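(* Let $A$ be a finite alphabet and let $F$ be a uniformly recurrent subset of $A^*$. Suppose that $Z\subseteq A^+$ is a rational bifix code of finite degree such that the semigroup $\eta_{Z^*}(A^+)$ is nil-simple, and let $X=Z\cap F$. The following conditions are equivalent: (1) $Z$ is $F$-charged; (2) $G_F(X)\simeq G(Z)$ and $X$ is weakly $F$-charged; (3) $|G_F(X)|=|G(Z)|$ and $X$ is weakly $F$-charged.
   Context: All alphabets are finite. $A^*$ is the free monoid on $A$, $1$ is the empty word, $A^+=A^*\setminus\{1\}$. A language is rational if it is recognized by a finite automaton. Codes. A nonempty $X\subseteq A^+$ is a prefix code if $X\cap XA^+=\emptyset$, a suffix code if $X\cap A^+X=\emptyset$, and a bifix code if it is both. Recurrent sets. $F\subseteq A^*$ is factorial if it contains every factor of each of its elements. A nonempty factorial set $F\neq\{1\}$ is recurrent if for all $u,v\in F$ there is $w\in F$ with $uwv\in F$. A recurrent set $F$ is uniformly recurrent if for every $u\in F$ there is a positive integer $n$ such that $u$ is a factor of every element of $F$ of length at least $n$. (When $F$ is uniformly recurrent and $Z$ is a rational bifix code of finite degree, it is known that $X=Z\cap F$ is a finite bifix code.) Degree. A parse of a word $w$ with respect to $Z\subseteq A^*$ is a triple $(v,x,u)$ with $w=vxu$, $v\in A^*\setminus A^*Z$, $x\in Z^*$, $u\in A^*\setminus ZA^*$; $\delta_Z(w)$ is the number of parses of $w$, and the degree of $Z$ is $\sup\{\delta_Z(w)\mid w\in A^*\}$. Free profinite monoid. $\widehat{A^*}$ is the free profinite monoid generated by $A$ (the profinite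 completion of $A^*$), a compact monoid containing $A^*$ as a dense submonoid; $\overline{Y}$ is the topological closure of $Y$ in $\widehat{A^*}$. If $F$ is recurrent, there is a unique regular $\mathcal J$-class $J(F)$ of $\widehat{A^*}$ contained in $\overline F$ such that $\overline F$ is the set of factors in $\widehat{A^*}$ of elements of $J(F)$. The maximal subgroups of a monoid are the $\mathcal H$-classes of its idempotents; those in the same regular $\mathcal D$-class are isomorphic, and the Schützenberger group of a regular $\mathcal D$-class is the (isomorphism class of the) group given by its maximal subgroups. (In profinite monoids $\mathcal J=\mathcal D$.) Syntactic monoids. For a rational language $L\subseteq A^*$, $M(L)$ is its (finite) syntactic monoid, $\eta_L\colon A^*\to M(L)$ the syntactic homomorphism, and $\hat\eta_L\colon\widehat{A^*}\to M(L)$ its unique continuous extension. For a rational code $Z$, $J(Z)$ is the minimum ideal of $M(Z^* )$ and $G(Z)$ is the Schützenberger group of $J(Z)$. For a rational code $X$ and a recurrent set $F$, $J_F(X)$ is the regular $\mathcal J$-class of $M(X^* )$ containing $\hat\eta_{X^*}(J(F))$, and $G_F(X)$ is the Schützenberger group of $J_F(X)$. Charged codes. A rational code $Z$ of $A^*$ is $F$-charged if $\hat\eta_{Z^*}$ maps all (equivalently, some) maximal subgroups of $J(F)$ onto maximal subgroups of $J(Z)$. A rational code $X$ contained in $F$ is weakly $F$-charged if $\hat\eta_{X^*}$ maps all (equivalently, some) maximal subgroups of $J(F)$ onto maximal subgroups of $J_F(X)$. A finite semigroup is nil-simple if all its idempotents lie in its minimum ideal. *)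

theory Defs
  imports
    "HOL-Analysis.Abstract_Topology"
    "HOL-Analysis.Function_Topology"
    "HOL-Algebra.Coset"
    "HOL-Library.Sublist"
    "HOL-Library.Extended_Nat"
begin

section \<open>Words, codes, recurrent sets\<close>

text \<open>
  The alphabet is a type \<^typ>\<open>'a\<close>, required to be finite in the theorem; words are lists.
\<close>

definition conc_lang :: "'a list set \<Rightarrow> 'a list set \<Rightarrow> 'a list set" (infixr \<open>\<cdot>\<close> 75)
  where "X \<cdot> Y = {x @ y | x y. x \<in> X \<and> y \<in> Y}"

definition star_lang :: "'a list set \<Rightarrow> 'a list set"
  where "star_lang X = concat ` lists X"

definition nonempty_words :: "'a list set"
  where "nonempty_words = {w. w \<noteq> []}"

record ('q, 'a) automaton =
  states :: "'q set"
  initial :: "'q set"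
  terminal :: "'q set"
  edges :: "('q \<times> 'a \<times> 'q) set"

definition finite_automaton :: "('q, 'a) automaton \<Rightarrow> bool"
  where "finite_automaton M \<longleftrightarrow> finite (states M) \<and>
    initial M \<subseteq> states M \<and> terminal M \<subseteq> states M \<and>
    edges M \<subseteq> states M \<times> UNIV \<times> states M"

inductive path :: "('q, 'a) automaton \<Rightarrow> 'q \<Rightarrow> 'a list \<Rightarrow> 'q \<Rightarrow> bool" for M
  where
    "p \<in> states M \<Longrightarrow> path M p [] p"
  | "(p, a, q) \<in> edges M \<Longrightarrow> path M q w r \<Longrightarrow> path M p (a # w) r"

definition recognized_lang :: "('q, 'a) automaton \<Rightarrow> 'a list set"
  where "recognized_lang M = {w. \<exists>i\<in>initial M. \<exists>t\<in>terminal M. path M i w t}"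

text \<open>
  Taking natural numbers as states loses no generality, since the set of states is finite.
\<close>

definition rational_lang :: "'a list set \<Rightarrow> bool"
  where "rational_lang L \<longleftrightarrow>
    (\<exists>M :: (nat, 'a) automaton. finite_automaton M \<and> recognized_lang M = L)"

definition prefix_code :: "'a list set \<Rightarrow> bool"
  where "prefix_code X \<longleftrightarrow> X \<noteq> {} \<and> X \<subseteq> nonempty_words \<and> X \<inter> X \<cdot> nonempty_words = {}"

definition suffix_code :: "'a list set \<Rightarrow> bool"
  where "suffix_code X \<longleftrightarrow> X \<noteq> {} \<and> X \<subseteq> nonempty_words \<and> X \<inter> nonempty_words \<cdot> X = {}"

definition bifix_code :: "'a list set \<Rightarrow> bool"
  where "bifix_code X \<longleftrightarrow> prefix_code X \<and> suffix_code X"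

definition factorial_lang :: "'a list set \<Rightarrow> bool"
  where "factorial_lang F \<longleftrightarrow> (\<forall>w\<in>F. \<forall>u. sublist u w \<longrightarrow> u \<in> F)"

definition recurrent :: "'a list set \<Rightarrow> bool"
  where "recurrent F \<longleftrightarrow> factorial_lang F \<and> F \<noteq> {} \<and> F \<noteq> {[]} \<and>
    (\<forall>u\<in>F. \<forall>v\<in>F. \<exists>w\<in>F. u @ w @ v \<in> F)"

definition uniformly_recurrent :: "'a list set \<Rightarrow> bool"
  where "uniformly_recurrent F \<longleftrightarrow> recurrent F \<and>
    (\<forall>u\<in>F. \<exists>n>0. \<forall>v\<in>F. n \<le> length v \<longrightarrow> sublist u v)"

definition parses :: "'a list set \<Rightarrow> 'a list \<Rightarrow> ('a list \<times> 'a list \<times> 'a list) set"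
  where "parses Z w = {(v, x, u). w = v @ x @ u \<and>
    v \<notin> UNIV \<cdot> Z \<and> x \<in> star_lang Z \<and> u \<notin> Z \<cdot> UNIV}"

definition degree :: "'a list set \<Rightarrow> enat"
  where "degree Z = (SUP w. enat (card (parses Z w)))"

section \<open>Semigroups, ideals and Green's relations\<close>

text \<open>
  A subsemigroup \<open>S\<close> of a monoid \<open>M\<close> is represented by the record \<open>M\<lparr>carrier := S\<rparr>\<close>.  The first
  three notions below do not refer to the neutral element, so they also apply to such semigroups.
\<close>

definition idempotents :: "('m, 'k) monoid_scheme \<Rightarrow> 'm set"
  where "idempotents S = {e \<in> carrier S. e \<otimes>\<^bsub>S\<^esub> e = e}"

text \<open>
  Every finite nonempty semigroup has a least nonempty ideal; it is the intersection of all
  nonempty ideals.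
\<close>

definition min_ideal :: "('m, 'k) monoid_scheme \<Rightarrow> 'm set"
  where "min_ideal S = \<Inter> {I. I \<noteq> {} \<and> I \<subseteq> carrier S \<and>
    (\<forall>x\<in>I. \<forall>s\<in>carrier S. s \<otimes>\<^bsub>S\<^esub> x \<in> I \<and> x \<otimes>\<^bsub>S\<^esub> s \<in> I)}"

definition nil_simple :: "('m, 'k) monoid_scheme \<Rightarrow> bool"
  where "nil_simple S \<longleftrightarrow> finite (carrier S) \<and> idempotents S \<subseteq> min_ideal S"

definition green_J :: "('m, 'k) monoid_scheme \<Rightarrow> ('m \<times> 'm) set"
  where "green_J M = {(x, y). x \<in> carrier M \<and> y \<in> carrier M \<and>
    {s \<otimes>\<^bsub>M\<^esub> x \<otimes>\<^bsub>M\<^esub> t | s t. s \<in> carrier M \<and> t \<in> carrier M} =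
    {s \<otimes>\<^bsub>M\<^esub> y \<otimes>\<^bsub>M\<^esub> t | s t. s \<in> carrier M \<and> t \<in> carrier M}}"

definition green_R :: "('m, 'k) monoid_scheme \<Rightarrow> ('m \<times> 'm) set"
  where "green_R M = {(x, y). x \<in> carrier M \<and> y \<in> carrier M \<and>
    {x \<otimes>\<^bsub>M\<^esub> t | t. t \<in> carrier M} = {y \<otimes>\<^bsub>M\<^esub> t | t. t \<in> carrier M}}"

definition green_L :: "('m, 'k) monoid_scheme \<Rightarrow> ('m \<times> 'm) set"
  where "green_L M = {(x, y). x \<in> carrier M \<and> y \<in> carrier M \<and>
    {s \<otimes>\<^bsub>M\<^esub> x | s. s \<in> carrier M} = {s \<otimes>\<^bsub>M\<^esub> y | s. s \<in> carrier M}}"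

definition green_H :: "('m, 'k) monoid_scheme \<Rightarrow> ('m \<times> 'm) set"
  where "green_H M = green_R M \<inter> green_L M"

definition regular_J_class :: "('m, 'k) monoid_scheme \<Rightarrow> 'm set \<Rightarrow> bool"
  where "regular_J_class M J \<longleftrightarrow> J \<in> carrier M // green_J M \<and> J \<inter> idempotents M \<noteq> {}"

text \<open>The maximal subgroups contained in a regular class \<open>J\<close>.\<close>

definition maximal_subgroups :: "('m, 'k) monoid_scheme \<Rightarrow> 'm set \<Rightarrow> 'm set set"
  where "maximal_subgroups M J = {green_H M `` {e} | e. e \<in> J \<inter> idempotents M}"

text \<open>
  The Schuetzenberger group is only defined up to isomorphism; we pick the maximal subgroup at
  some idempotent of \<open>J\<close>.
\<close>

definition schuetzenberger_group :: "('m, 'k) monoid_scheme \<Rightarrow> 'm set \<Rightarrow> 'm monoid"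
  where "schuetzenberger_group M J =
    (let e = SOME e. e \<in> J \<inter> idempotents M
     in \<lparr>carrier = green_H M `` {e}, mult = mult M, one = e\<rparr>)"

section \<open>Quotient monoids and the profinite completion\<close>

definition congruence :: "('m, 'k) monoid_scheme \<Rightarrow> ('m \<times> 'm) set \<Rightarrow> bool"
  where "congruence M r \<longleftrightarrow> equiv (carrier M) r \<and>
    (\<forall>(x, y)\<in>r. \<forall>(u, v)\<in>r. (x \<otimes>\<^bsub>M\<^esub> u, y \<otimes>\<^bsub>M\<^esub> v) \<in> r)"

text \<open>
  For a congruence \<open>r\<close>, all elements of \<open>C <#> D\<close> lie in one class, which is the product.
\<close>

definition quotient_monoid :: "('m, 'k) monoid_scheme \<Rightarrow> ('m \<times> 'm) set \<Rightarrow> 'm set monoid"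
  where "quotient_monoid M r =
    \<lparr>carrier = carrier M // r,
     mult = (\<lambda>C D. r `` (C <#>\<^bsub>M\<^esub> D)),
     one = r `` {\<one>\<^bsub>M\<^esub>}\<rparr>"

definition finite_congruences :: "('m, 'k) monoid_scheme \<Rightarrow> ('m \<times> 'm) set set"
  where "finite_congruences M = {r. congruence M r \<and> finite (carrier M // r)}"

text \<open>
  The profinite completion is the inverse limit of the quotients by the congruences of finite
  index, ordered by inclusion: for \<open>r \<subseteq> s\<close> the transition map sends an \<open>r\<close>-class to the \<open>s\<close>-class
  that contains it.
\<close>

definition profinite_completion ::
    "('m, 'k) monoid_scheme \<Rightarrow> (('m \<times> 'm) set \<Rightarrow> 'm set) monoid"
  where "profinite_completion M =
    \<lparr>carrier = {x \<in> \<Pi>\<^sub>E r\<in>finite_congruences M. carrier (quotient_monoid M r).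
        \<forall>r\<in>finite_congruences M. \<forall>s\<in>finite_congruences M. r \<subseteq> s \<longrightarrow> x r \<subseteq> x s},
     mult = (\<lambda>x y. \<lambda>r\<in>finite_congruences M. x r \<otimes>\<^bsub>quotient_monoid M r\<^esub> y r),
     one = (\<lambda>r\<in>finite_congruences M. \<one>\<^bsub>quotient_monoid M r\<^esub>)\<rparr>"

definition profinite_topology ::
    "('m, 'k) monoid_scheme \<Rightarrow> (('m \<times> 'm) set \<Rightarrow> 'm set) topology"
  where "profinite_topology M = subtopology
    (product_topology (\<lambda>r. discrete_topology (carrier (quotient_monoid M r)))
      (finite_congruences M))
    (carrier (profinite_completion M))"

definition profinite_embedding ::
    "('m, 'k) monoid_scheme \<Rightarrow> 'm \<Rightarrow> (('m \<times> 'm) set \<Rightarrow> 'm set)"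
  where "profinite_embedding M w = (\<lambda>r\<in>finite_congruences M. r `` {w})"

section \<open>The free profinite monoid\<close>

type_synonym 'a profinite_word = "('a list \<times> 'a list) set \<Rightarrow> 'a list set"

definition word_monoid :: "'a list monoid"
  where "word_monoid = \<lparr>carrier = UNIV, mult = (@), one = []\<rparr>"

abbreviation free_profinite :: "'a profinite_word monoid"
  where "free_profinite \<equiv> profinite_completion word_monoid"

definition profinite_closure :: "'a list set \<Rightarrow> 'a profinite_word set"
  where "profinite_closure Y =
    profinite_topology word_monoid closure_of (profinite_embedding word_monoid ` Y)"

definition J_class_of :: "'a list set \<Rightarrow> 'a profinite_word set"
  where "J_class_of F = (THE J. regular_J_class free_profinite J \<and>
    J \<subseteq> profinite_closure F \<and>
    profinite_closure F = {x \<in> carrier free_profinite.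
      \<exists>u\<in>carrier free_profinite. \<exists>v\<in>carrier free_profinite.
        u \<otimes>\<^bsub>free_profinite\<^esub> x \<otimes>\<^bsub>free_profinite\<^esub> v \<in> J})"

section \<open>Syntactic monoids and charged codes\<close>

definition syntactic_congruence :: "'a list set \<Rightarrow> ('a list \<times> 'a list) set"
  where "syntactic_congruence L = {(u, v). \<forall>x y. x @ u @ y \<in> L \<longleftrightarrow> x @ v @ y \<in> L}"

definition syntactic_monoid :: "'a list set \<Rightarrow> 'a list set monoid"
  where "syntactic_monoid L = quotient_monoid word_monoid (syntactic_congruence L)"

definition syntactic_hom :: "'a list set \<Rightarrow> 'a list \<Rightarrow> 'a list set"
  where "syntactic_hom L w = syntactic_congruence L `` {w}"

text \<open>
  The unique continuous extension of the syntactic homomorphism of a rational language to the free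
  profinite monoid, the finite syntactic monoid being discrete.  Extensionality makes it unique as
  a HOL function.
\<close>

definition syntactic_hom_ext :: "'a list set \<Rightarrow> 'a profinite_word \<Rightarrow> 'a list set"
  where "syntactic_hom_ext L = (THE f. f \<in> extensional (carrier free_profinite) \<and>
    continuous_map (profinite_topology word_monoid)
      (discrete_topology (carrier (syntactic_monoid L))) f \<and>
    (\<forall>w. f (profinite_embedding word_monoid w) = syntactic_hom L w))"

definition J_code :: "'a list set \<Rightarrow> 'a list set set"
  where "J_code Z = min_ideal (syntactic_monoid (star_lang Z))"

definition G_code :: "'a list set \<Rightarrow> 'a list set monoid"
  where "G_code Z = schuetzenberger_group (syntactic_monoid (star_lang Z)) (J_code Z)"

definition J_rel :: "'a list set \<Rightarrow> 'a list set \<Rightarrow> 'a list set set"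
  where "J_rel F X = (THE J. regular_J_class (syntactic_monoid (star_lang X)) J \<and>
    syntactic_hom_ext (star_lang X) ` J_class_of F \<subseteq> J)"

definition G_rel :: "'a list set \<Rightarrow> 'a list set \<Rightarrow> 'a list set monoid"
  where "G_rel F X = schuetzenberger_group (syntactic_monoid (star_lang X)) (J_rel F X)"

text \<open>
  The next two notions are meant for rational codes \<open>Z\<close>, and for rational codes \<open>X \<subseteq> F\<close>,
  respectively.
\<close>

definition charged :: "'a list set \<Rightarrow> 'a list set \<Rightarrow> bool"
  where "charged F Z \<longleftrightarrow>
    (\<forall>H\<in>maximal_subgroups free_profinite (J_class_of F).
      syntactic_hom_ext (star_lang Z) ` H
        \<in> maximal_subgroups (syntactic_monoid (star_lang Z)) (J_code Z))"

definition weakly_charged :: "'a list set \<Rightarrow> 'a list set \<Rightarrow> bool"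
  where "weakly_charged F X \<longleftrightarrow>
    (\<forall>H\<in>maximal_subgroups free_profinite (J_class_of F).
      syntactic_hom_ext (star_lang X) ` H
        \<in> maximal_subgroups (syntactic_monoid (star_lang X)) (J_rel F X))"

end

theory Submission
  imports Defs
begin

text \<open>
  Let \<open>H\<close> be the maximal subgroup of \<open>J(F)\<close> at an idempotent \<open>e\<close>, and let \<open>\<phi>\<^sub>Z\<close>, \<open>\<phi>\<^sub>X\<close> be the
  continuous extensions of the two syntactic homomorphisms.  Approximate \<open>e\<close> by a word \<open>u \<in> F\<close>
  longer than all words of the finite code \<open>X\<close>.  A factorization over \<open>X\<close> of a word containing
  \<open>u\<close> has a cut inside or at the end of \<open>u\<close>, and since \<open>Z\<close> is bifix the position of the cut is
  determined by any completion in \<open>Z\<^sup>*\<close>.  Hence the action of a word \<open>u v u\<close> on \<open>X\<^sup>*\<close> is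
  determined by its action on \<open>Z\<^sup>*\<close>, so \<open>\<phi>\<^sub>X\<close> factors through \<open>\<phi>\<^sub>Z\<close> on \<open>H\<close>.  Nil-simplicity puts
  \<open>\<phi>\<^sub>Z(e)\<close> in the minimum ideal, so \<open>\<phi>\<^sub>Z(H)\<close> lies in the group \<open>\<phi>\<^sub>Z(e) M(Z\<^sup>*) \<phi>\<^sub>Z(e)\<close>; if it is the
  whole group, transitivity gives the converse determination and \<open>\<phi>\<^sub>X(H)\<close> is maximal too.
  Counting gives the implication back.
\<close>

section \<open>Green's relations and maximal subgroups\<close>

text \<open>The obstacle is that membership in \<open>star_lang Z\<close> is tested in arbitrary
  contexts, whereas \<open>X\<close> only sees contexts that can be completed in
  \<open>star_lang X\<close>. From \<open>Z\<close> to \<open>X\<close> this is harmless, since a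
  context accepted by \<open>X\<close> is accepted by \<open>Z\<close>. In the other direction an
  arbitrary past has to be exchanged for one that \<open>X\<close> can read; surjectivity onto the
  group supplies it, because every word \<open>u m u\<close> then acts on \<open>star_lang Z\<close>
  like an element of \<open>H\<close>. Both ends of the representatives are the same
  \<open>u\<close> because \<open>h = e h e\<close>, and this confines the memory of the past to
  suffixes of one word. Finite degree is used twice: with uniform recurrence it bounds the words of
  \<open>X\<close>, and with recurrence it makes every word of \<open>F\<close> a prefix of a word
  of \<open>star_lang X\<close>. The objects of the statement are given by choice or definite
  description, so the class of \<open>F\<close>, the extended homomorphisms and the groups must
  first be identified; the groups only up to isomorphism. Limits in the profinite monoid are taken
  along an ultrafilter on the congruences of finite index, in place of a compactness
  argument.\<close>

definition group_at :: "('m, 'k) monoid_scheme \<Rightarrow> 'm \<Rightarrow> 'm monoid"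
  where "group_at M e = \<lparr>carrier = green_H M `` {e}, mult = mult M, one = e\<rparr>"

lemma schuetzenberger_group_eq_group_at:
  assumes "J \<inter> idempotents M \<noteq> {}"
  obtains e where "e \<in> J \<inter> idempotents M" "schuetzenberger_group M J = group_at M e"
proof -
  have "(SOME e. e \<in> J \<inter> idempotents M) \<in> J \<inter> idempotents M"
    using assms by (meson ex_in_conv someI)
  then show ?thesis
    using that by (simp add: schuetzenberger_group_def group_at_def Let_def)
qed

lemma equiv_same_image: "equiv A {(x, y). x \<in> A \<and> y \<in> A \<and> f x = f y}"
  by (rule equivI) (auto simp: refl_on_def sym_def trans_def)

context monoid
begin

lemma green_R_iff:
  "(x, y) \<in> green_R G \<longleftrightarrow> x \<in> carrier G \<and> y \<in> carrier G \<and>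
    (\<exists>t\<in>carrier G. y = x \<otimes> t) \<and> (\<exists>t\<in>carrier G. x = y \<otimes> t)" (is "?l \<longleftrightarrow> ?r")
proof
  assume l: ?l
  then have c: "x \<in> carrier G" "y \<in> carrier G"
    and eq: "{x \<otimes> t | t. t \<in> carrier G} = {y \<otimes> t | t. t \<in> carrier G}"
    by (auto simp: green_R_def)
  have "y \<in> {y \<otimes> t | t. t \<in> carrier G}" "x \<in> {x \<otimes> t | t. t \<in> carrier G}"
    using c by (metis (mono_tags, lifting) mem_Collect_eq one_closed r_one)+
  then show ?r using c eq by blast
next
  have sub: "{x \<otimes> t | t. t \<in> carrier G} \<subseteq> {y \<otimes> t | t. t \<in> carrier G}"
    if "y \<in> carrier G" "p \<in> carrier G" "x = y \<otimes> p" for x y p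
    using that by (auto simp: m_assoc)
  assume ?r
  then have "{x \<otimes> t | t. t \<in> carrier G} = {y \<otimes> t | t. t \<in> carrier G}"
    by (elim conjE bexE) (intro equalityI sub; assumption)
  then show ?l using \<open>?r\<close> by (simp add: green_R_def)
qed

lemma green_L_iff:
  "(x, y) \<in> green_L G \<longleftrightarrow> x \<in> carrier G \<and> y \<in> carrier G \<and>
    (\<exists>t\<in>carrier G. y = t \<otimes> x) \<and> (\<exists>t\<in>carrier G. x = t \<otimes> y)" (is "?l \<longleftrightarrow> ?r")
proof
  assume l: ?l
  then have c: "x \<in> carrier G" "y \<in> carrier G"
    and eq: "{t \<otimes> x | t. t \<in> carrier G} = {t \<otimes> y | t. t \<in> carrier G}"
    by (auto simp: green_L_def)
  have "y \<in> {t \<otimes> y | t. t \<in> carrier G}" "x \<in> {t \<otimes> x | t. t \<in> carrier G}"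
    using c by (metis (mono_tags, lifting) mem_Collect_eq one_closed l_one)+
  then show ?r using c eq by blast
next
  have sub: "{t \<otimes> x | t. t \<in> carrier G} \<subseteq> {t \<otimes> y | t. t \<in> carrier G}"
    if "y \<in> carrier G" "p \<in> carrier G" "x = p \<otimes> y" for x y p
    using that by (auto simp: m_assoc[symmetric])
  assume ?r
  then have "{t \<otimes> x | t. t \<in> carrier G} = {t \<otimes> y | t. t \<in> carrier G}"
    by (elim conjE bexE) (intro equalityI sub; assumption)
  then show ?l using \<open>?r\<close> by (simp add: green_L_def)
qed

lemma green_J_iff:
  "(x, y) \<in> green_J G \<longleftrightarrow> x \<in> carrier G \<and> y \<in> carrier G \<and>
    (\<exists>s\<in>carrier G. \<exists>t\<in>carrier G. y = s \<otimes> x \<otimes> t) \<and>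
    (\<exists>s\<in>carrier G. \<exists>t\<in>carrier G. x = s \<otimes> y \<otimes> t)" (is "?l \<longleftrightarrow> ?r")
proof
  assume l: ?l
  then have c: "x \<in> carrier G" "y \<in> carrier G"
    and eq: "{s \<otimes> x \<otimes> t | s t. s \<in> carrier G \<and> t \<in> carrier G} =
      {s \<otimes> y \<otimes> t | s t. s \<in> carrier G \<and> t \<in> carrier G}"
    by (auto simp: green_J_def)
  have "y = \<one> \<otimes> y \<otimes> \<one>" "x = \<one> \<otimes> x \<otimes> \<one>"
    using c by auto
  then have "y \<in> {s \<otimes> y \<otimes> t | s t. s \<in> carrier G \<and> t \<in> carrier G}"
    "x \<in> {s \<otimes> x \<otimes> t | s t. s \<in> carrier G \<and> t \<in> carrier G}"
    by blast+
  then show ?r using c eq by blast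
next
  have sub: "{s \<otimes> x \<otimes> t | s t. s \<in> carrier G \<and> t \<in> carrier G} \<subseteq>
      {s \<otimes> y \<otimes> t | s t. s \<in> carrier G \<and> t \<in> carrier G}"
    if "y \<in> carrier G" "p \<in> carrier G" "q \<in> carrier G" "x = p \<otimes> y \<otimes> q" for x y p q
  proof safe
    fix s t assume st: "s \<in> carrier G" "t \<in> carrier G"
    have "s \<otimes> x \<otimes> t = (s \<otimes> p) \<otimes> y \<otimes> (q \<otimes> t)"
      using that st by (simp add: m_assoc)
    then show "\<exists>s' t'. s \<otimes> x \<otimes> t = s' \<otimes> y \<otimes> t' \<and> s' \<in> carrier G \<and> t' \<in> carrier G"
      using st that by (metis m_closed)
  qed
  assume ?r
  then obtain p q p' q' where pq: "p \<in> carrier G" "q \<in> carrier G" "p' \<in> carrier G" "q' \<in> carrier G"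
    "x \<in> carrier G" "y \<in> carrier G" "y = p \<otimes> x \<otimes> q" "x = p' \<otimes> y \<otimes> q'"
    by blast
  have "{s \<otimes> x \<otimes> t | s t. s \<in> carrier G \<and> t \<in> carrier G} =
      {s \<otimes> y \<otimes> t | s t. s \<in> carrier G \<and> t \<in> carrier G}"
    by (intro equalityI sub[of y p' q' x] sub[of x p q y]) (use pq in blast)+
  then show ?l using pq(5,6) by (simp add: green_J_def)
qed

lemma equiv_green_J: "equiv (carrier G) (green_J G)"
  unfolding green_J_def by (rule equiv_same_image)

lemma green_H_idempotent_iff:
  assumes "e \<in> idempotents G"
  shows "y \<in> green_H G `` {e} \<longleftrightarrow> y \<in> carrier G \<and> e \<otimes> y = y \<and> y \<otimes> e = y \<and>
    (\<exists>z\<in>carrier G. y \<otimes> z = e) \<and> (\<exists>z\<in>carrier G. z \<otimes> y = e)"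
proof -
  have e: "e \<in> carrier G" "e \<otimes> e = e" using assms by (auto simp: idempotents_def)
  show ?thesis (is "?l \<longleftrightarrow> ?r")
  proof
    assume ?l
    then have R: "(e, y) \<in> green_R G" and L: "(e, y) \<in> green_L G"
      by (simp_all add: green_H_def)
    obtain t t' where t: "y \<in> carrier G" "t \<in> carrier G" "y = e \<otimes> t" "t' \<in> carrier G" "e = y \<otimes> t'"
      using R unfolding green_R_iff by blast
    obtain s s' where s: "s \<in> carrier G" "y = s \<otimes> e" "s' \<in> carrier G" "e = s' \<otimes> y"
      using L unfolding green_L_iff by blast
    have "e \<otimes> y = y"
      unfolding t(3) m_assoc[OF e(1) e(1) t(2), symmetric] e(2) ..
    moreover have "y \<otimes> e = y"
      unfolding s(2) m_assoc[OF s(1) e(1) e(1)] e(2) ..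
    moreover note t(1) t(4) t(5)[symmetric] s(3) s(4)[symmetric]
    ultimately show ?r by blast
  next
    assume ?r
    then have "y \<in> carrier G" "y = e \<otimes> y" "y = y \<otimes> e" "\<exists>z\<in>carrier G. e = y \<otimes> z" "\<exists>z\<in>carrier G. e = z \<otimes> y"
      by (blast intro: sym)+
    then have "(e, y) \<in> green_R G" "(e, y) \<in> green_L G"
      unfolding green_R_iff green_L_iff using e(1) by blast+
    then show ?l
      by (simp add: green_H_def)
  qed
qed

lemma idempotent_in_green_H: "e \<in> idempotents G \<Longrightarrow> e \<in> green_H G `` {e}"
  by (auto simp: green_H_def green_R_def green_L_def idempotents_def)

text \<open>A right inverse \<open>p\<close> and a left inverse \<open>q\<close> relative to
  \<open>e\<close> agree after cutting down to \<open>e\<close>, since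
  \<open>e p = q y p = q e\<close>; the common value is the inverse inside the class.\<close>

lemma green_H_inverses:
  assumes e: "e \<in> idempotents G" and y: "y \<in> green_H G `` {e}"
  shows "\<exists>z\<in>green_H G `` {e}. y \<otimes> z = e \<and> z \<otimes> y = e"
proof -
  have ec: "e \<in> carrier G" "e \<otimes> e = e" using e by (auto simp: idempotents_def)
  obtain p q where yc: "y \<in> carrier G" "e \<otimes> y = y" "y \<otimes> e = y"
    and p: "p \<in> carrier G" "y \<otimes> p = e" and q: "q \<in> carrier G" "q \<otimes> y = e"
    using y green_H_idempotent_iff[OF e] by auto
  have eq: "e \<otimes> p = q \<otimes> e"
    using p q yc ec by (metis m_assoc)
  have z1: "q \<otimes> e \<in> carrier G" "(q \<otimes> e) \<otimes> e = q \<otimes> e" "(q \<otimes> e) \<otimes> y = e"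
    using q yc ec by (simp_all add: m_assoc)
  have z2: "y \<otimes> (q \<otimes> e) = e"
    unfolding eq[symmetric] using p yc ec by (simp add: m_assoc[symmetric])
  have z3: "e \<otimes> (q \<otimes> e) = q \<otimes> e"
    unfolding eq[symmetric] using p ec by (simp add: m_assoc[symmetric])
  note z = z1 z2 z3
  then have "q \<otimes> e \<in> green_H G `` {e}"
    using green_H_idempotent_iff[OF e] yc by blast
  then show ?thesis using z by blast
qed

lemma green_H_mult:
  assumes e: "e \<in> idempotents G" and "x \<in> green_H G `` {e}" "y \<in> green_H G `` {e}"
  shows "x \<otimes> y \<in> green_H G `` {e}"
proof -
  have ec: "e \<in> carrier G" "e \<otimes> e = e" using e by (auto simp: idempotents_def)
  have xy: "x \<in> carrier G" "e \<otimes> x = x" "x \<otimes> e = x" "y \<in> carrier G" "e \<otimes> y = y" "y \<otimes> e = y"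
    using assms green_H_idempotent_iff[OF e] by auto
  obtain x' where x': "x' \<in> carrier G" "x \<otimes> x' = e" "x' \<otimes> x = e"
    using green_H_inverses[OF e assms(2)] green_H_idempotent_iff[OF e] by blast
  obtain y' where y': "y' \<in> carrier G" "y \<otimes> y' = e" "y' \<otimes> y = e"
    using green_H_inverses[OF e assms(3)] green_H_idempotent_iff[OF e] by blast
  have "(x \<otimes> y) \<otimes> (y' \<otimes> x') = x \<otimes> (y \<otimes> y') \<otimes> x'"
    using xy(1,4) x'(1) y'(1) by (simp add: m_assoc)
  also have "\<dots> = e" using xy x' y' by simp
  finally have 1: "(x \<otimes> y) \<otimes> (y' \<otimes> x') = e" .
  have "(y' \<otimes> x') \<otimes> (x \<otimes> y) = y' \<otimes> (x' \<otimes> x) \<otimes> y"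
    using xy(1,4) x'(1) y'(1) by (simp add: m_assoc)
  also have "\<dots> = y' \<otimes> (e \<otimes> y)" unfolding x'(3) using xy(4) y'(1) ec(1) by (simp add: m_assoc)
  also have "\<dots> = e" using xy y' by simp
  finally have 2: "(y' \<otimes> x') \<otimes> (x \<otimes> y) = e" .
  have 3: "e \<otimes> (x \<otimes> y) = x \<otimes> y" "(x \<otimes> y) \<otimes> e = x \<otimes> y"
    using xy ec m_assoc[of e x y] m_assoc[of x y e] by simp_all
  have "x \<otimes> y \<in> carrier G" "y' \<otimes> x' \<in> carrier G"
    using xy x' y' by simp_all
  then show ?thesis
    unfolding green_H_idempotent_iff[OF e]
    using 1 2 3 by blast
qed

lemma green_H_idempotent_unique:
  assumes e: "e \<in> idempotents G" and f: "f \<in> idempotents G" and "f \<in> green_H G `` {e}"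
  shows "f = e"
proof -
  obtain z where "z \<in> carrier G" "f \<otimes> z = e"
    using assms green_H_idempotent_iff[OF e] by auto
  moreover have "f \<in> carrier G" "f \<otimes> f = f" "f \<otimes> e = f"
    using assms green_H_idempotent_iff[OF e] by (auto simp: idempotents_def)
  ultimately show ?thesis by (metis m_assoc)
qed

text \<open>Since \<open>p q = e\<close>, left multiplication by \<open>q\<close> is injective on
  the finite set of elements fixed by \<open>e\<close> on the left, hence surjective there; a
  preimage \<open>x\<close> of \<open>e\<close> satisfies \<open>x = p e = p\<close>.\<close>

lemma finite_local_inverse:
  assumes fin: "finite (carrier G)"
    and pq: "p \<in> carrier G" "q \<in> carrier G" "e \<otimes> p = p" "p \<otimes> e = p" "e \<otimes> q = q" "q \<otimes> e = q"
    and e: "e \<in> idempotents G" and eq: "p \<otimes> q = e"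
  shows "q \<otimes> p = e"
proof -
  let ?S = "{x \<in> carrier G. e \<otimes> x = x}"
  have ec: "e \<in> carrier G" "e \<otimes> e = e" using e by (auto simp: idempotents_def)
  have inv: "p \<otimes> (q \<otimes> x) = x" if "x \<in> ?S" for x
    using that pq eq by (simp add: m_assoc[symmetric])
  have "(\<lambda>x. q \<otimes> x) ` ?S \<subseteq> ?S"
    using pq ec by (auto simp: m_assoc[symmetric])
  moreover have "inj_on (\<lambda>x. q \<otimes> x) ?S"
    using inv by (metis (no_types, lifting) inj_onI)
  ultimately have "(\<lambda>x. q \<otimes> x) ` ?S = ?S"
    using fin by (simp add: endo_inj_surj)
  moreover have "e \<in> ?S" using ec by simp
  ultimately obtain x where x: "x \<in> ?S" "e = q \<otimes> x" by blast
  have "x = p \<otimes> e" using inv[OF x(1)] x(2) by simp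
  then have "x = p" using pq by simp
  then show ?thesis using x by simp
qed

end

text \<open>
  With \<open>e = x f y\<close> the elements \<open>a = e x f\<close> and \<open>b = f y e\<close> satisfy \<open>a b = e\<close>; finiteness forces
  \<open>b a = f\<close>, so \<open>h \<mapsto> b h a\<close> is an isomorphism.
\<close>

lemma (in monoid) group_at_iso:
  assumes fin: "finite (carrier G)" and e: "e \<in> idempotents G" and f: "f \<in> idempotents G"
    and J: "(e, f) \<in> green_J G"
  shows "group_at G e \<cong> group_at G f"
proof -
  have ec: "e \<in> carrier G" "e \<otimes> e = e" and fc: "f \<in> carrier G" "f \<otimes> f = f"
    using e f by (auto simp: idempotents_def)
  obtain x y p q where xy: "x \<in> carrier G" "y \<in> carrier G" "e = x \<otimes> f \<otimes> y"
    and pq: "p \<in> carrier G" "q \<in> carrier G" "f = p \<otimes> e \<otimes> q"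
    using J unfolding green_J_iff by blast
  define a where "a = e \<otimes> x \<otimes> f"
  define b where "b = f \<otimes> y \<otimes> e"
  have ac: "a \<in> carrier G" and bc: "b \<in> carrier G"
    using xy(1,2) ec fc by (auto simp: a_def b_def)
  have a: "e \<otimes> a = a" "a \<otimes> f = a" and b: "f \<otimes> b = b" "b \<otimes> e = b"
    using xy(1,2) ec fc by (auto simp: a_def b_def m_assoc)
      (simp_all add: m_assoc[symmetric])
  have "a \<otimes> b = e \<otimes> (x \<otimes> (f \<otimes> f) \<otimes> y) \<otimes> e"
    using xy(1,2) ec(1) fc(1) unfolding a_def b_def by (simp add: m_assoc)
  also have "\<dots> = e" unfolding fc(2) xy(3)[symmetric] using ec by simp
  finally have ab: "a \<otimes> b = e" .
  define g where "g = b \<otimes> a"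
  have gc: "g \<in> carrier G" and fg: "f \<otimes> g = g" "g \<otimes> f = g"
    using ac bc a b fc by (auto simp: g_def m_assoc) (simp add: m_assoc[symmetric])
  have "g \<otimes> g = b \<otimes> (a \<otimes> b) \<otimes> a"
    using ac bc by (simp add: g_def m_assoc)
  then have gg: "g \<otimes> g = g" using ab b by (simp add: g_def)
  have "a \<otimes> g \<otimes> b = (a \<otimes> b) \<otimes> (a \<otimes> b)"
    using ac bc by (simp add: g_def m_assoc)
  then have agb: "a \<otimes> g \<otimes> b = e" by (simp add: ab ec)
  have f_eq: "f \<otimes> (p \<otimes> (a \<otimes> g \<otimes> b) \<otimes> q) \<otimes> f = f"
    unfolding agb pq(3)[symmetric] by (simp add: fc)
  \<comment> \<open>So far \<open>g = b a\<close> is only an idempotent below \<open>f\<close>.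
    Because \<open>f = p e q\<close> and \<open>e = a g b\<close>, the idempotent \<open>f\<close>
    splits as \<open>p1 q1\<close> inside its local monoid, with \<open>g q1 = q1\<close>. Commuting
    the factors gives \<open>f = q1 p1\<close>, hence \<open>g f = f\<close> and so
    \<open>g = f\<close>.\<close>
  define p1 where "p1 = f \<otimes> p \<otimes> a \<otimes> g"
  define q1 where "q1 = g \<otimes> b \<otimes> q \<otimes> f"
  have c1: "p1 \<in> carrier G" "q1 \<in> carrier G"
    using pq(1,2) ac bc gc fc by (auto simp: p1_def q1_def)
  have "p1 \<otimes> q1 = f \<otimes> (p \<otimes> (a \<otimes> (g \<otimes> g) \<otimes> b) \<otimes> q) \<otimes> f"
    using pq(1,2) ac bc gc fc(1) by (simp add: p1_def q1_def m_assoc)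
  then have p1q1: "p1 \<otimes> q1 = f" using f_eq gg by simp
  have "q1 \<otimes> p1 = f"
  proof (rule finite_local_inverse[OF fin c1 _ _ _ _ f p1q1])
    show "f \<otimes> p1 = p1" "p1 \<otimes> f = p1" "f \<otimes> q1 = q1" "q1 \<otimes> f = q1"
      using pq(1,2) ac bc gc fc fg by (simp_all add: p1_def q1_def m_assoc)
        (simp_all add: m_assoc[symmetric])
  qed
  moreover have "g \<otimes> q1 = q1"
    using pq(1,2) ac bc gc fc gg unfolding q1_def by (simp add: m_assoc[symmetric])
  ultimately have "g \<otimes> f = f" using gc c1 by (metis m_assoc)
  then have ba: "b \<otimes> a = f" using fg g_def by simp
  define h where "h z = b \<otimes> z \<otimes> a" for z
  define k where "k z = a \<otimes> z \<otimes> b" for z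
  have h_in: "h z \<in> green_H G `` {f}" and kh: "k (h z) = z" if z: "z \<in> green_H G `` {e}" for z
  proof -
    have zc: "z \<in> carrier G" "e \<otimes> z = z" "z \<otimes> e = z"
      using z green_H_idempotent_iff[OF e] by auto
    obtain w where w: "w \<in> carrier G" "z \<otimes> w = e" "w \<otimes> z = e" "e \<otimes> w = w"
      using green_H_inverses[OF e z] green_H_idempotent_iff[OF e] by blast
    have hh: "h x \<otimes> h y = h (x \<otimes> y)" if "x \<in> carrier G" "y \<in> carrier G" "e \<otimes> y = y" for x y
    proof -
      have "h x \<otimes> h y = b \<otimes> x \<otimes> (a \<otimes> b) \<otimes> y \<otimes> a"
        using that ac bc by (simp add: h_def m_assoc)
      also have "\<dots> = b \<otimes> x \<otimes> (e \<otimes> y) \<otimes> a"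
        unfolding ab using that(1,2) ac bc ec(1) by (simp add: m_assoc)
      also have "\<dots> = h (x \<otimes> y)" using that ac bc by (simp add: h_def m_assoc)
      finally show ?thesis .
    qed
    have he: "h e = f" using ba b by (simp add: h_def)
    have "h z \<otimes> h w = f" "h w \<otimes> h z = f"
      using hh zc w he by simp_all
    moreover have "f \<otimes> h z = h z" "h z \<otimes> f = h z"
      using a b ac bc fc zc unfolding h_def by (simp_all add: m_assoc) (simp add: m_assoc[symmetric])
    moreover have "h z \<in> carrier G" "h w \<in> carrier G" using ac bc zc w by (auto simp: h_def)
    ultimately show "h z \<in> green_H G `` {f}"
      unfolding green_H_idempotent_iff[OF f] by blast
    have "k (h z) = (a \<otimes> b) \<otimes> z \<otimes> (a \<otimes> b)"
      using zc ac bc by (simp add: h_def k_def m_assoc)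
    then show "k (h z) = z" using ab zc by simp
  qed
  have k_in: "k z \<in> green_H G `` {e}" and hk: "h (k z) = z" if z: "z \<in> green_H G `` {f}" for z
  proof -
    have zc: "z \<in> carrier G" "f \<otimes> z = z" "z \<otimes> f = z"
      using z green_H_idempotent_iff[OF f] by auto
    obtain w where w: "w \<in> carrier G" "z \<otimes> w = f" "w \<otimes> z = f" "f \<otimes> w = w"
      using green_H_inverses[OF f z] green_H_idempotent_iff[OF f] by blast
    have kk: "k x \<otimes> k y = k (x \<otimes> y)" if "x \<in> carrier G" "y \<in> carrier G" "f \<otimes> y = y" for x y
    proof -
      have "k x \<otimes> k y = a \<otimes> x \<otimes> (b \<otimes> a) \<otimes> y \<otimes> b"
        using that ac bc by (simp add: k_def m_assoc)
      also have "\<dots> = a \<otimes> x \<otimes> (f \<otimes> y) \<otimes> b"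
        unfolding ba using that(1,2) ac bc fc(1) by (simp add: m_assoc)
      also have "\<dots> = k (x \<otimes> y)" using that ac bc by (simp add: k_def m_assoc)
      finally show ?thesis .
    qed
    have ke: "k f = e" using ab a by (simp add: k_def)
    have "k z \<otimes> k w = e" "k w \<otimes> k z = e"
      using kk zc w ke by simp_all
    moreover have "e \<otimes> k z = k z" "k z \<otimes> e = k z"
      using a b ac bc ec zc unfolding k_def by (simp_all add: m_assoc) (simp add: m_assoc[symmetric])
    moreover have "k z \<in> carrier G" "k w \<in> carrier G" using ac bc zc w by (auto simp: k_def)
    ultimately show "k z \<in> green_H G `` {e}"
      unfolding green_H_idempotent_iff[OF e] by blast
    have "h (k z) = (b \<otimes> a) \<otimes> z \<otimes> (b \<otimes> a)"
      using zc ac bc by (simp add: h_def k_def m_assoc)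
    then show "h (k z) = z" using ba zc by simp
  qed
  have "bij_betw h (green_H G `` {e}) (green_H G `` {f})"
    by (rule bij_betw_byWitness[of _ k]) (use h_in kh k_in hk in auto)
  moreover have "h (z \<otimes> w) = h z \<otimes> h w"
    if "z \<in> green_H G `` {e}" "w \<in> green_H G `` {e}" for z w
  proof -
    have zw: "z \<in> carrier G" "w \<in> carrier G" "e \<otimes> w = w"
      using that green_H_idempotent_iff[OF e] by auto
    have "h z \<otimes> h w = b \<otimes> z \<otimes> ((a \<otimes> b) \<otimes> w) \<otimes> a"
      using zw ac bc by (simp add: h_def m_assoc)
    then show ?thesis using ab zw ac bc by (simp add: h_def m_assoc)
  qed
  ultimately have "h \<in> iso (group_at G e) (group_at G f)"
    using h_in by (auto simp: iso_def hom_def group_at_def)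
  then show ?thesis by (rule is_isoI)
qed

section \<open>The minimum ideal and its local groups\<close>

context monoid
begin

text \<open>The products \<open>s y t\<close> form a nonempty two-sided ideal, which therefore
  contains the minimum ideal.\<close>

lemma min_ideal_factor:
  assumes e: "e \<in> min_ideal G" and y: "y \<in> carrier G"
  shows "\<exists>s\<in>carrier G. \<exists>t\<in>carrier G. e = s \<otimes> y \<otimes> t"
proof -
  let ?I = "{s \<otimes> y \<otimes> t | s t. s \<in> carrier G \<and> t \<in> carrier G}"
  have "\<one> \<otimes> y \<otimes> \<one> \<in> ?I" by blast
  then have 1: "?I \<noteq> {}" by blast
  have 2: "?I \<subseteq> carrier G"
    using y by (blast intro: m_closed)
  have 3: "r \<otimes> x \<in> ?I \<and> x \<otimes> r \<in> ?I" if x: "x \<in> ?I" and r: "r \<in> carrier G" for x r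
  proof -
    obtain s t where st: "s \<in> carrier G" "t \<in> carrier G" "x = s \<otimes> y \<otimes> t"
      using x by blast
    have "r \<otimes> x = (r \<otimes> s) \<otimes> y \<otimes> t" "x \<otimes> r = s \<otimes> y \<otimes> (t \<otimes> r)"
      using st y r by (simp_all add: m_assoc)
    moreover have "r \<otimes> s \<in> carrier G" "t \<otimes> r \<in> carrier G"
      using st r by simp_all
    ultimately show ?thesis using st(1,2) by blast
  qed
  have "?I \<in> {I. I \<noteq> {} \<and> I \<subseteq> carrier G \<and>
      (\<forall>x\<in>I. \<forall>s\<in>carrier G. s \<otimes> x \<in> I \<and> x \<otimes> s \<in> I)}"
    using 1 2 3 by blast
  then have "e \<in> ?I"
    using e unfolding min_ideal_def by (rule InterD[rotated])
  then show ?thesis by blast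
qed

lemma min_ideal_subset: "min_ideal G \<subseteq> carrier G"
  unfolding min_ideal_def by (rule Inter_lower) auto

lemma min_ideal_green_J:
  "e \<in> min_ideal G \<Longrightarrow> f \<in> min_ideal G \<Longrightarrow> (e, f) \<in> green_J G"
  unfolding green_J_iff
  using min_ideal_factor min_ideal_subset by blast

text \<open>By minimality \<open>e\<close> is a multiple \<open>s x t\<close> of
  \<open>x = e y e\<close>. The outer factors can be moved into the local monoid at
  \<open>e\<close>, where finiteness makes one-sided inverses two-sided; the inverse of
  \<open>x\<close> is \<open>t' s'\<close>.\<close>

lemma min_ideal_local_group:
  assumes fin: "finite (carrier G)" and e: "e \<in> min_ideal G" "e \<in> idempotents G"
    and y: "y \<in> carrier G"
  shows "e \<otimes> y \<otimes> e \<in> green_H G `` {e}"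
proof -
  have ec: "e \<in> carrier G" "e \<otimes> e = e" using e by (auto simp: idempotents_def)
  define x where "x = e \<otimes> y \<otimes> e"
  have x: "x \<in> carrier G" "e \<otimes> x = x" "x \<otimes> e = x"
    using ec y by (auto simp: x_def m_assoc) (simp add: m_assoc[symmetric])
  obtain s t where st: "s \<in> carrier G" "t \<in> carrier G" "e = s \<otimes> x \<otimes> t"
    using min_ideal_factor[OF e(1) x(1)] by blast
  define s' where "s' = e \<otimes> s \<otimes> e"
  define t' where "t' = e \<otimes> t \<otimes> e"
  have s': "s' \<in> carrier G" "e \<otimes> s' = s'" "s' \<otimes> e = s'" and t': "t' \<in> carrier G" "e \<otimes> t' = t'" "t' \<otimes> e = t'"
    using ec st(1,2) by (auto simp: s'_def t'_def m_assoc) (simp_all add: m_assoc[symmetric])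
  have "s' \<otimes> x \<otimes> t' = e \<otimes> s \<otimes> (e \<otimes> x \<otimes> e) \<otimes> t \<otimes> e"
    using ec(1) st(1,2) x(1) by (simp add: s'_def t'_def m_assoc)
  also have "\<dots> = e \<otimes> (s \<otimes> x \<otimes> t) \<otimes> e" using x ec(1) st(1,2) by (simp add: m_assoc)
  also have "\<dots> = e" unfolding st(3)[symmetric] by (simp add: ec)
  finally have eq: "s' \<otimes> x \<otimes> t' = e" .
  have xt: "x \<otimes> t' \<in> carrier G" "e \<otimes> (x \<otimes> t') = x \<otimes> t'" "(x \<otimes> t') \<otimes> e = x \<otimes> t'"
    and sx: "s' \<otimes> x \<in> carrier G" "e \<otimes> (s' \<otimes> x) = s' \<otimes> x" "(s' \<otimes> x) \<otimes> e = s' \<otimes> x"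
    using x s' t' ec m_assoc[of e x t'] m_assoc[of x t' e] m_assoc[of e s' x] m_assoc[of s' x e]
    by simp_all
  have eq': "s' \<otimes> (x \<otimes> t') = e"
    using eq x s' t' by (simp add: m_assoc)
  have 1: "x \<otimes> t' \<otimes> s' = e"
    by (rule finite_local_inverse[OF fin s'(1) xt(1) s'(2,3) xt(2,3) e(2) eq'])
  have 2: "t' \<otimes> (s' \<otimes> x) = e"
    by (rule finite_local_inverse[OF fin sx(1) t'(1) sx(2,3) t'(2,3) e(2) eq])
  have "x \<otimes> (t' \<otimes> s') = e" "(t' \<otimes> s') \<otimes> x = e" "t' \<otimes> s' \<in> carrier G"
    using 1 2 x s' t' by (auto simp: m_assoc)
  then show ?thesis
    using x unfolding x_def[symmetric] green_H_idempotent_iff[OF e(2)] by blast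
qed

end

lemma regular_J_class_iff:
  assumes "monoid M"
  shows "regular_J_class M J \<longleftrightarrow> (\<exists>e\<in>idempotents M. J = green_J M `` {e})"
proof -
  interpret monoid M by fact
  show ?thesis
  proof
    assume "regular_J_class M J"
    then obtain e where J: "J \<in> carrier M // green_J M" and e: "e \<in> J" "e \<in> idempotents M"
      by (auto simp: regular_J_class_def)
    have "green_J M `` {e} = J"
      using J e equiv_green_J by (metis Image_singleton_iff equiv_class_eq_iff quotientE)
    then show "\<exists>e\<in>idempotents M. J = green_J M `` {e}" using e by blast
  next
    assume "\<exists>e\<in>idempotents M. J = green_J M `` {e}"
    then obtain e where e: "e \<in> idempotents M" "J = green_J M `` {e}" by blast
    then have ec: "e \<in> carrier M" by (simp add: idempotents_def)
    then have "e \<in> J" using e equiv_class_self[OF equiv_green_J] by blast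
    then show "regular_J_class M J"
      using e ec by (auto simp: regular_J_class_def intro: quotientI)
  qed
qed

section \<open>Words over bifix codes\<close>

lemma Nil_in_star [simp]: "[] \<in> star_lang X"
  unfolding star_lang_def by (rule image_eqI[of _ _ "[]"]) auto

lemma star_Cons: "x \<in> X \<Longrightarrow> y \<in> star_lang X \<Longrightarrow> x @ y \<in> star_lang X"
  unfolding star_lang_def by (elim imageE, rule image_eqI[of _ _ "x # z" for z]) auto

lemma star_induct [consumes 1, case_names Nil append]:
  assumes "w \<in> star_lang X" "P []" "\<And>x y. x \<in> X \<Longrightarrow> y \<in> star_lang X \<Longrightarrow> P y \<Longrightarrow> P (x @ y)"
  shows "P w"
proof -
  obtain xs where "xs \<in> lists X" "w = concat xs"
    using assms(1) by (auto simp: star_lang_def)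
  moreover have "concat xs \<in> star_lang X \<and> P (concat xs)" if "xs \<in> lists X" for xs
    using that
  proof (induction xs)
    case Nil
    show ?case using assms(2) by simp
  next
    case (Cons x xs)
    then show ?case using assms(3)[of x "concat xs"] star_Cons[of x X] by simp
  qed
  ultimately show ?thesis by simp
qed

lemma star_nonemptyE:
  assumes "w \<in> star_lang X" "w \<noteq> []"
  obtains x y where "w = x @ y" "x \<in> X" "y \<in> star_lang X"
proof -
  have "w = [] \<or> (\<exists>x y. w = x @ y \<and> x \<in> X \<and> y \<in> star_lang X)"
    using assms(1) by (induction rule: star_induct) auto
  then show ?thesis using assms(2) that by blast
qed

lemma star_append: "x \<in> star_lang X \<Longrightarrow> y \<in> star_lang X \<Longrightarrow> x @ y \<in> star_lang X"
  by (induction rule: star_induct) (auto intro: star_Cons)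

lemma star_base: "x \<in> X \<Longrightarrow> x \<in> star_lang X"
  using star_Cons[of x X "[]"] by simp

lemma star_mono: "X \<subseteq> Y \<Longrightarrow> star_lang X \<subseteq> star_lang Y"
  unfolding star_lang_def by (intro image_mono lists_mono)

text \<open>The cut is the last boundary of the factorization inside \<open>p\<close>; what remains
  of \<open>p\<close> is a proper prefix of the codeword that crosses the end of
  \<open>p\<close>.\<close>

lemma star_append_split:
  assumes "p @ y \<in> star_lang X"
  shows "\<exists>c s. p = c @ s \<and> c \<in> star_lang X \<and> s @ y \<in> star_lang X \<and>
    (s = [] \<or> (\<exists>t. t \<noteq> [] \<and> s @ t \<in> X))"
  using assms
proof (induction "p @ y" arbitrary: p y rule: star_induct)
  case Nil
  then show ?case by (intro exI[of _ "[]"]) simp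
next
  case (append x w)
  from \<open>x @ w = p @ y\<close> consider d where "x @ d = p" "w = d @ y" | d where "x = p @ d" "y = d @ w" "d \<noteq> []"
    unfolding append_eq_append_conv2 by force
  then show ?case
  proof cases
    case 1
    then obtain c s where cs: "d = c @ s" "c \<in> star_lang X" "s @ y \<in> star_lang X"
      "s = [] \<or> (\<exists>t. t \<noteq> [] \<and> s @ t \<in> X)"
      using append.hyps(3)[of d y] by blast
    have "x @ c \<in> star_lang X"
      using \<open>x \<in> X\<close> cs(2) by (rule star_Cons)
    moreover have "p = (x @ c) @ s" using 1 cs by simp
    ultimately show ?thesis using cs by blast
  next
    case 2
    have "p @ y \<in> star_lang X"
      using star_Cons[OF \<open>x \<in> X\<close> \<open>w \<in> star_lang X\<close>] \<open>x @ w = p @ y\<close> by simp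
    moreover have "\<exists>t. t \<noteq> [] \<and> p @ t \<in> X"
      using 2 \<open>x \<in> X\<close> by blast
    ultimately show ?thesis by (intro exI[of _ "[]"] exI[of _ p]) simp
  qed
qed

lemma bifix_code_subset:
  assumes "bifix_code Z" "X \<subseteq> Z"
  shows "x \<in> X \<Longrightarrow> x \<noteq> []"
    and "x \<in> X \<Longrightarrow> x @ k \<in> X \<Longrightarrow> k = []"
    and "x \<in> X \<Longrightarrow> k @ x \<in> X \<Longrightarrow> k = []"
proof -
  have Z: "Z \<subseteq> nonempty_words" "Z \<inter> Z \<cdot> nonempty_words = {}" "Z \<inter> nonempty_words \<cdot> Z = {}"
    using assms(1) by (simp_all add: bifix_code_def prefix_code_def suffix_code_def)
  show "x \<in> X \<Longrightarrow> x \<noteq> []"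
    using Z(1) assms(2) by (auto simp: nonempty_words_def)
  show "k = []" if x: "x \<in> X" "x @ k \<in> X"
  proof (rule ccontr)
    assume "k \<noteq> []"
    then have "x @ k \<in> Z \<cdot> nonempty_words"
      using x assms(2) unfolding conc_lang_def nonempty_words_def by blast
    then show False using Z(2) x assms(2) by blast
  qed
  show "k = []" if x: "x \<in> X" "k @ x \<in> X"
  proof (rule ccontr)
    assume "k \<noteq> []"
    then have "k @ x \<in> nonempty_words \<cdot> Z"
      using x assms(2) unfolding conc_lang_def nonempty_words_def by blast
    then show False using Z(3) x assms(2) by blast
  qed
qed

text \<open>Two factorizations of the same word begin with the same codeword, because neither first
  codeword can be a proper prefix of the other; codewords are thus removed one at a time.\<close>

lemma star_prefix_cancel:
  assumes Z: "bifix_code Z" "X \<subseteq> Z" and "c \<in> star_lang X" "c @ y \<in> star_lang X"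
  shows "y \<in> star_lang X"
  using assms(3,4)
proof (induction rule: star_induct)
  case Nil
  then show ?case by simp
next
  case (append x w)
  let ?v = "w @ y"
  have "\<exists>x' w'. x @ ?v = x' @ w' \<and> x' \<in> X \<and> w' \<in> star_lang X"
  proof -
    have "x @ ?v \<in> star_lang X" using append.prems by simp
    moreover have "x \<noteq> []" using append.hyps bifix_code_subset[OF Z] by blast
    ultimately show ?thesis
      by (metis Nil_is_append_conv star_nonemptyE)
  qed
  then obtain x' w' where xw: "x @ ?v = x' @ w'" "x' \<in> X" "w' \<in> star_lang X" by blast
  from xw(1) obtain k where "x @ k = x' \<or> x = x' @ k"
    unfolding append_eq_append_conv2 by blast
  then have "x' = x"
    using xw(2) \<open>x \<in> X\<close> bifix_code_subset(2)[OF Z, of x k] bifix_code_subset(2)[OF Z, of x' k]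
    by (elim disjE) simp_all
  then have "?v \<in> star_lang X" using xw by simp
  then show ?case using append.IH by simp
qed

lemma star_rev_append_cases:
  assumes "w \<in> star_lang X" "w \<noteq> []"
  shows "\<exists>y x. w = y @ x \<and> x \<in> X \<and> y \<in> star_lang X"
  using assms
proof (induction rule: star_induct)
  case Nil
  then show ?case by simp
next
  case (append x w)
  show ?case
  proof (cases "w = []")
    case True
    then show ?thesis using append.hyps by (intro exI[of _ "[]"] exI[of _ x]) simp
  next
    case False
    then obtain y x' where "w = y @ x'" "x' \<in> X" "y \<in> star_lang X"
      using append.IH by blast
    then show ?thesis
      by (intro exI[of _ "x @ y"] exI[of _ x']) (simp add: star_Cons append.hyps)
  qed
qed

lemma star_suffix_cancel:
  assumes Z: "bifix_code Z" "X \<subseteq> Z" and "c \<in> star_lang X" "y @ c \<in> star_lang X"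
  shows "y \<in> star_lang X"
  using assms(3,4)
proof (induction c arbitrary: y rule: length_induct)
  case (1 c)
  show ?case
  proof (cases "c = []")
    case True
    then show ?thesis using 1 by simp
  next
    case False
    obtain w x where c: "c = w @ x" "x \<in> X" "w \<in> star_lang X"
      using star_rev_append_cases[of c X] 1(2) False by blast
    obtain w' x' where yc: "y @ c = w' @ x'" "x' \<in> X" "w' \<in> star_lang X"
      using star_rev_append_cases[of "y @ c" X] 1(3) False by blast
    have "(y @ w) @ x = w' @ x'" using c yc by simp
    then obtain k where "x = k @ x' \<or> x' = k @ x"
      unfolding append_eq_append_conv2 by blast
    then have "x' = x"
      using yc(2) c(2) bifix_code_subset(3)[OF Z, of x k] bifix_code_subset(3)[OF Z, of x' k]
      by (elim disjE) simp_all
    then have "y @ w \<in> star_lang X" using c yc by simp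
    moreover have "length w < length c"
      using c bifix_code_subset(1)[OF Z] by simp
    ultimately show ?thesis using 1(1) c by blast
  qed
qed

text \<open>A codeword crossing the end of \<open>u\<close> is no longer than \<open>u\<close>, so
  it begins inside \<open>u\<close>. The remainder \<open>s\<close>, being empty or a proper prefix
  of a codeword, has no prefix in \<open>Z\<close>; this normal form is what makes \<open>s\<close>
  recognizable from its completions.\<close>

lemma star_append_cut:
  assumes Z: "bifix_code Z" and XZ: "X \<subseteq> Z" and len: "\<forall>z\<in>X. length z \<le> length u"
    and xuy: "x @ u @ y \<in> star_lang X"
  shows "\<exists>c s. x @ u = c @ s \<and> c \<in> star_lang X \<and> suffix s u \<and> s \<notin> Z \<cdot> UNIV \<and> s @ y \<in> star_lang X"
proof -
  obtain c s where cs: "x @ u = c @ s" "c \<in> star_lang X" "s @ y \<in> star_lang X"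
    "s = [] \<or> (\<exists>t. t \<noteq> [] \<and> s @ t \<in> X)"
    using star_append_split[of "x @ u" y X] xuy by auto
  have "length s \<le> length u"
    using cs(4) len by (auto dest: bspec)
  moreover have "suffix s (x @ u)"
    unfolding cs(1) suffix_def by blast
  moreover have "suffix u (x @ u)"
    unfolding suffix_def by blast
  ultimately have "suffix s u"
    using suffix_length_suffix by blast
  moreover have "s \<notin> Z \<cdot> UNIV"
  proof
    assume "s \<in> Z \<cdot> UNIV"
    then obtain z k where zk: "z \<in> Z" "s = z @ k" by (auto simp: conc_lang_def)
    have "z \<noteq> []" using bifix_code_subset(1)[OF Z order_refl] zk by blast
    then obtain t where "t \<noteq> []" "z @ k @ t \<in> Z" using cs(4) zk XZ by auto
    then show False using bifix_code_subset(2)[OF Z order_refl] zk by blast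
  qed
  ultimately show ?thesis using cs by blast
qed

text \<open>Of two suffixes of \<open>u\<close> one is a suffix of the other, say
  \<open>s' = r s\<close>. Cancelling \<open>s y\<close> puts \<open>r\<close> in
  \<open>star_lang Z\<close>, and a nonempty \<open>r\<close> would give \<open>s'\<close> a prefix
  in \<open>Z\<close>.\<close>

lemma suffix_completion_unique:
  assumes Z: "bifix_code Z" and s: "suffix s u" "s \<notin> Z \<cdot> UNIV" "s @ y \<in> star_lang Z"
    and s': "suffix s' u" "s' \<notin> Z \<cdot> UNIV" "s' @ y \<in> star_lang Z"
  shows "s = s'"
proof -
  have *: "s = s'" if "suffix s s'" "s @ y \<in> star_lang Z" "s' \<notin> Z \<cdot> UNIV" "s' @ y \<in> star_lang Z" for s s'
  proof -
    from that(1) obtain r where r: "s' = r @ s" by (auto simp: suffix_def)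
    have r': "r \<in> star_lang Z"
      using star_suffix_cancel[OF Z order_refl that(2), of r] that(4) r by simp
    have "r = []"
    proof (rule ccontr)
      assume "r \<noteq> []"
      then obtain x y where "r = x @ y" "x \<in> Z"
        using r' by (metis star_nonemptyE)
      then have "s' \<in> Z \<cdot> UNIV" using r by (auto simp: conc_lang_def)
      then show False using that by simp
    qed
    then show ?thesis using r by simp
  qed
  have "suffix s s' \<or> suffix s' s"
    using s(1) s'(1) by (metis suffix_same_cases)
  then show ?thesis using *[of s s'] *[of s' s] s s' by blast
qed

section \<open>Exchange between the actions on \<open>star_lang Z\<close> and on
  \<open>star_lang X\<close>\<close>

lemma syntactic_congruenceD:
  "(u, v) \<in> syntactic_congruence L \<Longrightarrow> x @ u @ y \<in> L \<longleftrightarrow> x @ v @ y \<in> L"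
  by (auto simp: syntactic_congruence_def)

text \<open>
  After reading \<open>u\<close>, the only trace of the past is the suffix of \<open>u\<close> that begins the next word of
  \<open>X\<close>; since \<open>Z\<close> is bifix, this suffix is determined by any of its completions, so it can be read
  off from the action of \<open>u v u\<close> on \<open>Z\<^sup>*\<close> as well.
\<close>

lemma syntactic_transfer_to_subcode:
  assumes Z: "bifix_code Z" and XZ: "X \<subseteq> Z" and len: "\<forall>z\<in>X. length z \<le> length u"
    and SZ: "(u @ v @ u, u @ v' @ u) \<in> syntactic_congruence (star_lang Z)"
    and b: "(u @ v' @ u @ b, u) \<in> syntactic_congruence (star_lang X)"
    and xy: "x @ u @ v @ u @ y \<in> star_lang X"
  shows "x @ u @ v' @ u @ y \<in> star_lang X"
proof -
  note cut = star_append_cut[OF Z XZ len]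
  note cancel = star_prefix_cancel[OF Z XZ] and cancel_Z = star_prefix_cancel[OF Z order_refl]
  note sub = star_mono[OF XZ, THEN subsetD]
  obtain c s where cs: "x @ u = c @ s" "c \<in> star_lang X" "s @ v @ u @ y \<in> star_lang X"
    using cut[of x "v @ u @ y"] xy by auto
  have step: "x @ u @ w = c @ s @ w" for w
    using cs(1) by (metis append_assoc)
  obtain c' s' where c's': "s @ v @ u = c' @ s'" "c' \<in> star_lang X" "suffix s' u"
    "s' \<notin> Z \<cdot> UNIV" "s' @ y \<in> star_lang X"
    using cut[of "s @ v" y] cs(3) by auto
  \<comment> \<open>Following \<open>u v' u\<close> by \<open>b\<close> has the effect of
    \<open>u\<close> alone, so \<open>x u v' u\<close> has a completion in
    \<open>star_lang X\<close> and a cut in its second \<open>u\<close> can be taken. Without it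
    only membership in \<open>star_lang Z\<close> would be available.\<close>
  have "x @ (u @ v' @ u @ b) @ v @ u @ y \<in> star_lang X"
    unfolding syntactic_congruenceD[OF b] using xy by simp
  then have "c @ s @ v' @ u @ b @ v @ u @ y \<in> star_lang X"
    by (simp add: step)
  then have "s @ v' @ u @ b @ v @ u @ y \<in> star_lang X"
    by (rule cancel[OF cs(2)])
  then obtain c'' s'' where c''s'': "s @ v' @ u = c'' @ s''" "c'' \<in> star_lang X" "suffix s'' u"
    "s'' \<notin> Z \<cdot> UNIV"
    using cut[of "s @ v'" "b @ v @ u @ y"] by auto
  have step'': "s @ v' @ u @ w = c'' @ s'' @ w" for w
    using c''s''(1) by (metis append_assoc)
  have "x @ (u @ v' @ u) @ y \<in> star_lang Z"
    using syntactic_congruenceD[OF SZ, of x y] sub[OF xy] by simp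
  then have "c @ c'' @ s'' @ y \<in> star_lang Z"
    by (simp add: step step'')
  then have "s'' @ y \<in> star_lang Z"
    by (rule cancel_Z[OF sub[OF c''s''(2)] cancel_Z[OF sub[OF cs(2)]]])
  then have "s' = s''"
    using suffix_completion_unique[OF Z c's'(3,4) sub[OF c's'(5)] c''s''(3,4)] by simp
  then show ?thesis
    using c's'(5) cs(2) c''s''(2) by (simp add: step step'' star_append)
qed

text \<open>
  Every state \<open>x u\<close> can be reached from the fixed completable state \<open>u\<close> through a word that the
  hypothesis \<open>trans\<close> allows to choose completable in \<open>X\<^sup>*\<close>, so the past in \<open>Z\<^sup>*\<close> may again be
  replaced by a suffix of \<open>u\<close>.
\<close>

lemma syntactic_transfer_from_subcode:
  assumes Z: "bifix_code Z" and XZ: "X \<subseteq> Z" and len: "\<forall>z\<in>X. length z \<le> length u"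
    and t0: "u @ t0 \<in> star_lang X"
    and trans: "\<And>m. \<exists>w b. (u @ m @ u, w @ u) \<in> syntactic_congruence (star_lang Z) \<and>
      (w @ u @ b, u) \<in> syntactic_congruence (star_lang X)"
    and SX: "(u @ v @ u, u @ v' @ u) \<in> syntactic_congruence (star_lang X)"
    and b: "(u @ v @ u @ b, u) \<in> syntactic_congruence (star_lang X)"
    and xy: "x @ u @ v @ u @ y \<in> star_lang Z"
  shows "x @ u @ v' @ u @ y \<in> star_lang Z"
proof -
  note cut = star_append_cut[OF Z XZ len]
  note cancel = star_prefix_cancel[OF Z XZ] and cancel_Z = star_prefix_cancel[OF Z order_refl]
  note sub = star_mono[OF XZ, THEN subsetD]
  obtain w b' where wZ: "(u @ (t0 @ x) @ u, w @ u) \<in> syntactic_congruence (star_lang Z)"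
    and wX: "(w @ u @ b', u) \<in> syntactic_congruence (star_lang X)"
    using trans[of "t0 @ x"] by blast
  \<comment> \<open>The prefix \<open>u t0\<close> can be added and cancelled freely, so the
    unrestricted past \<open>x u\<close> acts on \<open>star_lang Z\<close> like \<open>w u\<close>,
    which is completable in \<open>star_lang X\<close>.\<close>
  have xw: "x @ u @ k \<in> star_lang Z \<longleftrightarrow> w @ u @ k \<in> star_lang Z" for k
  proof -
    have "x @ u @ k \<in> star_lang Z \<longleftrightarrow> (u @ t0) @ x @ u @ k \<in> star_lang Z"
      using star_append[OF sub[OF t0]] cancel_Z[OF sub[OF t0]] by blast
    then show ?thesis using syntactic_congruenceD[OF wZ, of "[]" k] by simp
  qed
  \<comment> \<open>A common completion for both words: \<open>b\<close> leads from
    \<open>w u v u\<close> back to \<open>w u\<close>, \<open>b'\<close> from \<open>w u\<close> to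
    \<open>u\<close>, and \<open>t0\<close> ends in \<open>star_lang X\<close>. The hypothesis
    \<open>SX\<close> carries it over to \<open>v'\<close>.\<close>
  define t where "t = b @ b' @ t0"
  have "w @ (u @ v @ u @ b) @ b' @ t0 \<in> star_lang X"
    unfolding syntactic_congruenceD[OF b] using syntactic_congruenceD[OF wX, of "[]" t0] t0 by simp
  then have w1: "w @ u @ v @ u @ t \<in> star_lang X" by (simp add: t_def)
  have w2: "w @ u @ v' @ u @ t \<in> star_lang X"
    using syntactic_congruenceD[OF SX, of w t] w1 by simp
  obtain c s where cs: "w @ u = c @ s" "c \<in> star_lang X" "s @ v @ u @ t \<in> star_lang X"
    using cut[of w "v @ u @ t"] w1 by auto
  have step: "w @ u @ k = c @ s @ k" for k
    using cs(1) by (metis append_assoc)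
  obtain c' s' where c's': "s @ v @ u = c' @ s'" "c' \<in> star_lang X" "suffix s' u"
    "s' \<notin> Z \<cdot> UNIV" "s' @ t \<in> star_lang X"
    using cut[of "s @ v" t] cs(3) by auto
  have step': "s @ v @ u @ k = c' @ s' @ k" for k
    using c's'(1) by (metis append_assoc)
  have "c @ s @ v' @ u @ t \<in> star_lang X"
    using w2 by (simp add: step)
  then have "s @ v' @ u @ t \<in> star_lang X"
    by (rule cancel[OF cs(2)])
  then obtain c'' s'' where c''s'': "s @ v' @ u = c'' @ s''" "c'' \<in> star_lang X" "suffix s'' u"
    "s'' \<notin> Z \<cdot> UNIV" "s'' @ t \<in> star_lang X"
    using cut[of "s @ v'" t] by auto
  have step'': "s @ v' @ u @ k = c'' @ s'' @ k" for k
    using c''s''(1) by (metis append_assoc)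
  have eq: "s' = s''"
    using suffix_completion_unique[OF Z c's'(3,4) sub[OF c's'(5)] c''s''(3,4) sub[OF c''s''(5)]] .
  have "w @ u @ v @ u @ y \<in> star_lang Z" using xy xw by simp
  then have "c @ c' @ s' @ y \<in> star_lang Z"
    by (simp add: step step')
  then have "s' @ y \<in> star_lang Z"
    by (rule cancel_Z[OF sub[OF c's'(2)] cancel_Z[OF sub[OF cs(2)]]])
  then have "w @ u @ v' @ u @ y \<in> star_lang Z"
    using sub[OF cs(2)] sub[OF c''s''(2)] eq by (simp add: step step'' star_append)
  then show ?thesis using xw by simp
qed

section \<open>Parses and finite degree\<close>

lemma ex_suffix_parse:
  assumes "u \<notin> Z \<cdot> UNIV" "prefix_code Z"
  shows "\<exists>v x. w @ u = v @ x @ u \<and> v \<notin> UNIV \<cdot> Z \<and> x \<in> star_lang Z"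
proof (induction w rule: length_induct)
  case (1 w)
  show ?case
  proof (cases "w \<in> UNIV \<cdot> Z")
    case True
    \<comment> \<open>Codewords are stripped from the end of \<open>w\<close> as long as possible;
      those removed make up the middle component of the parse.\<close>
    then obtain w' z where w: "w = w' @ z" "z \<in> Z" by (auto simp: conc_lang_def)
    have "z \<noteq> []" using assms(2) w by (auto simp: prefix_code_def nonempty_words_def)
    then have "length w' < length w" using w by simp
    then obtain v x where vx: "w' @ u = v @ x @ u" "v \<notin> UNIV \<cdot> Z" "x \<in> star_lang Z"
      using 1 by blast
    have "w @ u = v @ (x @ z) @ u" using vx(1) w by simp
    then show ?thesis using vx w star_append[OF vx(3) star_base[OF w(2)]] by blast
  next
    case False
    then show ?thesis by (intro exI[of _ w] exI[of _ "[]"]) simp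
  qed
qed

lemma finite_parses: "finite (parses Z w)"
proof -
  have "parses Z w \<subseteq> {v. length v \<le> length w \<and> set v \<subseteq> set w} \<times>
      {v. length v \<le> length w \<and> set v \<subseteq> set w} \<times> {v. length v \<le> length w \<and> set v \<subseteq> set w}"
    by (auto simp: parses_def)
  moreover have "finite {v. length v \<le> length w \<and> set v \<subseteq> set w}"
    using finite_lists_length_le[of "set w" "length w"] by (simp add: conj_commute)
  ultimately show ?thesis by (meson finite_SigmaI finite_subset)
qed

text \<open>Each of these suffixes is the last component of some parse of \<open>w\<close>, so there
  are at most as many of them as parses.\<close>

lemma card_suffixes_le_degree:
  assumes "prefix_code Z"
  shows "enat (card {u. suffix u w \<and> u \<notin> Z \<cdot> UNIV}) \<le> degree Z"
proof -
  have "{u. suffix u w \<and> u \<notin> Z \<cdot> UNIV} \<subseteq> (\<lambda>(v, x, u). u) ` parses Z w"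
  proof safe
    fix u assume u: "suffix u w" "u \<notin> Z \<cdot> UNIV"
    then obtain p where "w = p @ u" by (auto simp: suffix_def)
    then obtain v x where "w = v @ x @ u" "v \<notin> UNIV \<cdot> Z" "x \<in> star_lang Z"
      using ex_suffix_parse[OF u(2) assms, of p] by auto
    then have "(v, x, u) \<in> parses Z w" using u by (simp add: parses_def)
    then show "u \<in> (\<lambda>(v, x, u). u) ` parses Z w" by force
  qed
  then have "card {u. suffix u w \<and> u \<notin> Z \<cdot> UNIV} \<le> card (parses Z w)"
    using finite_parses by (rule surj_card_le[rotated])
  also have "enat (card (parses Z w)) \<le> degree Z"
    unfolding degree_def by (rule SUP_upper) simp
  finally show ?thesis by simp
qed

text \<open>Finite degree bounds the number of suffixes without prefix in \<open>Z\<close>, and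
  \<open>m\<close> maximizes this number over \<open>F\<close>. A proper left extension
  \<open>b m\<close> in \<open>F\<close> without prefix in \<open>Z\<close> would itself be one
  suffix more.\<close>

lemma ex_parse_maximal_word:
  assumes "prefix_code Z" "degree Z \<noteq> \<infinity>" "F \<noteq> {}"
  shows "\<exists>m\<in>F. \<forall>b. b \<noteq> [] \<and> b @ m \<in> F \<longrightarrow> b @ m \<in> Z \<cdot> UNIV"
proof -
  let ?S = "\<lambda>w. {u. suffix u w \<and> u \<notin> Z \<cdot> UNIV}"
  obtain d where "degree Z = enat d" using assms(2) by auto
  then have bound: "card (?S w) < Suc d" for w
    using card_suffixes_le_degree[OF assms(1), of w] by simp
  obtain w0 where "w0 \<in> F" using assms(3) by blast
  then have "\<exists>m. m \<in> F \<and> (\<forall>w. w \<in> F \<longrightarrow> card (?S w) \<le> card (?S m))"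
    using bound less_imp_le by (intro ex_has_greatest_nat[of _ w0 _ "Suc d"]) blast+
  then obtain m where m: "m \<in> F" "\<And>w. w \<in> F \<Longrightarrow> card (?S w) \<le> card (?S m)"
    by blast
  have "b @ m \<in> Z \<cdot> UNIV" if b: "b \<noteq> []" "b @ m \<in> F" for b
  proof (rule ccontr)
    assume "b @ m \<notin> Z \<cdot> UNIV"
    then have sub: "insert (b @ m) (?S m) \<subseteq> ?S (b @ m)"
      by (auto intro: suffix_appendI)
    have fin: "finite (?S w)" for w
      by (rule finite_subset[of _ "set (suffixes w)"]) auto
    have "card (insert (b @ m) (?S m)) \<le> card (?S (b @ m))"
      by (rule card_mono[OF fin sub])
    moreover have "b @ m \<notin> ?S m"
      using b by (auto dest: suffix_length_le)
    ultimately have "card (?S m) < card (?S (b @ m))"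
      using fin by simp
    then show False using m(2)[OF b(2)] by simp
  qed
  then show ?thesis using m by blast
qed

lemma factorial_langD:
  "factorial_lang F \<Longrightarrow> x @ y @ z \<in> F \<Longrightarrow> y \<in> F"
  unfolding factorial_lang_def by (meson sublist_appendI)

text \<open>A long word of \<open>F\<close> contains the maximal word \<open>m\<close> away from
  both ends. The part that ends with this occurrence starts with a codeword, which would be a proper
  prefix of the long word if that were a codeword too.\<close>

lemma finite_code_in_uniformly_recurrent:
  fixes F Z :: "'a::finite list set"
  assumes F: "uniformly_recurrent F" and Z: "bifix_code Z" and d: "degree Z \<noteq> \<infinity>"
  shows "\<exists>n. \<forall>z\<in>Z \<inter> F. length z \<le> n"
proof -
  have fac: "factorial_lang F" and "F \<noteq> {}"
    using F by (auto simp: uniformly_recurrent_def recurrent_def)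
  then obtain m where m: "m \<in> F" "\<forall>b. b \<noteq> [] \<and> b @ m \<in> F \<longrightarrow> b @ m \<in> Z \<cdot> UNIV"
    using ex_parse_maximal_word[of Z F] Z d by (auto simp: bifix_code_def)
  have "\<exists>n>0. \<forall>v\<in>F. n \<le> length v \<longrightarrow> sublist m v"
    using F m(1) by (simp add: uniformly_recurrent_def)
  then obtain n where n: "\<And>v. v \<in> F \<Longrightarrow> n \<le> length v \<Longrightarrow> sublist m v"
    by blast
  \<comment> \<open>The bound \<open>n + 1\<close> leaves \<open>n\<close> letters after removing
    both ends: the first letter makes the left extension of \<open>m\<close> nonempty, the last one
    makes the resulting prefix proper.\<close>
  have "length z \<le> n + 1" if z: "z \<in> Z" "z \<in> F" for z
  proof (rule ccontr)
    assume len: "\<not> length z \<le> n + 1"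
    then obtain a y where ay: "z = a # y" "n + 1 \<le> length y" by (cases z) auto
    then obtain v c where vc: "y = v @ [c]" by (cases y rule: rev_cases) auto
    have zv: "z = [a] @ v @ [c]" using ay vc by simp
    then have "v \<in> F" using z(2) factorial_langD[OF fac] by metis
    then have "sublist m v" using n ay vc by simp
    then obtain p q where v: "v = p @ m @ q" by (auto simp: sublist_def)
    have "([] @ ((a # p) @ m) @ (q @ [c])) \<in> F" using z(2) zv v by simp
    then have "(a # p) @ m \<in> F" by (rule factorial_langD[OF fac])
    then have "(a # p) @ m \<in> Z \<cdot> UNIV" using m(2) by blast
    then obtain z' k where zk: "z' \<in> Z" "(a # p) @ m = z' @ k" by (auto simp: conc_lang_def)
    have "z = z' @ (k @ q @ [c])"
      using zv v zk(2) by (metis append.assoc append_Cons append_Nil)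
    then show False
      using bifix_code_subset(2)[OF Z order_refl zk(1), of "k @ q @ [c]"] z(1) by simp
  qed
  then show ?thesis by blast
qed

text \<open>Codewords are split off from the left of \<open>p m\<close> until the rest is no longer
  than \<open>m\<close>. For \<open>p = u b\<close> the part split off covers \<open>u b\<close>,
  and its codewords lie in \<open>F\<close> by factoriality.\<close>

lemma ex_completion_in_star:
  fixes F Z :: "'a::finite list set"
  assumes F: "recurrent F" and Z: "bifix_code Z" and d: "degree Z \<noteq> \<infinity>" and u: "u \<in> F"
  shows "\<exists>t. u @ t \<in> star_lang (Z \<inter> F)"
proof -
  have fac: "factorial_lang F" and "F \<noteq> {}"
    using F by (auto simp: recurrent_def)
  then obtain m where m: "m \<in> F" "\<And>b. b \<noteq> [] \<Longrightarrow> b @ m \<in> F \<Longrightarrow> b @ m \<in> Z \<cdot> UNIV"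
    using ex_parse_maximal_word[of Z F] Z d by (auto simp: bifix_code_def)
  have parse: "\<exists>x k. p @ m = x @ k \<and> x \<in> star_lang (Z \<inter> F) \<and> length k \<le> length m" if "p @ m \<in> F" for p
    using that
  proof (induction p rule: length_induct)
    case (1 p)
    show ?case
    proof (cases "p = []")
      case True
      then show ?thesis by (intro exI[of _ "[]"] exI[of _ m]) simp
    next
      case False
      then have "p @ m \<in> Z \<cdot> UNIV" using m 1 by blast
      then obtain z k where zk: "z \<in> Z" "p @ m = z @ k" by (auto simp: conc_lang_def)
      have "[] @ z @ k \<in> F" "z @ k @ [] \<in> F" using 1 zk by simp_all
      then have zF: "z \<in> Z \<inter> F" and kF: "k \<in> F" using factorial_langD[OF fac] zk by blast+
      show ?thesis
      proof (cases "length k \<le> length m")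
        case True
        then show ?thesis using zk star_base[OF zF] by blast
      next
        case False
        then obtain p' where p': "k = p' @ m" "p = z @ p'"
          using zk(2) unfolding append_eq_append_conv2 by auto
        have "z \<noteq> []" using bifix_code_subset(1)[OF Z order_refl] zk by blast
        then have "length p' < length p" using p' by simp
        then obtain x k' where xk: "p' @ m = x @ k'" "x \<in> star_lang (Z \<inter> F)" "length k' \<le> length m"
          using 1(1) p'(1) kF by blast
        then have "p @ m = (z @ x) @ k'" using p'(2) by simp
        then show ?thesis using star_Cons[OF zF xk(2)] xk(3) by blast
      qed
    qed
  qed
  obtain b where b: "u @ b @ m \<in> F" using F u m(1) by (auto simp: recurrent_def)
  then obtain x k where xk: "(u @ b) @ m = x @ k" "x \<in> star_lang (Z \<inter> F)" "length k \<le> length m"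
    using parse[of "u @ b"] by auto
  then obtain t where "x = (u @ b) @ t"
    unfolding append_eq_append_conv2 by auto
  then show ?thesis using xk by auto
qed

section \<open>Congruences of finite index on words\<close>

abbreviation word_congruences :: "('a list \<times> 'a list) set set"
  where "word_congruences \<equiv> finite_congruences word_monoid"

lemma congruence_word_monoid_iff:
  "congruence word_monoid r \<longleftrightarrow>
    equiv UNIV r \<and> (\<forall>x y u v. (x, y) \<in> r \<longrightarrow> (u, v) \<in> r \<longrightarrow> (x @ u, y @ v) \<in> r)"
  by (auto simp: congruence_def word_monoid_def)

lemma word_congruence_iff:
  "r \<in> word_congruences \<longleftrightarrow> equiv UNIV r \<and>
    (\<forall>x y u v. (x, y) \<in> r \<longrightarrow> (u, v) \<in> r \<longrightarrow> (x @ u, y @ v) \<in> r) \<and> finite (UNIV // r)"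
  by (simp add: finite_congruences_def congruence_word_monoid_iff) (simp add: word_monoid_def)

lemma word_congruenceD:
  assumes "r \<in> word_congruences"
  shows "congruence word_monoid r" "equiv UNIV r" "finite (UNIV // r)"
    and "(x, y) \<in> r \<Longrightarrow> (u, v) \<in> r \<Longrightarrow> (x @ u, y @ v) \<in> r"
    and "(x, x) \<in> r" and "(x, y) \<in> r \<Longrightarrow> (y, x) \<in> r" and "(x, y) \<in> r \<Longrightarrow> (y, z) \<in> r \<Longrightarrow> (x, z) \<in> r"
proof -
  show c: "congruence word_monoid r" "equiv UNIV r" "finite (UNIV // r)"
    and "(x, y) \<in> r \<Longrightarrow> (u, v) \<in> r \<Longrightarrow> (x @ u, y @ v) \<in> r"
    using assms by (auto simp: word_congruence_iff congruence_word_monoid_iff)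
  show "(x, x) \<in> r" using c(2) by (simp add: equiv_def refl_on_def)
  show "(x, y) \<in> r \<Longrightarrow> (y, x) \<in> r" using c(2) by (meson equivE symE)
  show "(x, y) \<in> r \<Longrightarrow> (y, z) \<in> r \<Longrightarrow> (x, z) \<in> r" using c(2) by (meson equivE transE)
qed

lemma kernel_in_word_congruences:
  assumes fin: "finite (range t)"
    and app: "\<And>u u' v v'. t u = t u' \<Longrightarrow> t v = t v' \<Longrightarrow> t (u @ v) = t (u' @ v')"
  shows "{(u, v). t u = t v} \<in> word_congruences"
  unfolding word_congruence_iff
proof (intro conjI allI impI)
  show "equiv UNIV {(u, v). t u = t v}"
    by (rule equivI) (auto simp: refl_on_def sym_def trans_def)
  have "UNIV // {(u, v). t u = t v} \<subseteq> (\<lambda>c. {v. c = t v}) ` range t"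
    unfolding quotient_def by auto
  then show "finite (UNIV // {(u, v). t u = t v})"
    by (rule finite_subset) (rule finite_imageI[OF fin])
  show "(x @ u, y @ v) \<in> {(u, v). t u = t v}"
    if "(x, y) \<in> {(u, v). t u = t v}" "(u, v) \<in> {(u, v). t u = t v}" for x y u v
    using that app[of x y u v] by simp
qed

lemma word_congruence_Image_eq_iff:
  "r \<in> word_congruences \<Longrightarrow> r `` {u} = r `` {v} \<longleftrightarrow> (u, v) \<in> r"
  using eq_equiv_class_iff[OF word_congruenceD(2), of r u v] by simp

lemma finite_range_Image: "r \<in> word_congruences \<Longrightarrow> finite (range (\<lambda>w. r `` {w}))"
  using word_congruenceD(3) by (simp add: quotient_def UNION_singleton_eq_range)

lemma word_congruence_Int:
  assumes "r \<in> word_congruences" "s \<in> word_congruences"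
  shows "r \<inter> s \<in> word_congruences"
proof -
  have "{(u, v). (r `` {u}, s `` {u}) = (r `` {v}, s `` {v})} \<in> word_congruences"
  proof (rule kernel_in_word_congruences)
    have "range (\<lambda>u. (r `` {u}, s `` {u})) \<subseteq> range (\<lambda>w. r `` {w}) \<times> range (\<lambda>w. s `` {w})" by auto
    then show "finite (range (\<lambda>u. (r `` {u}, s `` {u})))"
      by (rule finite_subset) (use assms finite_range_Image in blast)
    show "(r `` {u @ v}, s `` {u @ v}) = (r `` {u' @ v'}, s `` {u' @ v'})"
      if "(r `` {u}, s `` {u}) = (r `` {u'}, s `` {u'})" "(r `` {v}, s `` {v}) = (r `` {v'}, s `` {v'})"
      for u v u' v'
      using that assms by (simp add: word_congruence_Image_eq_iff word_congruenceD(4))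
  qed
  also have "{(u, v). (r `` {u}, s `` {u}) = (r `` {v}, s `` {v})} = r \<inter> s"
    using assms by (auto simp: word_congruence_Image_eq_iff)
  finally show ?thesis .
qed

lemma word_congruence_UNIV: "UNIV \<in> word_congruences"
  using kernel_in_word_congruences[of "\<lambda>_. ()"] by simp

lemma word_congruence_Inter:
  "finite R \<Longrightarrow> R \<subseteq> word_congruences \<Longrightarrow> \<Inter>R \<in> word_congruences"
  by (induction R rule: finite_induct) (auto intro: word_congruence_Int word_congruence_UNIV)

text \<open>This is the Rees quotient by the ideal of words of length at least \<open>n\<close>. It
  serves to isolate the empty word, to recognize bounded languages, and to force representatives to
  be long.\<close>

lemma length_congruence:
  "{(u, v :: 'a::finite list). u = v \<or> n \<le> length u \<and> n \<le> length v} \<in> word_congruences"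
proof -
  let ?t = "\<lambda>u :: 'a list. if length u < n then Some u else None"
  have "{(u, v). ?t u = ?t v} \<in> word_congruences"
  proof (rule kernel_in_word_congruences)
    have "range ?t \<subseteq> insert None (Some ` {u. set u \<subseteq> UNIV \<and> length u \<le> n})" by auto
    then show "finite (range ?t)"
      by (rule finite_subset) (intro finite.insertI finite_imageI finite_lists_length_le finite)
  qed (auto split: if_splits)
  also have "{(u, v). ?t u = ?t v} = {(u, v). u = v \<or> n \<le> length u \<and> n \<le> length v}"
    by (auto split: if_splits)
  finally show ?thesis .
qed

text \<open>
  The refined congruence records the classes of all factorizations of a word in two factors.  It
  makes concatenation an open map of the free profinite monoid.
\<close>

lemma ex_splitting_congruence:
  assumes r: "r \<in> word_congruences"
  shows "\<exists>s\<in>word_congruences. s \<subseteq> r \<and>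
    (\<forall>w a b. (w, a @ b) \<in> s \<longrightarrow> (\<exists>a' b'. w = a' @ b' \<and> (a', a) \<in> r \<and> (b', b) \<in> r))"
proof -
  define t where "t w = {(r `` {a}, r `` {b}) | a b. w = a @ b}" for w
  define s where "s = {(u, v). t u = t v}"
  note eq = word_congruence_Image_eq_iff[OF r] and D = word_congruenceD[OF r]
  have split: "\<exists>a' b'. w = a' @ b' \<and> (a', a) \<in> r \<and> (b', b) \<in> r" if "t w = t (a @ b)" for w a b
  proof -
    have "(r `` {a}, r `` {b}) \<in> t w" unfolding that by (auto simp: t_def)
    then obtain a' b' where "w = a' @ b'" "r `` {a'} = r `` {a}" "r `` {b'} = r `` {b}"
      by (auto simp: t_def)
    then show ?thesis using eq by blast
  qed
  have tr: "(u, v) \<in> r" if uv: "t u = t v" for u v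
  proof -
    have "t u = t (v @ [])" using uv by simp
    then obtain a' b' where "u = a' @ b'" "(a', v) \<in> r" "(b', []) \<in> r" using split by blast
    then show ?thesis using D(4) by fastforce
  qed
  have sub: "t (u @ v) \<subseteq> t (u' @ v')" if uv: "t u = t u'" "t v = t v'" for u v u' v'
  proof
    fix p assume "p \<in> t (u @ v)"
    then obtain a b where ab: "p = (r `` {a}, r `` {b})" "u @ v = a @ b" by (auto simp: t_def)
    then consider k where "u = a @ k" "b = k @ v" | k where "a = u @ k" "v = k @ b"
      unfolding append_eq_append_conv2 by blast
    then show "p \<in> t (u' @ v')"
    proof cases
      case 1
      have "t u' = t (a @ k)" using uv 1 by simp
      then obtain a' k' where "u' = a' @ k'" "(a', a) \<in> r" "(k', k) \<in> r" using split by blast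
      then have "(r `` {a}, r `` {b}) = (r `` {a'}, r `` {k' @ v'})" "u' @ v' = a' @ k' @ v'"
        using 1 tr[OF uv(2)] D(4,6) eq by auto
      then show ?thesis unfolding t_def ab(1) by blast
    next
      case 2
      have "t v' = t (k @ b)" using uv 2 by simp
      then obtain k' b' where "v' = k' @ b'" "(k', k) \<in> r" "(b', b) \<in> r" using split by blast
      then have "(r `` {a}, r `` {b}) = (r `` {u' @ k'}, r `` {b'})" "u' @ v' = (u' @ k') @ b'"
        using 2 tr[OF uv(1)] D(4,6) eq by auto
      then show ?thesis unfolding t_def ab(1) by blast
    qed
  qed
  have "s \<in> word_congruences" unfolding s_def
  proof (rule kernel_in_word_congruences)
    have "range t \<subseteq> Pow (range (\<lambda>w. r `` {w}) \<times> range (\<lambda>w. r `` {w}))"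
      by (auto simp: t_def)
    then show "finite (range t)"
      by (rule finite_subset) (use finite_range_Image[OF r] in simp)
    show "t (u @ v) = t (u' @ v')" if "t u = t u'" "t v = t v'" for u u' v v'
      using sub[OF that] sub[OF that[symmetric]] by blast
  qed
  moreover have "s \<subseteq> r" using tr by (auto simp: s_def)
  moreover have "\<forall>w a b. (w, a @ b) \<in> s \<longrightarrow> (\<exists>a' b'. w = a' @ b' \<and> (a', a) \<in> r \<and> (b', b) \<in> r)"
    using split by (simp add: s_def)
  ultimately show ?thesis by blast
qed

text \<open>Unlike in \<open>star_append_split\<close>, both halves of the crossing codeword are
  kept, so that each can be exchanged for a congruent word and the codeword reassembled.\<close>

lemma star_append_split_word:
  assumes "p @ y \<in> star_lang X"
  shows "\<exists>c s t d. p = c @ s \<and> y = t @ d \<and> c \<in> star_lang X \<and> d \<in> star_lang X \<and>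
    (s @ t = [] \<or> s @ t \<in> X)"
proof -
  have "\<exists>c s t d. p = c @ s \<and> y = t @ d \<and> c \<in> star_lang X \<and> d \<in> star_lang X \<and>
    (s @ t = [] \<or> s @ t \<in> X)" if "w = p @ y" "w \<in> star_lang X" for w p y
    using that(2,1)
  proof (induction arbitrary: p y rule: star_induct)
    case Nil
    then show ?case by (intro exI[of _ "[]"]) simp
  next
    case (append x w)
    from append.prems consider d where "x @ d = p" "w = d @ y" | d where "x = p @ d" "y = d @ w"
      unfolding append_eq_append_conv2 by blast
    then show ?case
    proof cases
      case 1
      then obtain c s t e where e: "d = c @ s" "y = t @ e" "c \<in> star_lang X" "e \<in> star_lang X"
        "s @ t = [] \<or> s @ t \<in> X"
        using append.IH[of d y] by blast
      have "x @ c \<in> star_lang X" "p = (x @ c) @ s"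
        using 1 e star_Cons[OF append.hyps(1) e(3)] by simp_all
      then show ?thesis using e by blast
    next
      case 2
      then have "p = [] @ p" "y = d @ w" "p @ d \<in> X"
        using append.hyps by simp_all
      then show ?thesis using append.hyps(2) Nil_in_star by blast
    qed
  qed
  then show ?thesis using assms by blast
qed

text \<open>For an equivalence \<open>r\<close> this says that \<open>L\<close> is a union of
  \<open>r\<close>-classes; together with finite index it is recognition by a finite monoid.\<close>

definition saturates :: "('a list \<times> 'a list) set \<Rightarrow> 'a list set \<Rightarrow> bool"
  where "saturates r L \<longleftrightarrow> (\<forall>u v. (u, v) \<in> r \<longrightarrow> u \<in> L \<longrightarrow> v \<in> L)"

text \<open>
  The congruence records the classes of the outer factors of all factorizations \<open>a y b\<close> with
  \<open>y \<in> L\<^sup>*\<close>; a word is in \<open>L\<^sup>*\<close> if both outer factors can be empty.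
\<close>

lemma ex_congruence_saturating_star:
  fixes L :: "'a::finite list set"
  assumes r0: "r0 \<in> word_congruences" and sat0: "saturates r0 L"
  shows "\<exists>s\<in>word_congruences. saturates s (star_lang L)"
proof -
  \<comment> \<open>The class of the empty word is made a singleton, so that empty outer factors and
    an empty crossing word remain recognizable.\<close>
  define r where "r = r0 \<inter> {(u, v). u = v \<or> 1 \<le> length u \<and> 1 \<le> length v}"
  have r: "r \<in> word_congruences"
    unfolding r_def by (intro word_congruence_Int r0 length_congruence)
  have sat: "v \<in> L" if "(u, v) \<in> r" "u \<in> L" for u v
    using that sat0 by (auto simp: saturates_def r_def)
  have nil: "u = []" if "(u, []) \<in> r" for u
    using that by (auto simp: r_def)
  define T where "T w = {(r `` {a}, r `` {b}) | a y b. w = a @ y @ b \<and> y \<in> star_lang L}" for w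
  define t where "t w = (r `` {w}, T w)" for w
  note eq = word_congruence_Image_eq_iff[OF r] and D = word_congruenceD[OF r]
  have T_I: "(r `` {a}, r `` {b}) \<in> T w"
    if "w = a' @ y @ b'" "y \<in> star_lang L" "(a', a) \<in> r" "(b', b) \<in> r" for a b w a' b' y
  proof -
    have "(r `` {a}, r `` {b}) = (r `` {a'}, r `` {b'})" using D(6)[OF that(3)] D(6)[OF that(4)] eq by simp
    then show ?thesis using that(1,2) unfolding T_def by blast
  qed
  have split: "\<exists>a' y' b'. w = a' @ y' @ b' \<and> y' \<in> star_lang L \<and> (a', a) \<in> r \<and> (b', b) \<in> r"
    if Tw: "T w = T (a @ y @ b)" "y \<in> star_lang L" for w a y b
  proof -
    have "(r `` {a}, r `` {b}) \<in> T w"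
      unfolding Tw(1) using T_I[OF refl Tw(2) D(5) D(5)] .
    then obtain a' y' b' where "w = a' @ y' @ b'" "y' \<in> star_lang L" "r `` {a'} = r `` {a}" "r `` {b'} = r `` {b}"
      unfolding T_def by auto
    then show ?thesis using eq by blast
  qed
  have sub: "T (u @ v) \<subseteq> T (u' @ v')"
    if uv: "(u, u') \<in> r" "(v, v') \<in> r" "T u = T u'" "T v = T v'" for u v u' v'
  proof
    fix p assume "p \<in> T (u @ v)"
    then obtain a y b where p: "p = (r `` {a}, r `` {b})" and w: "u @ v = a @ y @ b"
      and y: "y \<in> star_lang L" by (auto simp: T_def)
    from w consider k where "a = u @ k" "v = k @ y @ b"
      | k l where "u = a @ k" "v = l @ b" "y = k @ l"
      | k where "u = a @ y @ k" "b = k @ v"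
      unfolding append_eq_append_conv2 by (auto simp: append_eq_append_conv2)
    then show "p \<in> T (u' @ v')"
    proof cases
      case 1
      have eq_T: "T v' = T (k @ y @ b)"
        unfolding 1(2)[symmetric] by (rule uv(4)[symmetric])
      obtain k' y' b' where v': "v' = k' @ y' @ b'" "y' \<in> star_lang L" "(k', k) \<in> r" "(b', b) \<in> r"
        using split[OF eq_T y] by blast
      have "(u' @ k', a) \<in> r" using 1(1) D(4)[OF D(6)[OF uv(1)] v'(3)] by simp
      moreover have "u' @ v' = (u' @ k') @ y' @ b'" using v' by simp
      ultimately show ?thesis unfolding p using v' T_I by blast
    next
      case 3
      have eq_T: "T u' = T (a @ y @ k)"
        unfolding 3(1)[symmetric] by (rule uv(3)[symmetric])
      obtain a' y' k' where u': "u' = a' @ y' @ k'" "y' \<in> star_lang L" "(a', a) \<in> r" "(k', k) \<in> r"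
        using split[OF eq_T y] by blast
      have "(k' @ v', b) \<in> r" using 3(2) D(4)[OF u'(4) D(6)[OF uv(2)]] by simp
      moreover have "u' @ v' = a' @ y' @ (k' @ v')" using u' by simp
      ultimately show ?thesis unfolding p using u' T_I by blast
    next
      case 2
      \<comment> \<open>Here the factor in \<open>star_lang L\<close> crosses the border between
        \<open>u\<close> and \<open>v\<close>. The crossing codeword \<open>s f\<close> is replaced
        by the congruent word \<open>s' f'\<close>, which is in \<open>L\<close> by
        saturation.\<close>
      obtain c s f d where cs: "k = c @ s" "l = f @ d" "c \<in> star_lang L" "d \<in> star_lang L"
        "s @ f = [] \<or> s @ f \<in> L"
        using star_append_split_word[of k l L] y 2(3) by blast
      have eq_T: "T u' = T (a @ c @ s)"
        using uv(3) 2(1) cs(1) by simp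
      obtain a' c' s' where u': "u' = a' @ c' @ s'" "c' \<in> star_lang L" "(a', a) \<in> r" "(s', s) \<in> r"
        using split[OF eq_T cs(3)] by blast
      have eq_T: "T v' = T (f @ d @ b)"
        using uv(4) 2(2) cs(2) by simp
      obtain f' d' b' where v': "v' = f' @ d' @ b'" "d' \<in> star_lang L" "(f', f) \<in> r" "(b', b) \<in> r"
        using split[OF eq_T cs(4)] by blast
      have sf: "(s' @ f', s @ f) \<in> r" using u' v' D(4) by blast
      have "s' @ f' \<in> star_lang L"
        using cs(5)
      proof
        assume "s @ f = []"
        then have "s' @ f' = []" using sf nil[of "s' @ f'"] by simp
        then show ?thesis by (simp only: Nil_in_star)
      next
        assume "s @ f \<in> L"
        then show ?thesis using sat[OF D(6)[OF sf]] star_base by blast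
      qed
      then have "c' @ (s' @ f') @ d' \<in> star_lang L"
        by (rule star_append[OF u'(2) star_append[OF _ v'(2)]])
      moreover have "u' @ v' = a' @ (c' @ (s' @ f') @ d') @ b'" using u' v' by simp
      ultimately show ?thesis unfolding p using u'(3) v'(4) T_I by blast
    qed
  qed
  have t_eq: "(u, v) \<in> r \<and> T u = T v" if "t u = t v" for u v
    using that eq by (simp add: t_def)
  have "{(u, v). t u = t v} \<in> word_congruences"
  proof (rule kernel_in_word_congruences)
    have "range t \<subseteq> range (\<lambda>w. r `` {w}) \<times> Pow (range (\<lambda>w. r `` {w}) \<times> range (\<lambda>w. r `` {w}))"
      by (auto simp: t_def T_def)
    then show "finite (range t)"
      by (rule finite_subset) (use finite_range_Image[OF r] in simp)
    show "t (u @ v) = t (u' @ v')" if "t u = t u'" "t v = t v'" for u u' v v'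
    proof -
      note u = t_eq[OF that(1)] and v = t_eq[OF that(2)]
      have "T (u @ v) = T (u' @ v')"
        by (intro equalityI sub) (use u v D(6) in auto)
      moreover have "(u @ v, u' @ v') \<in> r" using u v D(4) by blast
      ultimately show ?thesis using eq by (simp add: t_def)
    qed
  qed
  moreover have "saturates {(u, v). t u = t v} (star_lang L)"
    unfolding saturates_def
  proof (intro allI impI)
    fix u v assume "(u, v) \<in> {(u, v). t u = t v}" and u: "u \<in> star_lang L"
    then have "t u = t v" by simp
    then have eq_T: "T v = T ([] @ u @ [])" using t_eq[of u v] by simp
    obtain a y b where "v = a @ y @ b" "y \<in> star_lang L" "(a, []) \<in> r" "(b, []) \<in> r"
      using split[OF eq_T u] by blast
    then show "v \<in> star_lang L" using nil[of a] nil[of b] by simp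
  qed
  ultimately show ?thesis by blast
qed

text \<open>The congruence of \<open>L\<close> is the coarsest one saturating \<open>L\<close>, so
  it contains \<open>s\<close> and inherits finite index from it.\<close>

lemma syntactic_congruence_in_word_congruences:
  assumes s: "s \<in> word_congruences" and sat: "saturates s L"
  shows "syntactic_congruence L \<in> word_congruences"
proof -
  have eqv: "equiv UNIV (syntactic_congruence L)"
    by (rule equivI) (auto simp: syntactic_congruence_def refl_on_def sym_def trans_def)
  have cong: "(x @ u, y @ v) \<in> syntactic_congruence L"
    if xy: "(x, y) \<in> syntactic_congruence L" and uv: "(u, v) \<in> syntactic_congruence L" for x y u v
    unfolding syntactic_congruence_def
  proof (clarify)
    fix p q
    show "p @ (x @ u) @ q \<in> L \<longleftrightarrow> p @ (y @ v) @ q \<in> L"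
      using syntactic_congruenceD[OF xy, of p "u @ q"] syntactic_congruenceD[OF uv, of "p @ y" q] by simp
  qed
  have sub: "s \<subseteq> syntactic_congruence L"
  proof clarify
    fix u v assume uv: "(u, v) \<in> s"
    have "(p @ u @ q, p @ v @ q) \<in> s" "(p @ v @ q, p @ u @ q) \<in> s" for p q
      using word_congruenceD[OF s] uv by blast+
    then show "(u, v) \<in> syntactic_congruence L"
      using sat unfolding saturates_def syntactic_congruence_def by blast
  qed
  have "UNIV // syntactic_congruence L = (\<lambda>c. syntactic_congruence L `` c) ` (UNIV // s)"
  proof -
    have "syntactic_congruence L `` (s `` {w}) = syntactic_congruence L `` {w}" for w
    proof -
      have "(w, w) \<in> s" using word_congruenceD(5)[OF s] .
      moreover have "(w, z) \<in> syntactic_congruence L"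
        if "(w, y) \<in> s" "(y, z) \<in> syntactic_congruence L" for y z
        using that sub eqv by (meson equivE subsetD transE)
      ultimately show ?thesis by blast
    qed
    then show ?thesis by (simp add: quotient_def UNION_singleton_eq_range image_image)
  qed
  then have "finite (UNIV // syntactic_congruence L)"
    using word_congruenceD(3)[OF s] by simp
  then show ?thesis
    using eqv cong by (simp add: word_congruence_iff)
qed

lemma path_states:
  assumes "finite_automaton M" "path M p w q"
  shows "p \<in> states M" "q \<in> states M"
  using assms(2,1) by (induction rule: path.induct) (auto simp: finite_automaton_def)

lemma path_append_iff:
  assumes M: "finite_automaton M"
  shows "path M p (u @ v) r \<longleftrightarrow> (\<exists>q. path M p u q \<and> path M q v r)"
proof (induction u arbitrary: p)
  case Nil
  have "path M p [] q \<longleftrightarrow> p \<in> states M \<and> p = q" for q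
    using path.simps[of M p "[]" q] by auto
  then show ?case using path_states[OF M] by auto
next
  case (Cons a u)
  have step: "path M p (a # w) q \<longleftrightarrow> (\<exists>s. (p, a, s) \<in> edges M \<and> path M s w q)" for w q
    using path.simps[of M p "a # w" q] by auto
  show ?case by (auto simp: step Cons.IH)
qed

text \<open>The invariant of a word is the relation it induces on the states; as the automaton may
  be nondeterministic, concatenation becomes composition of relations.\<close>

lemma rational_lang_saturated:
  assumes "rational_lang L"
  shows "\<exists>r\<in>word_congruences. saturates r L"
proof -
  obtain M :: "(nat, 'a) automaton" where M: "finite_automaton M" and L: "recognized_lang M = L"
    using assms unfolding rational_lang_def by blast
  define t where "t w = {(p, q). path M p w q}" for w
  have "{(u, v). t u = t v} \<in> word_congruences"
  proof (rule kernel_in_word_congruences)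
    have "range t \<subseteq> Pow (states M \<times> states M)"
      using path_states[OF M] by (auto simp: t_def)
    moreover have "finite (states M)" using M by (simp add: finite_automaton_def)
    ultimately show "finite (range t)" by (meson finite_Pow_iff finite_SigmaI finite_subset)
    have "t (u @ v) = t u O t v" for u v
      by (auto simp: t_def path_append_iff[OF M])
    then show "t (u @ v) = t (u' @ v')" if "t u = t u'" "t v = t v'" for u u' v v'
      using that by simp
  qed
  moreover have "saturates {(u, v). t u = t v} L"
  proof -
    have "w \<in> L \<longleftrightarrow> (\<exists>i\<in>initial M. \<exists>f\<in>terminal M. (i, f) \<in> t w)" for w
      by (simp add: L[symmetric] recognized_lang_def t_def)
    then show ?thesis by (simp add: saturates_def)
  qed
  ultimately show ?thesis by blast
qed

text \<open>Words longer than \<open>n\<close> are all outside \<open>X\<close> and may be merged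
  into one class.\<close>

lemma bounded_lang_saturated:
  fixes X :: "'a::finite list set"
  assumes "\<forall>x\<in>X. length x \<le> n"
  shows "\<exists>r\<in>word_congruences. saturates r X"
  using length_congruence[of "Suc n"] assms
  by (intro bexI[of _ "{(u, v). u = v \<or> Suc n \<le> length u \<and> Suc n \<le> length v}"])
    (auto simp: saturates_def)

section \<open>The free profinite monoid\<close>

lemma word_monoid_simps [simp]:
  "carrier word_monoid = UNIV" "x \<otimes>\<^bsub>word_monoid\<^esub> y = x @ y" "\<one>\<^bsub>word_monoid\<^esub> = []"
  by (simp_all add: word_monoid_def)

lemma quotient_monoid_carrier: "carrier (quotient_monoid word_monoid r) = UNIV // r"
  by (simp add: quotient_monoid_def)

lemma quotient_monoid_one: "\<one>\<^bsub>quotient_monoid word_monoid r\<^esub> = r `` {[]}"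
  by (simp add: quotient_monoid_def)

lemma quotient_monoid_mult:
  assumes "congruence word_monoid r"
  shows "r `` {u} \<otimes>\<^bsub>quotient_monoid word_monoid r\<^esub> r `` {v} = r `` {u @ v}"
proof -
  have r: "equiv UNIV r" "\<And>x y u v. (x, y) \<in> r \<Longrightarrow> (u, v) \<in> r \<Longrightarrow> (x @ u, y @ v) \<in> r"
    using assms congruence_word_monoid_iff by blast+
  have refl: "(x, x) \<in> r" for x using r(1) by (simp add: equiv_def refl_on_def)
  let ?S = "r `` {u} <#>\<^bsub>word_monoid\<^esub> r `` {v}"
  have S: "?S = {x @ y | x y. (u, x) \<in> r \<and> (v, y) \<in> r}"
    unfolding set_mult_def by auto
  have "r `` ?S \<subseteq> r `` {u @ v}"
  proof
    fix z assume "z \<in> r `` ?S"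
    then obtain x y where "(u, x) \<in> r" "(v, y) \<in> r" "(x @ y, z) \<in> r" unfolding S by blast
    then show "z \<in> r `` {u @ v}" using r(2) r(1) by (meson Image_singleton_iff equivE transE)
  qed
  moreover have "u @ v \<in> ?S" unfolding S using refl by blast
  ultimately have "r `` ?S = r `` {u @ v}" by blast
  then show ?thesis by (simp add: quotient_monoid_def)
qed

lemma monoid_quotient_monoid:
  assumes "congruence word_monoid r"
  shows "monoid (quotient_monoid word_monoid r)"
proof -
  note mult = quotient_monoid_mult[OF assms]
  show ?thesis
    by (rule monoidI)
      (auto simp: quotient_monoid_carrier quotient_monoid_one mult elim!: quotientE intro!: quotientI)
qed

lemma free_profinite_carrier:
  "x \<in> carrier free_profinite \<longleftrightarrow> x \<in> extensional word_congruences \<and>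
    (\<forall>r\<in>word_congruences. x r \<in> UNIV // r) \<and>
    (\<forall>r\<in>word_congruences. \<forall>s\<in>word_congruences. r \<subseteq> s \<longrightarrow> x r \<subseteq> x s)"
  by (auto simp: profinite_completion_def quotient_monoid_carrier PiE_def Pi_def)

lemma free_profinite_mono:
  "x \<in> carrier free_profinite \<Longrightarrow> r \<in> word_congruences \<Longrightarrow> s \<in> word_congruences \<Longrightarrow> r \<subseteq> s \<Longrightarrow> x r \<subseteq> x s"
  by (simp add: free_profinite_carrier)

text \<open>A coordinate is a congruence class and is known from any word in it; the proofs below
  choose such words instead of computing with classes.\<close>

lemma free_profinite_class:
  assumes "x \<in> carrier free_profinite" "r \<in> word_congruences" "w \<in> x r"
  shows "x r = r `` {w}"
proof -
  have "x r \<in> UNIV // r" using assms by (simp add: free_profinite_carrier)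
  then obtain v where "x r = r `` {v}" by (rule quotientE)
  then show ?thesis using assms(3) word_congruence_Image_eq_iff[OF assms(2), of v w] by simp
qed

lemma free_profinite_ex_word:
  assumes "x \<in> carrier free_profinite" "r \<in> word_congruences"
  shows "\<exists>w. w \<in> x r"
proof -
  have "x r \<in> UNIV // r" using assms by (simp add: free_profinite_carrier)
  then obtain v where "x r = r `` {v}" by (rule quotientE)
  then show ?thesis using word_congruenceD(5)[OF assms(2)] by blast
qed

lemma free_profinite_eqI:
  assumes "x \<in> carrier free_profinite" "y \<in> carrier free_profinite"
    and "\<And>r. r \<in> word_congruences \<Longrightarrow> \<exists>w. w \<in> x r \<and> w \<in> y r"
  shows "x = y"
proof (rule extensionalityI)
  show "x \<in> extensional word_congruences" "y \<in> extensional word_congruences"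
    using assms by (simp_all add: free_profinite_carrier)
  fix r :: "('a list \<times> 'a list) set" assume r: "r \<in> word_congruences"
  then obtain w where "w \<in> x r" "w \<in> y r" using assms(3) by blast
  then show "x r = y r"
    using free_profinite_class[OF assms(1) r, of w] free_profinite_class[OF assms(2) r, of w] by simp
qed

lemma free_profinite_mult_eval:
  "r \<in> word_congruences \<Longrightarrow>
    (x \<otimes>\<^bsub>free_profinite\<^esub> y) r = x r \<otimes>\<^bsub>quotient_monoid word_monoid r\<^esub> y r"
  by (simp add: profinite_completion_def)

lemma free_profinite_mult_class:
  assumes "x \<in> carrier free_profinite" "y \<in> carrier free_profinite" "r \<in> word_congruences"
    and "u \<in> x r" "v \<in> y r"
  shows "(x \<otimes>\<^bsub>free_profinite\<^esub> y) r = r `` {u @ v}"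
  using free_profinite_class[OF assms(1,3,4)] free_profinite_class[OF assms(2,3,5)]
    quotient_monoid_mult[OF word_congruenceD(1)[OF assms(3)]]
  by (simp add: free_profinite_mult_eval[OF assms(3)])

lemma free_profinite_mult_memI:
  assumes "x \<in> carrier free_profinite" "y \<in> carrier free_profinite" "r \<in> word_congruences"
    and "u \<in> x r" "v \<in> y r"
  shows "u @ v \<in> (x \<otimes>\<^bsub>free_profinite\<^esub> y) r"
  unfolding free_profinite_mult_class[OF assms] using word_congruenceD(5)[OF assms(3)] by simp

lemma free_profinite_mult_closed:
  assumes x: "x \<in> carrier free_profinite" and y: "y \<in> carrier free_profinite"
  shows "x \<otimes>\<^bsub>free_profinite\<^esub> y \<in> carrier free_profinite"
  unfolding free_profinite_carrier
proof (intro conjI ballI impI)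
  show "x \<otimes>\<^bsub>free_profinite\<^esub> y \<in> extensional word_congruences"
    by (simp add: profinite_completion_def)
  fix r :: "('a list \<times> 'a list) set" assume r: "r \<in> word_congruences"
  obtain u v where uv: "u \<in> x r" "v \<in> y r"
    using free_profinite_ex_word[OF x r] free_profinite_ex_word[OF y r] by blast
  show "(x \<otimes>\<^bsub>free_profinite\<^esub> y) r \<in> UNIV // r"
    unfolding free_profinite_mult_class[OF x y r uv] by (rule quotientI) simp
  fix s :: "('a list \<times> 'a list) set" assume s: "s \<in> word_congruences" "r \<subseteq> s"
  have "u \<in> x s" "v \<in> y s" using uv free_profinite_mono x y r s by blast+
  then show "(x \<otimes>\<^bsub>free_profinite\<^esub> y) r \<subseteq> (x \<otimes>\<^bsub>free_profinite\<^esub> y) s"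
    unfolding free_profinite_mult_class[OF x y r uv] free_profinite_mult_class[OF x y s(1) \<open>u \<in> x s\<close> \<open>v \<in> y s\<close>]
    using s(2) by blast
qed

lemma profinite_embedding_carrier: "profinite_embedding word_monoid w \<in> carrier free_profinite"
  unfolding free_profinite_carrier profinite_embedding_def by (auto intro: quotientI)

lemma profinite_embedding_mem: "r \<in> word_congruences \<Longrightarrow> w \<in> profinite_embedding word_monoid w r"
  using word_congruenceD(5) by (auto simp: profinite_embedding_def)

lemma free_profinite_one: "\<one>\<^bsub>free_profinite\<^esub> = profinite_embedding word_monoid []"
  by (simp add: profinite_completion_def profinite_embedding_def quotient_monoid_one)

lemma monoid_free_profinite: "monoid (free_profinite :: 'a profinite_word monoid)"
proof (rule monoidI)
  show "\<one>\<^bsub>free_profinite\<^esub> \<in> carrier (free_profinite :: 'a profinite_word monoid)"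
    by (simp only: free_profinite_one profinite_embedding_carrier)
  then have one: "\<one>\<^bsub>free_profinite\<^esub> \<in> carrier (free_profinite :: 'a profinite_word monoid)" .
  fix x y z :: "'a profinite_word"
  assume x: "x \<in> carrier free_profinite"
  have one_mem: "[] \<in> \<one>\<^bsub>free_profinite\<^esub> r" if "r \<in> word_congruences" for r :: "('a list \<times> 'a list) set"
    unfolding free_profinite_one by (rule profinite_embedding_mem[OF that])
  show "\<one>\<^bsub>free_profinite\<^esub> \<otimes>\<^bsub>free_profinite\<^esub> x = x"
  proof (rule free_profinite_eqI[OF free_profinite_mult_closed[OF one x] x])
    fix r :: "('a list \<times> 'a list) set" assume r: "r \<in> word_congruences"
    obtain w where "w \<in> x r" using free_profinite_ex_word[OF x r] by blast
    then show "\<exists>w. w \<in> (\<one>\<^bsub>free_profinite\<^esub> \<otimes>\<^bsub>free_profinite\<^esub> x) r \<and> w \<in> x r"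
      using free_profinite_mult_memI[OF one x r one_mem[OF r]] by auto
  qed
  show "x \<otimes>\<^bsub>free_profinite\<^esub> \<one>\<^bsub>free_profinite\<^esub> = x"
  proof (rule free_profinite_eqI[OF free_profinite_mult_closed[OF x one] x])
    fix r :: "('a list \<times> 'a list) set" assume r: "r \<in> word_congruences"
    obtain w where "w \<in> x r" using free_profinite_ex_word[OF x r] by blast
    then show "\<exists>w. w \<in> (x \<otimes>\<^bsub>free_profinite\<^esub> \<one>\<^bsub>free_profinite\<^esub>) r \<and> w \<in> x r"
      using free_profinite_mult_memI[OF x one r _ one_mem[OF r]] by force
  qed
  assume y: "y \<in> carrier free_profinite"
  show "x \<otimes>\<^bsub>free_profinite\<^esub> y \<in> carrier free_profinite"
    by (rule free_profinite_mult_closed[OF x y])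
  assume z: "z \<in> carrier free_profinite"
  note xy = free_profinite_mult_closed[OF x y] and yz = free_profinite_mult_closed[OF y z]
  show "x \<otimes>\<^bsub>free_profinite\<^esub> y \<otimes>\<^bsub>free_profinite\<^esub> z = x \<otimes>\<^bsub>free_profinite\<^esub> (y \<otimes>\<^bsub>free_profinite\<^esub> z)"
  proof (rule free_profinite_eqI[OF free_profinite_mult_closed[OF xy z] free_profinite_mult_closed[OF x yz]])
    fix r :: "('a list \<times> 'a list) set" assume r: "r \<in> word_congruences"
    obtain u v w where uvw: "u \<in> x r" "v \<in> y r" "w \<in> z r"
      using free_profinite_ex_word[OF x r] free_profinite_ex_word[OF y r]
        free_profinite_ex_word[OF z r] by blast
    have "(u @ v) @ w \<in> (x \<otimes>\<^bsub>free_profinite\<^esub> y \<otimes>\<^bsub>free_profinite\<^esub> z) r"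
      by (intro free_profinite_mult_memI xy x y z r uvw)
    moreover have "u @ (v @ w) \<in> (x \<otimes>\<^bsub>free_profinite\<^esub> (y \<otimes>\<^bsub>free_profinite\<^esub> z)) r"
      by (intro free_profinite_mult_memI yz x y z r uvw)
    ultimately show "\<exists>w. w \<in> (x \<otimes>\<^bsub>free_profinite\<^esub> y \<otimes>\<^bsub>free_profinite\<^esub> z) r \<and>
        w \<in> (x \<otimes>\<^bsub>free_profinite\<^esub> (y \<otimes>\<^bsub>free_profinite\<^esub> z)) r"
      by auto
  qed
qed

section \<open>Topology, closure and the continuous extension\<close>

lemma topspace_profinite_topology:
  "topspace (profinite_topology word_monoid) = carrier free_profinite"
proof -
  have "carrier (free_profinite :: 'a profinite_word monoid) \<subseteq>
      (\<Pi>\<^sub>E r\<in>word_congruences. carrier (quotient_monoid word_monoid r))"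
    by (auto simp: profinite_completion_def)
  then show ?thesis
    by (auto simp: profinite_topology_def)
qed

lemma openin_profinite_class:
  assumes r: "r \<in> word_congruences"
  shows "openin (profinite_topology word_monoid) {x \<in> carrier free_profinite. x r = C}"
proof -
  let ?Q = "\<lambda>r. discrete_topology (carrier (quotient_monoid word_monoid r))"
  have "continuous_map (product_topology ?Q word_congruences) (?Q r) (\<lambda>x. x r)"
    using r by (rule continuous_map_product_projection)
  then have "continuous_map (profinite_topology word_monoid) (?Q r) (\<lambda>x. x r)"
    unfolding profinite_topology_def by (rule continuous_map_from_subtopology)
  then have "openin (profinite_topology word_monoid)
      {x \<in> topspace (profinite_topology word_monoid). x r \<in> {C} \<inter> carrier (quotient_monoid word_monoid r)}"
    by (rule openin_continuous_map_preimage) simp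
  moreover have "{x \<in> topspace (profinite_topology word_monoid). x r \<in> {C} \<inter> carrier (quotient_monoid word_monoid r)}
      = {x \<in> carrier free_profinite. x r = C}"
    using r by (auto simp: topspace_profinite_topology free_profinite_carrier quotient_monoid_carrier)
  ultimately show ?thesis by simp
qed

text \<open>A basic open set of the product restricts only finitely many coordinates. The
  intersection of these congruences still has finite index, and compatibility of coordinates lets
  this one coordinate determine all the restricted ones.\<close>

lemma openin_profinite_nbhd:
  assumes "openin (profinite_topology word_monoid) T" "x \<in> T"
  shows "\<exists>r\<in>word_congruences. \<forall>y\<in>carrier free_profinite. y r = x r \<longrightarrow> y \<in> T"
proof -
  let ?Q = "\<lambda>r. discrete_topology (carrier (quotient_monoid word_monoid r))"
  obtain T' where T': "openin (product_topology ?Q word_congruences) T'" "T = T' \<inter> carrier free_profinite"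
    using assms(1) unfolding profinite_topology_def openin_subtopology by blast
  have x: "x \<in> carrier free_profinite" and xT': "x \<in> T'" using assms(2) T'(2) by simp_all
  from bspec[OF T'(1)[unfolded openin_product_topology_alt] xT'] obtain U where U: "finite {r \<in> word_congruences. U r \<noteq> topspace (?Q r)}"
    "x \<in> Pi\<^sub>E word_congruences U" "Pi\<^sub>E word_congruences U \<subseteq> T'"
    by (elim exE conjE)
  let ?R = "{r \<in> word_congruences. U r \<noteq> topspace (?Q r)}"
  have r: "\<Inter>?R \<in> word_congruences"
    using U(1) by (rule word_congruence_Inter) blast
  have "y \<in> T" if y: "y \<in> carrier free_profinite" "y (\<Inter>?R) = x (\<Inter>?R)" for y
  proof -
    have "y s \<in> U s" if s: "s \<in> word_congruences" for s
    proof (cases "s \<in> ?R")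
      case True
      then have sub: "\<Inter>?R \<subseteq> s" by blast
      obtain w where w: "w \<in> x (\<Inter>?R)" using free_profinite_ex_word[OF x r] by blast
      have "w \<in> x s" "w \<in> y s"
        using w y(2) free_profinite_mono[OF x r s sub] free_profinite_mono[OF y(1) r s sub] by auto
      then have "y s = x s"
        using free_profinite_class[OF x s, of w] free_profinite_class[OF y(1) s, of w] by simp
      then show ?thesis using U(2) s by auto
    next
      case False
      then show ?thesis using s y(1) by (simp add: free_profinite_carrier quotient_monoid_carrier)
    qed
    then have "y \<in> Pi\<^sub>E word_congruences U"
      using y(1) by (auto simp: PiE_def free_profinite_carrier)
    then show ?thesis using U(3) T'(2) y(1) by blast
  qed
  then show ?thesis using r by blast
qed

text \<open>The sets prescribing a single coordinate form a neighbourhood base, so closure is tested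
  modulo one congruence at a time and topology can be avoided afterwards.\<close>

lemma profinite_closure_iff:
  "x \<in> profinite_closure Y \<longleftrightarrow> x \<in> carrier free_profinite \<and> (\<forall>r\<in>word_congruences. \<exists>w\<in>Y. w \<in> x r)"
proof
  assume cl: "x \<in> profinite_closure Y"
  then have x: "x \<in> carrier free_profinite"
    by (simp add: profinite_closure_def in_closure_of topspace_profinite_topology)
  have "\<exists>w\<in>Y. w \<in> x r" if r: "r \<in> word_congruences" for r
  proof -
    let ?T = "{y \<in> carrier free_profinite. y r = x r}"
    have T: "x \<in> ?T \<and> openin (profinite_topology word_monoid) ?T"
      using x openin_profinite_class[OF r, of "x r"] by simp
    have "\<forall>T. x \<in> T \<and> openin (profinite_topology word_monoid) T \<longrightarrow>
        (\<exists>y. y \<in> profinite_embedding word_monoid ` Y \<and> y \<in> T)"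
      using cl unfolding profinite_closure_def in_closure_of by (rule conjunct2)
    from mp[OF spec[OF this] T] obtain w where w: "w \<in> Y" "profinite_embedding word_monoid w r = x r" by blast
    then show ?thesis using profinite_embedding_mem[OF r, of w] by auto
  qed
  then show "x \<in> carrier free_profinite \<and> (\<forall>r\<in>word_congruences. \<exists>w\<in>Y. w \<in> x r)" using x by blast
next
  assume x: "x \<in> carrier free_profinite \<and> (\<forall>r\<in>word_congruences. \<exists>w\<in>Y. w \<in> x r)"
  show "x \<in> profinite_closure Y"
    unfolding profinite_closure_def in_closure_of topspace_profinite_topology
  proof (intro conjI allI impI)
    show "x \<in> carrier free_profinite" using x ..
    fix T assume T: "x \<in> T \<and> openin (profinite_topology word_monoid) T"
    obtain r where r: "r \<in> word_congruences"
      "\<And>y. y \<in> carrier free_profinite \<Longrightarrow> y r = x r \<Longrightarrow> y \<in> T"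
      using openin_profinite_nbhd[OF conjunct2[OF T] conjunct1[OF T]] by blast
    obtain w where w: "w \<in> Y" "w \<in> x r" using x r(1) by blast
    have "profinite_embedding word_monoid w r = x r"
      using free_profinite_class[of x r w] x r(1) w by (simp add: profinite_embedding_def)
    then have "profinite_embedding word_monoid w \<in> T"
      using r(2) profinite_embedding_carrier by blast
    then show "\<exists>y. y \<in> profinite_embedding word_monoid ` Y \<and> y \<in> T" using w by blast
  qed
qed

text \<open>The coordinate at the congruence of \<open>L\<close> is continuous and has the right
  values on words; density of the words forces every other continuous extension to agree with
  it.\<close>

lemma syntactic_hom_ext_eq:
  assumes L: "syntactic_congruence L \<in> word_congruences" and x: "x \<in> carrier free_profinite"
  shows "syntactic_hom_ext L x = x (syntactic_congruence L)"
proof -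
  let ?r = "syntactic_congruence L"
  let ?Q = "discrete_topology (carrier (syntactic_monoid L))"
  define f0 where "f0 = (\<lambda>x\<in>carrier free_profinite. x ?r)"
  have f0: "continuous_map (profinite_topology word_monoid) ?Q f0"
  proof -
    have "continuous_map (product_topology (\<lambda>r. discrete_topology (carrier (quotient_monoid word_monoid r)))
        word_congruences) ?Q (\<lambda>x. x ?r)"
      unfolding syntactic_monoid_def using L by (rule continuous_map_product_projection)
    then have "continuous_map (profinite_topology word_monoid) ?Q (\<lambda>x. x ?r)"
      unfolding profinite_topology_def by (rule continuous_map_from_subtopology)
    then show ?thesis
      by (rule continuous_map_eq) (simp add: f0_def topspace_profinite_topology)
  qed
  have emb: "f0 (profinite_embedding word_monoid w) = syntactic_hom L w" for w
    using L profinite_embedding_carrier[of w]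
    by (simp add: f0_def) (simp add: profinite_embedding_def syntactic_hom_def)
  have "syntactic_hom_ext L = f0"
    unfolding syntactic_hom_ext_def
  proof (rule the_equality)
    show "f0 \<in> extensional (carrier free_profinite) \<and>
      continuous_map (profinite_topology word_monoid) ?Q f0 \<and>
      (\<forall>w. f0 (profinite_embedding word_monoid w) = syntactic_hom L w)"
      using f0 emb by (simp add: f0_def)
    fix f assume f: "f \<in> extensional (carrier free_profinite) \<and>
      continuous_map (profinite_topology word_monoid) ?Q f \<and>
      (\<forall>w. f (profinite_embedding word_monoid w) = syntactic_hom L w)"
    show "f = f0"
    proof (rule extensionalityI[of _ "carrier free_profinite"])
      show "f \<in> extensional (carrier free_profinite)" using f by blast
      show "f0 \<in> extensional (carrier free_profinite)" by (simp add: f0_def)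
      fix y :: "'a profinite_word" assume y: "y \<in> carrier free_profinite"
      have pre: "openin (profinite_topology word_monoid) {z \<in> carrier free_profinite. g z = g y}"
        if g: "continuous_map (profinite_topology word_monoid) ?Q g" for g
      proof -
        have "g y \<in> carrier (syntactic_monoid L)"
          using continuous_map_image_subset_topspace[OF g] y by (auto simp: topspace_profinite_topology)
        then have "openin ?Q {g y}" by simp
        from openin_continuous_map_preimage[OF g this] show ?thesis
          by (simp add: topspace_profinite_topology)
      qed
      \<comment> \<open>A neighbourhood of \<open>y\<close> on which both maps are constant; it
        contains a word, and on words they agree.\<close>
      let ?T = "{z \<in> carrier free_profinite. f z = f y} \<inter> {z \<in> carrier free_profinite. f0 z = f0 y}"
      have T1: "openin (profinite_topology word_monoid) ?T"
        using f f0 by (intro openin_Int pre) blast+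
      have T2: "y \<in> ?T" using y by simp
      from openin_profinite_nbhd[OF T1 T2] obtain r where r: "r \<in> word_congruences"
        "\<forall>z\<in>carrier free_profinite. z r = y r \<longrightarrow> z \<in> ?T"
        by (elim bexE)
      obtain w where w: "w \<in> y r" using free_profinite_ex_word[OF y r(1)] by blast
      have "profinite_embedding word_monoid w r = y r"
        using free_profinite_class[OF y r(1) w] r(1) by (simp add: profinite_embedding_def)
      then show "f y = f0 y"
        using bspec[OF r(2) profinite_embedding_carrier[of w]] f emb[of w] by clarsimp
    qed
  qed
  then show ?thesis using x by (simp add: f0_def)
qed

section \<open>Limits of words along an ultrafilter\<close>

text \<open>Zorn's lemma is applied to the families that contain \<open>B\<close>, are closed under
  intersection and omit the empty set; a maximal one is a base of the filter.\<close>

lemma ex_ultrafilter: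
  assumes B: "UNIV \<in> B" "{} \<notin> B" "\<And>x y. x \<in> B \<Longrightarrow> y \<in> B \<Longrightarrow> x \<inter> y \<in> B"
  shows "\<exists>U. U \<noteq> bot \<and> (\<forall>b\<in>B. eventually (\<lambda>x. x \<in> b) U) \<and>
    (\<forall>P. eventually P U \<or> eventually (\<lambda>x. \<not> P x) U)"
proof -
  define A where "A = {S. B \<subseteq> S \<and> {} \<notin> S \<and> (\<forall>x\<in>S. \<forall>y\<in>S. x \<inter> y \<in> S)}"
  have "\<exists>M\<in>A. \<forall>X\<in>A. M \<subseteq> X \<longrightarrow> X = M"
  proof (rule subset_Zorn_nonempty)
    have "B \<in> A" using B by (simp add: A_def)
    then show "A \<noteq> {}" by blast
    fix C assume "C \<noteq> {}" and ch: "subset.chain A C"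
    have CA: "C \<subseteq> A" using ch by (simp add: subset.chain_def)
    have "B \<subseteq> \<Union>C" using \<open>C \<noteq> {}\<close> CA unfolding A_def by blast
    moreover have "{} \<notin> \<Union>C" using CA unfolding A_def by blast
    moreover have "x \<inter> y \<in> \<Union>C" if xy: "x \<in> \<Union>C" "y \<in> \<Union>C" for x y
    proof -
      obtain S where S: "S \<in> C" "x \<in> S" using xy(1) by (rule UnionE)
      obtain T where T: "T \<in> C" "y \<in> T" using xy(2) by (rule UnionE)
      have "S \<subseteq> T \<or> T \<subseteq> S" using ch S(1) T(1) by (auto simp: subset.chain_def)
      then have "\<exists>R\<in>C. x \<in> R \<and> y \<in> R" using S T by blast
      then show ?thesis using CA unfolding A_def by blast
    qed
    ultimately show "\<Union>C \<in> A" by (simp add: A_def)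
  qed
  then obtain M where "M \<in> A" and max: "\<And>X. X \<in> A \<Longrightarrow> M \<subseteq> X \<Longrightarrow> X = M" by blast
  then have M: "B \<subseteq> M" "{} \<notin> M" "\<And>x y. x \<in> M \<Longrightarrow> y \<in> M \<Longrightarrow> x \<inter> y \<in> M"
    by (auto simp: A_def)
  define U where "U = (INF m\<in>M. principal m)"
  have ev: "eventually P U \<longleftrightarrow> (\<exists>m\<in>M. \<forall>x\<in>m. P x)" for P
    unfolding U_def
  proof (subst eventually_INF_base)
    show "M \<noteq> {}" using M(1) B(1) by blast
    show "\<exists>c\<in>M. principal c \<le> inf (principal a) (principal b)" if "a \<in> M" "b \<in> M" for a b
      using M(3)[OF that] by (intro bexI[of _ "a \<inter> b"]) simp_all
  qed (simp add: eventually_principal)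
  have "U \<noteq> bot"
  proof
    assume "U = bot"
    then have "eventually (\<lambda>_. False) U" by simp
    then obtain m where "m \<in> M" "\<forall>x\<in>m. False" unfolding ev by blast
    then have "m = {}" by blast
    then show False using M(2) \<open>m \<in> M\<close> by simp
  qed
  moreover have "\<forall>b\<in>B. eventually (\<lambda>x. x \<in> b) U" unfolding ev using M(1) by blast
  moreover have "eventually P U \<or> eventually (\<lambda>x. \<not> P x) U" for P
  proof (rule disjCI)
    assume not: "\<not> eventually (\<lambda>x. \<not> P x) U"
    \<comment> \<open>Since the filter does not contain the complement of \<open>a\<close>,
      adjoining all \<open>m \<inter> a\<close> keeps the family admissible, and maximality puts
      \<open>a\<close> into it.\<close>
    define a where "a = {x. P x}"
    have ne: "m \<inter> a \<noteq> {}" if "m \<in> M" for m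
      using not that unfolding ev a_def by blast
    define M' where "M' = M \<union> (\<lambda>m. m \<inter> a) ` M"
    have M': "x \<in> M' \<longleftrightarrow> (\<exists>m\<in>M. x = m \<or> x = m \<inter> a)" for x
      by (auto simp: M'_def)
    have "M' \<in> A" unfolding A_def
    proof (intro CollectI conjI ballI)
      show "B \<subseteq> M'" using M(1) by (auto simp: M'_def)
      show "{} \<notin> M'" using M(2) ne unfolding M' by metis
      fix x y assume "x \<in> M'" "y \<in> M'"
      then obtain m n where mn: "m \<in> M" "n \<in> M" "x = m \<or> x = m \<inter> a" "y = n \<or> y = n \<inter> a"
        unfolding M' by blast
      then have "x \<inter> y = m \<inter> n \<or> x \<inter> y = m \<inter> n \<inter> a" by blast
      then show "x \<inter> y \<in> M'" using M(3)[OF mn(1,2)] unfolding M' by blast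
    qed
    then have "M' = M" using max by (simp add: M'_def)
    moreover have "a \<in> M'" using M(1) B(1) by (auto simp: M'_def)
    ultimately show "eventually P U" unfolding ev a_def by blast
  qed
  ultimately show ?thesis by blast
qed

text \<open>The ultrafilter contains, for every congruence of finite index, the set of its
  refinements. Every family of words indexed by congruences then has a limit, without passing to
  subnets.\<close>

definition congruence_ultrafilter :: "('a list \<times> 'a list) set filter"
  where "congruence_ultrafilter = (SOME U. U \<noteq> bot \<and>
    (\<forall>r\<in>word_congruences. eventually (\<lambda>s. s \<in> word_congruences \<and> s \<subseteq> r) U) \<and>
    (\<forall>P. eventually P U \<or> eventually (\<lambda>x. \<not> P x) U))"

abbreviation (input) finely :: "(('a list \<times> 'a list) set \<Rightarrow> bool) \<Rightarrow> bool"
  where "finely P \<equiv> eventually P congruence_ultrafilter"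

lemma
  shows congruence_ultrafilter_not_bot: "(congruence_ultrafilter :: ('a list \<times> 'a list) set filter) \<noteq> bot"
    and finely_refines: "\<And>r :: ('a list \<times> 'a list) set. r \<in> word_congruences \<Longrightarrow>
      finely (\<lambda>s. s \<in> word_congruences \<and> s \<subseteq> r)"
    and finely_ultra: "\<And>P. finely P \<or> finely (\<lambda>s :: ('a list \<times> 'a list) set. \<not> P s)"
proof -
  define B :: "('a list \<times> 'a list) set set set"
    where "B = {S. \<exists>r\<in>word_congruences. {s \<in> word_congruences. s \<subseteq> r} \<subseteq> S}"
  have "\<exists>U. U \<noteq> bot \<and> (\<forall>b\<in>B. eventually (\<lambda>x. x \<in> b) U) \<and>
    (\<forall>P. eventually P U \<or> eventually (\<lambda>x. \<not> P x) U)"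
  proof (rule ex_ultrafilter)
    show "UNIV \<in> B" using word_congruence_UNIV by (auto simp: B_def)
    show "{} \<notin> B" by (auto simp: B_def)
    fix x y assume "x \<in> B" "y \<in> B"
    then obtain r s where rs: "r \<in> word_congruences" "{t \<in> word_congruences. t \<subseteq> r} \<subseteq> x"
      "s \<in> word_congruences" "{t \<in> word_congruences. t \<subseteq> s} \<subseteq> y"
      by (auto simp: B_def)
    then have "{t \<in> word_congruences. t \<subseteq> r \<inter> s} \<subseteq> x \<inter> y" by blast
    then show "x \<inter> y \<in> B" unfolding B_def using word_congruence_Int[OF rs(1,3)] by blast
  qed
  then obtain U where U: "U \<noteq> bot" "\<forall>b\<in>B. eventually (\<lambda>x. x \<in> b) U"
    "\<forall>P. eventually P U \<or> eventually (\<lambda>x. \<not> P x) U" by blast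
  have "eventually (\<lambda>s. s \<in> word_congruences \<and> s \<subseteq> r) U" if "r \<in> word_congruences" for r
  proof -
    have "{s \<in> word_congruences. s \<subseteq> r} \<in> B" using that unfolding B_def by blast
    from bspec[OF U(2) this] show ?thesis by simp
  qed
  then have "\<exists>U :: ('a list \<times> 'a list) set filter. U \<noteq> bot \<and>
    (\<forall>r\<in>word_congruences. eventually (\<lambda>s. s \<in> word_congruences \<and> s \<subseteq> r) U) \<and>
    (\<forall>P. eventually P U \<or> eventually (\<lambda>x. \<not> P x) U)"
    using U(1,3) by blast
  from someI_ex[OF this]
  have *: "(congruence_ultrafilter :: ('a list \<times> 'a list) set filter) \<noteq> bot \<and>
    (\<forall>r\<in>word_congruences. finely (\<lambda>s :: ('a list \<times> 'a list) set. s \<in> word_congruences \<and> s \<subseteq> r)) \<and>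
    (\<forall>P. finely P \<or> finely (\<lambda>x :: ('a list \<times> 'a list) set. \<not> P x))"
    unfolding congruence_ultrafilter_def .
  show "(congruence_ultrafilter :: ('a list \<times> 'a list) set filter) \<noteq> bot"
    using * by (rule conjunct1)
  show "finely (\<lambda>s :: ('a list \<times> 'a list) set. s \<in> word_congruences \<and> s \<subseteq> r)"
    if "r \<in> word_congruences" for r
    using * that by blast
  show "finely P \<or> finely (\<lambda>s :: ('a list \<times> 'a list) set. \<not> P s)" for P
    using * by blast
qed

lemma finely_ex: "finely P \<Longrightarrow> \<exists>s. P s"
  using eventually_happens congruence_ultrafilter_not_bot by blast

lemma finely_finite_union:
  assumes "finite C" "finely (\<lambda>s. w s \<in> \<Union>C)"
  shows "\<exists>c\<in>C. finely (\<lambda>s. w s \<in> c)"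
  using assms
proof (induction C rule: finite_induct)
  case empty
  then show ?case using finely_ex by fastforce
next
  case (insert c C)
  show ?case
  proof (cases "finely (\<lambda>s. w s \<in> c)")
    case True
    then show ?thesis by blast
  next
    case False
    then have "finely (\<lambda>s. w s \<notin> c)" using finely_ultra by blast
    then have "finely (\<lambda>s. w s \<in> \<Union>C)"
      using insert.prems by eventually_elim simp
    then show ?thesis using insert.IH by blast
  qed
qed

text \<open>Coordinate \<open>r\<close> collects the words congruent to almost all
  \<open>w s\<close>. There are finitely many \<open>r\<close>-classes, so the ultrafilter selects
  exactly one of them.\<close>

definition profinite_lim :: "(('a list \<times> 'a list) set \<Rightarrow> 'a list) \<Rightarrow> 'a profinite_word"
  where "profinite_lim w = (\<lambda>r\<in>word_congruences. {v. finely (\<lambda>s. (w s, v) \<in> r)})"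

lemma profinite_lim_mem:
  "r \<in> word_congruences \<Longrightarrow> v \<in> profinite_lim w r \<longleftrightarrow> finely (\<lambda>s. (w s, v) \<in> r)"
  by (simp add: profinite_lim_def)

lemma profinite_lim_ex:
  assumes r: "r \<in> word_congruences"
  shows "\<exists>v. v \<in> profinite_lim w r"
proof -
  have "\<Union>(UNIV // r) = UNIV" using word_congruenceD(2)[OF r] by (rule Union_quotient)
  then have "finely (\<lambda>s. w s \<in> \<Union>(UNIV // r))" by simp
  from finely_finite_union[OF word_congruenceD(3)[OF r] this]
  obtain c where c: "c \<in> UNIV // r" "finely (\<lambda>s. w s \<in> c)" by blast
  from c(1) obtain v where v: "c = r `` {v}" by (rule quotientE)
  have "finely (\<lambda>s. (w s, v) \<in> r)"
    using c(2) by eventually_elim (use v word_congruenceD(6)[OF r] in blast)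
  then show ?thesis using profinite_lim_mem[OF r] by blast
qed

lemma profinite_lim_carrier: "profinite_lim w \<in> carrier free_profinite"
  unfolding free_profinite_carrier
proof (intro conjI ballI impI)
  show "profinite_lim w \<in> extensional word_congruences" by (simp add: profinite_lim_def)
  fix r :: "('a list \<times> 'a list) set" assume r: "r \<in> word_congruences"
  obtain v where v: "v \<in> profinite_lim w r" using profinite_lim_ex[OF r] by blast
  have "profinite_lim w r = r `` {v}"
  proof (intro equalityI subsetI)
    fix z assume "z \<in> profinite_lim w r"
    then have "finely (\<lambda>s. (w s, z) \<in> r \<and> (w s, v) \<in> r)"
      using v unfolding profinite_lim_mem[OF r] by (rule eventually_conj)
    then obtain s where "(w s, z) \<in> r" "(w s, v) \<in> r" using finely_ex by blast
    then show "z \<in> r `` {v}" using word_congruenceD(6,7)[OF r] by blast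
  next
    fix z assume "z \<in> r `` {v}"
    then show "z \<in> profinite_lim w r"
      using v unfolding profinite_lim_mem[OF r]
      by (elim eventually_mono) (use word_congruenceD(7)[OF r] in blast)
  qed
  then show "profinite_lim w r \<in> UNIV // r" by (simp add: quotientI)
  fix s :: "('a list \<times> 'a list) set" assume s: "s \<in> word_congruences" "r \<subseteq> s"
  show "profinite_lim w r \<subseteq> profinite_lim w s"
    using s(2) by (auto simp: profinite_lim_mem[OF r] profinite_lim_mem[OF s(1)] elim!: eventually_mono)
qed

lemma finely_congruence: "finely (\<lambda>s. s \<in> word_congruences)"
  using finely_refines[OF word_congruence_UNIV] by eventually_elim simp

text \<open>Almost every index \<open>s\<close> refines a given \<open>r\<close>, and then
  \<open>w s\<close> lies in \<open>x s\<close>, hence in \<open>x r\<close>.\<close>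

lemma profinite_lim_eqI:
  assumes x: "x \<in> carrier free_profinite" and w: "\<And>s. s \<in> word_congruences \<Longrightarrow> w s \<in> x s"
  shows "profinite_lim w = x"
proof (rule free_profinite_eqI[OF profinite_lim_carrier x])
  fix r :: "('a list \<times> 'a list) set" assume r: "r \<in> word_congruences"
  obtain v where v: "v \<in> profinite_lim w r" using profinite_lim_ex[OF r] by blast
  then have "finely (\<lambda>s. (w s, v) \<in> r \<and> s \<in> word_congruences \<and> s \<subseteq> r)"
    using finely_refines[OF r] unfolding profinite_lim_mem[OF r] by (rule eventually_conj)
  then obtain s where s: "(w s, v) \<in> r" "s \<in> word_congruences" "s \<subseteq> r" using finely_ex by blast
  have "w s \<in> x r" using w[OF s(2)] free_profinite_mono[OF x s(2) r s(3)] by blast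
  then have "v \<in> x r" using free_profinite_class[OF x r] s(1) by blast
  then show "\<exists>v. v \<in> profinite_lim w r \<and> v \<in> x r" using v by blast
qed

lemma profinite_lim_mult:
  "profinite_lim u \<otimes>\<^bsub>free_profinite\<^esub> profinite_lim v = profinite_lim (\<lambda>s. u s @ v s)"
proof (rule free_profinite_eqI[OF free_profinite_mult_closed[OF profinite_lim_carrier profinite_lim_carrier] profinite_lim_carrier])
  fix r :: "('a list \<times> 'a list) set" assume r: "r \<in> word_congruences"
  obtain a where a: "a \<in> profinite_lim u r" using profinite_lim_ex[OF r] by blast
  obtain b where b: "b \<in> profinite_lim v r" using profinite_lim_ex[OF r] by blast
  have "finely (\<lambda>s. (u s @ v s, a @ b) \<in> r)"
    using a b unfolding profinite_lim_mem[OF r]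
    by eventually_elim (rule word_congruenceD(4)[OF r])
  then have "a @ b \<in> profinite_lim (\<lambda>s. u s @ v s) r" by (simp add: profinite_lim_mem[OF r])
  moreover have "a @ b \<in> (profinite_lim u \<otimes>\<^bsub>free_profinite\<^esub> profinite_lim v) r"
    by (rule free_profinite_mult_memI[OF profinite_lim_carrier profinite_lim_carrier r a b])
  ultimately show "\<exists>w. w \<in> (profinite_lim u \<otimes>\<^bsub>free_profinite\<^esub> profinite_lim v) r \<and>
    w \<in> profinite_lim (\<lambda>s. u s @ v s) r" by blast
qed

lemma profinite_lim_cong:
  assumes "\<And>s. s \<in> word_congruences \<Longrightarrow> u s = v s"
  shows "profinite_lim u = profinite_lim v"
proof (rule free_profinite_eqI[OF profinite_lim_carrier profinite_lim_carrier])
  fix r :: "('a list \<times> 'a list) set" assume r: "r \<in> word_congruences"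
  obtain a where a: "a \<in> profinite_lim u r" using profinite_lim_ex[OF r] by blast
  then have "finely (\<lambda>s. (v s, a) \<in> r)"
    using finely_congruence unfolding profinite_lim_mem[OF r]
    by eventually_elim (simp add: assms)
  then show "\<exists>w. w \<in> profinite_lim u r \<and> w \<in> profinite_lim v r"
    using a by (auto simp: profinite_lim_mem[OF r])
qed

lemma profinite_lim_in_closure:
  assumes w: "\<And>s. s \<in> word_congruences \<Longrightarrow> w s \<in> Y"
  shows "profinite_lim w \<in> profinite_closure Y"
  unfolding profinite_closure_iff
proof (intro conjI ballI profinite_lim_carrier)
  fix r :: "('a list \<times> 'a list) set" assume r: "r \<in> word_congruences"
  obtain v where v: "v \<in> profinite_lim w r" using profinite_lim_ex[OF r] by blast
  have "finely (\<lambda>s. w s \<in> Y \<and> (v, w s) \<in> r)"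
    using finely_congruence v[unfolded profinite_lim_mem[OF r]]
    by eventually_elim (use w word_congruenceD(6)[OF r] in blast)
  then obtain s where "w s \<in> Y" "(v, w s) \<in> r" using finely_ex by blast
  then show "\<exists>w'\<in>Y. w' \<in> profinite_lim w r"
    using free_profinite_class[OF profinite_lim_carrier r v] by blast
qed

text \<open>For each congruence \<open>s\<close> a word of \<open>Y\<close> in \<open>x s\<close> is
  chosen. Properties of the words of \<open>F\<close> can thus be applied index by index and carried
  to the closure by taking limits.\<close>

lemma profinite_closure_sequence:
  assumes "x \<in> profinite_closure Y"
  obtains w where "\<And>s. s \<in> word_congruences \<Longrightarrow> w s \<in> Y" "\<And>s. s \<in> word_congruences \<Longrightarrow> w s \<in> x s"
    "x = profinite_lim w"
proof -
  have x: "x \<in> carrier free_profinite" and "\<forall>r\<in>word_congruences. \<exists>w. w \<in> Y \<and> w \<in> x r"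
    using assms by (auto simp: profinite_closure_iff)
  from bchoice[OF this(2)] obtain w where w: "\<forall>r\<in>word_congruences. w r \<in> Y \<and> w r \<in> x r" by blast
  then show ?thesis using that[of w] profinite_lim_eqI[OF x, of w] by blast
qed

lemma profinite_closure_UNIV: "profinite_closure UNIV = carrier free_profinite"
  using free_profinite_ex_word by (auto simp: profinite_closure_iff)

section \<open>The regular class of a recurrent set\<close>

lemma recurrent_contains_finite:
  assumes F: "recurrent F" and "finite R" "R \<subseteq> F"
  shows "\<exists>w\<in>F. \<forall>u\<in>R. sublist u w"
  using assms(2,3)
proof (induction R rule: finite_induct)
  case empty
  then show ?case using F by (auto simp: recurrent_def)
next
  case (insert u R)
  then obtain w where w: "w \<in> F" "\<And>v. v \<in> R \<Longrightarrow> sublist v w" by auto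
  have "u \<in> F" using insert.prems by simp
  then obtain k where k: "u @ k @ w \<in> F"
    using F w(1) unfolding recurrent_def by blast
  have "sublist u (u @ k @ w)"
    unfolding sublist_def by (intro exI[of _ "[]"] exI[of _ "k @ w"]) simp
  moreover have "sublist v (u @ k @ w)" if v: "v \<in> R" for v
  proof -
    obtain p q where "w = p @ v @ q" using w(2)[OF v] by (auto simp: sublist_def)
    then have "u @ k @ w = (u @ k @ p) @ v @ q" by simp
    then show ?thesis unfolding sublist_def by blast
  qed
  ultimately show ?case using k by blast
qed

lemma free_profinite_sequence:
  assumes "x \<in> carrier free_profinite"
  obtains w where "\<And>s. s \<in> word_congruences \<Longrightarrow> w s \<in> x s" "x = profinite_lim w"
  using assms profinite_closure_sequence[of x UNIV] unfolding profinite_closure_UNIV by blast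

text \<open>
  The limit of words \<open>x\<^sub>s \<in> F\<close> containing a representative of every \<open>s\<close>-class that meets \<open>F\<close>.
\<close>

lemma ex_minimal_in_closure:
  assumes F: "recurrent F"
  shows "\<exists>x\<in>profinite_closure F. \<forall>y\<in>profinite_closure F.
    \<exists>p\<in>carrier free_profinite. \<exists>q\<in>carrier free_profinite.
      x = p \<otimes>\<^bsub>free_profinite\<^esub> y \<otimes>\<^bsub>free_profinite\<^esub> q"
proof -
  define rep where "rep c = (SOME w. w \<in> c \<and> w \<in> F)" for c
  have rep: "rep c \<in> c \<and> rep c \<in> F" if "\<exists>w. w \<in> c \<and> w \<in> F" for c
    unfolding rep_def using that by (rule someI_ex)
  define R where "R s = rep ` {c \<in> UNIV // s. \<exists>w. w \<in> c \<and> w \<in> F}" for s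
  have R: "rep c \<in> R s" if "c \<in> UNIV // s" "\<exists>w. w \<in> c \<and> w \<in> F" for c s
    unfolding R_def using that by simp
  have "\<exists>w\<in>F. \<forall>u\<in>R s. sublist u w" if "s \<in> word_congruences" for s
  proof (rule recurrent_contains_finite[OF F])
    show "finite (R s)" unfolding R_def using word_congruenceD(3)[OF that] by simp
    show "R s \<subseteq> F"
    proof
      fix u assume "u \<in> R s"
      then obtain c where "u = rep c" "\<exists>w. w \<in> c \<and> w \<in> F" unfolding R_def by blast
      then show "u \<in> F" using rep[of c] by simp
    qed
  qed
  then have "\<forall>s\<in>word_congruences. \<exists>w. w \<in> F \<and> (\<forall>u\<in>R s. sublist u w)" by blast
  from bchoice[OF this] obtain w where w: "\<forall>s\<in>word_congruences. w s \<in> F \<and> (\<forall>u\<in>R s. sublist u (w s))"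
    by blast
  have "\<exists>p\<in>carrier free_profinite. \<exists>q\<in>carrier free_profinite.
      profinite_lim w = p \<otimes>\<^bsub>free_profinite\<^esub> y \<otimes>\<^bsub>free_profinite\<^esub> q"
    if y: "y \<in> profinite_closure F" for y
  proof -
    have yc: "y \<in> carrier free_profinite" using y by (simp add: profinite_closure_iff)
    have cl: "y s \<in> UNIV // s \<and> (\<exists>w. w \<in> y s \<and> w \<in> F)" if "s \<in> word_congruences" for s
      using y that by (auto simp: profinite_closure_iff free_profinite_carrier)
    have "\<exists>pq. w s = fst pq @ rep (y s) @ snd pq" if s: "s \<in> word_congruences" for s
    proof -
      have "sublist (rep (y s)) (w s)" using w s R cl[OF s] by blast
      then obtain p q where "w s = p @ rep (y s) @ q" by (auto simp: sublist_def)
      then show ?thesis by (intro exI[of _ "(p, q)"]) simp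
    qed
    then have "\<forall>s\<in>word_congruences. \<exists>pq. w s = fst pq @ rep (y s) @ snd pq" by blast
    from bchoice[OF this] obtain pq where
      pq: "\<forall>s\<in>word_congruences. w s = fst (pq s) @ rep (y s) @ snd (pq s)" by blast
    have "profinite_lim (\<lambda>s. rep (y s)) = y"
      using rep cl by (intro profinite_lim_eqI[OF yc]) blast
    then have "profinite_lim (\<lambda>s. fst (pq s)) \<otimes>\<^bsub>free_profinite\<^esub> y \<otimes>\<^bsub>free_profinite\<^esub> profinite_lim (\<lambda>s. snd (pq s))
        = profinite_lim (\<lambda>s. (fst (pq s) @ rep (y s)) @ snd (pq s))"
      using profinite_lim_mult[of "\<lambda>s. fst (pq s)" "\<lambda>s. rep (y s)"]
        profinite_lim_mult[of "\<lambda>s. fst (pq s) @ rep (y s)" "\<lambda>s. snd (pq s)"] by simp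
    also have "\<dots> = profinite_lim w"
      using pq by (intro profinite_lim_cong) simp
    finally show ?thesis using profinite_lim_carrier by metis
  qed
  moreover have "profinite_lim w \<in> profinite_closure F"
    using w by (intro profinite_lim_in_closure) blast
  ultimately show ?thesis by blast
qed

lemma closure_recurrent:
  assumes F: "recurrent F" and x: "x \<in> profinite_closure F"
  shows "\<exists>w\<in>carrier free_profinite. x \<otimes>\<^bsub>free_profinite\<^esub> w \<otimes>\<^bsub>free_profinite\<^esub> x \<in> profinite_closure F"
proof -
  obtain a where a: "\<And>s. s \<in> word_congruences \<Longrightarrow> a s \<in> F" "x = profinite_lim a"
    using profinite_closure_sequence[OF x] by blast
  have "\<forall>s\<in>word_congruences. \<exists>v. a s @ v @ a s \<in> F"
    using a(1) F unfolding recurrent_def by blast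
  from bchoice[OF this] obtain v where v: "\<forall>s\<in>word_congruences. a s @ v s @ a s \<in> F" by blast
  have "x \<otimes>\<^bsub>free_profinite\<^esub> profinite_lim v \<otimes>\<^bsub>free_profinite\<^esub> x = profinite_lim (\<lambda>s. (a s @ v s) @ a s)"
    unfolding a(2) profinite_lim_mult ..
  moreover have "profinite_lim (\<lambda>s. (a s @ v s) @ a s) \<in> profinite_closure F"
    using v by (intro profinite_lim_in_closure) simp
  ultimately show ?thesis using profinite_lim_carrier by metis
qed

text \<open>The product has three factors, so a word of \<open>F\<close> close to it is split by two
  successive splitting congruences; its middle piece is in \<open>F\<close> by factoriality and
  close to \<open>x\<close>.\<close>

lemma closure_factorial:
  assumes F: "factorial_lang F" and c: "u \<in> carrier free_profinite" "x \<in> carrier free_profinite"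
    "v \<in> carrier free_profinite"
    and uxv: "u \<otimes>\<^bsub>free_profinite\<^esub> x \<otimes>\<^bsub>free_profinite\<^esub> v \<in> profinite_closure F"
  shows "x \<in> profinite_closure F"
  unfolding profinite_closure_iff
proof (intro conjI ballI c)
  fix r :: "('a list \<times> 'a list) set" assume r: "r \<in> word_congruences"
  obtain s where s: "s \<in> word_congruences" "s \<subseteq> r"
    "\<And>w a b. (w, a @ b) \<in> s \<Longrightarrow> \<exists>a' b'. w = a' @ b' \<and> (a', a) \<in> r \<and> (b', b) \<in> r"
    using ex_splitting_congruence[OF r] by blast
  obtain t where t: "t \<in> word_congruences" "t \<subseteq> s"
    "\<And>w a b. (w, a @ b) \<in> t \<Longrightarrow> \<exists>a' b'. w = a' @ b' \<and> (a', a) \<in> s \<and> (b', b) \<in> s"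
    using ex_splitting_congruence[OF s(1)] by blast
  obtain a b d where abd: "a \<in> u t" "b \<in> x t" "d \<in> v t"
    using free_profinite_ex_word[OF c(1) t(1)] free_profinite_ex_word[OF c(2) t(1)]
      free_profinite_ex_word[OF c(3) t(1)] by blast
  have ab: "a @ b \<in> (u \<otimes>\<^bsub>free_profinite\<^esub> x) t"
    by (rule free_profinite_mult_memI[OF c(1,2) t(1) abd(1,2)])
  have "(u \<otimes>\<^bsub>free_profinite\<^esub> x \<otimes>\<^bsub>free_profinite\<^esub> v) t = t `` {(a @ b) @ d}"
    by (rule free_profinite_mult_class[OF free_profinite_mult_closed[OF c(1,2)] c(3) t(1) ab abd(3)])
  then obtain w where w: "w \<in> F" "((a @ b) @ d, w) \<in> t"
    using uxv t(1) by (auto simp: profinite_closure_iff)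
  obtain w1 d' where w1: "w = w1 @ d'" "(w1, a @ b) \<in> s"
    using t(3)[OF word_congruenceD(6)[OF t(1) w(2)]] by blast
  obtain a' b' where b': "w1 = a' @ b'" "(b', b) \<in> r"
    using s(3)[OF w1(2)] by blast
  have "b' \<in> F" using factorial_langD[OF F, of a' b' d'] w(1) w1(1) b'(1) by simp
  moreover have "b \<in> x r" using abd(2) free_profinite_mono[OF c(2) t(1) r] t(2) s(2) by blast
  then have "b' \<in> x r"
    using free_profinite_class[OF c(2) r] word_congruenceD(6)[OF r b'(2)] by blast
  ultimately show "\<exists>w\<in>F. w \<in> x r" by blast
qed

section \<open>Idempotents as limits of powers\<close>

abbreviation word_power :: "nat \<Rightarrow> 'a list \<Rightarrow> 'a list"
  where "word_power n w \<equiv> concat (replicate n w)"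

lemma word_power_add: "word_power (m + n) w = word_power m w @ word_power n w"
  by (simp add: replicate_add)

lemma ex_idempotent_power:
  assumes r: "r \<in> word_congruences"
  shows "\<exists>n>0. (word_power n w @ word_power n w, word_power n w) \<in> r"
proof -
  have "\<not> inj (\<lambda>n. r `` {word_power n w})"
  proof
    assume "inj (\<lambda>n. r `` {word_power n w})"
    moreover have "range (\<lambda>n. r `` {word_power n w}) \<subseteq> UNIV // r"
      by (auto intro: quotientI)
    ultimately show False
      using word_congruenceD(3)[OF r] by (meson finite_subset infinite_UNIV_nat finite_imageD)
  qed
  then obtain i j where ij: "i \<noteq> j" "r `` {word_power i w} = r `` {word_power j w}"
    unfolding inj_def by blast
  have ij': "(word_power i w, word_power j w) \<in> r" "(word_power j w, word_power i w) \<in> r"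
    using ij(2) word_congruence_Image_eq_iff[OF r] word_congruenceD(6)[OF r] by blast+
  have "\<exists>i d. d > 0 \<and> (word_power (i + d) w, word_power i w) \<in> r"
  proof (cases "i < j")
    case True
    then have "j - i > 0" "(word_power (i + (j - i)) w, word_power i w) \<in> r" using ij' by simp_all
    then show ?thesis by blast
  next
    case False
    then have "i - j > 0" "(word_power (j + (i - j)) w, word_power j w) \<in> r" using ij(1) ij' by simp_all
    then show ?thesis by blast
  qed
  then obtain i d where d: "d > 0" "(word_power (i + d) w, word_power i w) \<in> r" by blast
  have shift: "(word_power (i + m + d) w, word_power (i + m) w) \<in> r" for m
  proof -
    have "(word_power (i + d) w @ word_power m w, word_power i w @ word_power m w) \<in> r"
      by (rule word_congruenceD(4)[OF r d(2) word_congruenceD(5)[OF r]])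
    then have "(word_power (i + d + m) w, word_power (i + m) w) \<in> r"
      by (simp only: word_power_add)
    moreover have "i + d + m = i + m + d" by simp
    ultimately show ?thesis by simp
  qed
  have iter: "(word_power (i + m + k * d) w, word_power (i + m) w) \<in> r" for m k
  proof (induction k)
    case 0
    then show ?case using word_congruenceD(5)[OF r] by simp
  next
    case (Suc k)
    have "(word_power (i + (m + k * d) + d) w, word_power (i + (m + k * d)) w) \<in> r" by (rule shift)
    moreover have "i + (m + k * d) + d = i + m + Suc k * d" "i + (m + k * d) = i + m + k * d" by simp_all
    ultimately have "(word_power (i + m + Suc k * d) w, word_power (i + m + k * d) w) \<in> r" by (simp only:)
    then show ?case by (rule word_congruenceD(7)[OF r _ Suc.IH])
  qed
  \<comment> \<open>A multiple of the period \<open>d\<close> that is at least \<open>i\<close>,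
    from where on the powers are periodic; \<open>Suc i\<close> instead of \<open>i\<close> also
    keeps it positive.\<close>
  define n where "n = Suc i * d"
  have "Suc i * 1 \<le> Suc i * d" using d(1) by (intro mult_le_mono2) simp
  then have "i \<le> n" by (simp add: n_def)
  then obtain m where m: "n = i + m" using le_Suc_ex by blast
  have "(word_power (n + n) w, word_power n w) \<in> r"
    using iter[of m "Suc i"] by (simp only: m[symmetric] n_def[symmetric])
  then show ?thesis
    using d(1) by (intro exI[of _ n]) (simp add: word_power_add n_def)
qed

text \<open>From \<open>x = p x y\<close> one gets \<open>x = p\<^sup>\<omega> x y\<^sup>\<omega>\<close>, with \<open>y\<^sup>\<omega>\<close> idempotent.\<close>

lemma ex_idempotent_right_stabilizer:
  assumes c: "p \<in> carrier free_profinite" "x \<in> carrier free_profinite" "y \<in> carrier free_profinite"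
    and eq: "x = p \<otimes>\<^bsub>free_profinite\<^esub> x \<otimes>\<^bsub>free_profinite\<^esub> y"
  shows "\<exists>e\<in>idempotents free_profinite.
    (\<exists>z\<in>carrier free_profinite. e = y \<otimes>\<^bsub>free_profinite\<^esub> z) \<and>
    (\<exists>q\<in>carrier free_profinite. x = q \<otimes>\<^bsub>free_profinite\<^esub> x \<otimes>\<^bsub>free_profinite\<^esub> e)"
proof -
  obtain a where a: "\<And>s. s \<in> word_congruences \<Longrightarrow> a s \<in> p s" "p = profinite_lim a"
    using free_profinite_sequence[OF c(1)] by blast
  obtain b where b: "\<And>s. s \<in> word_congruences \<Longrightarrow> b s \<in> x s" "x = profinite_lim b"
    using free_profinite_sequence[OF c(2)] by blast
  obtain d where d: "\<And>s. s \<in> word_congruences \<Longrightarrow> d s \<in> y s" "y = profinite_lim d"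
    using free_profinite_sequence[OF c(3)] by blast
  have "\<forall>s\<in>word_congruences. \<exists>n>0. (word_power n (d s) @ word_power n (d s), word_power n (d s)) \<in> s"
    using ex_idempotent_power by blast
  from bchoice[OF this] obtain n where n: "\<forall>s\<in>word_congruences. n s > 0 \<and>
    (word_power (n s) (d s) @ word_power (n s) (d s), word_power (n s) (d s)) \<in> s" by blast
  have step: "(a s @ b s @ d s, b s) \<in> s" if s: "s \<in> word_congruences" for s
  proof -
    have "a s @ b s \<in> (p \<otimes>\<^bsub>free_profinite\<^esub> x) s"
      by (rule free_profinite_mult_memI[OF c(1,2) s a(1)[OF s] b(1)[OF s]])
    from free_profinite_mult_class[OF free_profinite_mult_closed[OF c(1,2)] c(3) s this d(1)[OF s]]
    have "x s = s `` {(a s @ b s) @ d s}" using eq by simp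
    then show ?thesis using b(1)[OF s] by simp
  qed
  have iter: "(word_power k (a s) @ b s @ word_power k (d s), b s) \<in> s" if s: "s \<in> word_congruences" for s k
  proof (induction k)
    case 0
    then show ?case using word_congruenceD(5)[OF s] by simp
  next
    case (Suc k)
    have "(word_power k (a s) @ (a s @ b s @ d s) @ word_power k (d s),
        word_power k (a s) @ b s @ word_power k (d s)) \<in> s"
      by (intro word_congruenceD(4)[OF s] word_congruenceD(5)[OF s] step[OF s])
    moreover have "word_power (Suc k) (a s) = word_power k (a s) @ a s"
      using word_power_add[of k 1 "a s"] by simp
    ultimately show ?case using Suc word_congruenceD(7)[OF s] by simp
  qed
  \<comment> \<open>The exponent varies with \<open>s\<close>: each power is idempotent only modulo
    its own \<open>s\<close>, but along the ultrafilter \<open>s\<close> becomes finer than any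
    given congruence.\<close>
  define e where "e = profinite_lim (\<lambda>s. word_power (n s) (d s))"
  have ec: "e \<in> carrier free_profinite" by (simp add: e_def profinite_lim_carrier)
  have lim_eq: "profinite_lim u = profinite_lim v"
    if uv: "\<And>s. s \<in> word_congruences \<Longrightarrow> (u s, v s) \<in> s" for u v :: "('a list \<times> 'a list) set \<Rightarrow> 'a list"
  proof (rule free_profinite_eqI[OF profinite_lim_carrier profinite_lim_carrier])
    fix r :: "('a list \<times> 'a list) set" assume r: "r \<in> word_congruences"
    obtain z where z: "z \<in> profinite_lim v r" using profinite_lim_ex[OF r] by blast
    have "finely (\<lambda>s. (u s, z) \<in> r)"
      using z[unfolded profinite_lim_mem[OF r]] finely_refines[OF r]
      by eventually_elim (use uv word_congruenceD(7)[OF r] in blast)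
    then show "\<exists>w. w \<in> profinite_lim u r \<and> w \<in> profinite_lim v r"
      using z by (auto simp: profinite_lim_mem[OF r])
  qed
  have "e \<otimes>\<^bsub>free_profinite\<^esub> e = e"
    unfolding e_def profinite_lim_mult using n by (intro lim_eq) blast
  then have "e \<in> idempotents free_profinite" using ec by (simp add: idempotents_def)
  moreover have "e = y \<otimes>\<^bsub>free_profinite\<^esub> profinite_lim (\<lambda>s. word_power (n s - 1) (d s))"
  proof -
    \<comment> \<open>A positive exponent exposes one factor \<open>d s\<close>, which makes
      \<open>e\<close> a right multiple of \<open>y\<close>.\<close>
    have "word_power (n s) (d s) = d s @ word_power (n s - 1) (d s)" if "s \<in> word_congruences" for s
    proof -
      have "n s > 0" using n that by blast
      then show ?thesis by (cases "n s") simp_all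
    qed
    then show ?thesis
      unfolding e_def d(2) profinite_lim_mult by (rule profinite_lim_cong)
  qed
  moreover have "x = profinite_lim (\<lambda>s. word_power (n s) (a s)) \<otimes>\<^bsub>free_profinite\<^esub> x \<otimes>\<^bsub>free_profinite\<^esub> e"
  proof -
    have "profinite_lim (\<lambda>s. (word_power (n s) (a s) @ b s) @ word_power (n s) (d s)) = profinite_lim b"
      using iter by (intro lim_eq) simp
    then show ?thesis unfolding b(2) e_def profinite_lim_mult by simp
  qed
  ultimately show ?thesis using profinite_lim_carrier by blast
qed

section \<open>Existence and uniqueness of the class of a recurrent set\<close>

definition is_J_class_of :: "'a list set \<Rightarrow> 'a profinite_word set \<Rightarrow> bool"
  where "is_J_class_of F J \<longleftrightarrow> regular_J_class free_profinite J \<and>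
    J \<subseteq> profinite_closure F \<and>
    profinite_closure F = {x \<in> carrier free_profinite.
      \<exists>u\<in>carrier free_profinite. \<exists>v\<in>carrier free_profinite.
        u \<otimes>\<^bsub>free_profinite\<^esub> x \<otimes>\<^bsub>free_profinite\<^esub> v \<in> J}"

lemma ex_is_J_class_of:
  assumes F: "recurrent F"
  shows "\<exists>J. is_J_class_of F J"
proof -
  let ?P = "free_profinite :: 'a profinite_word monoid"
  interpret P: monoid ?P by (rule monoid_free_profinite)
  have fac: "factorial_lang F" using F by (simp add: recurrent_def)
  obtain x where x: "x \<in> profinite_closure F"
    and min: "\<And>y. y \<in> profinite_closure F \<Longrightarrow>
      \<exists>p\<in>carrier ?P. \<exists>q\<in>carrier ?P. x = p \<otimes>\<^bsub>?P\<^esub> y \<otimes>\<^bsub>?P\<^esub> q"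
    using ex_minimal_in_closure[OF F] by blast
  have xc: "x \<in> carrier ?P" using x by (simp add: profinite_closure_iff)
  obtain w where w: "w \<in> carrier ?P" "x \<otimes>\<^bsub>?P\<^esub> w \<otimes>\<^bsub>?P\<^esub> x \<in> profinite_closure F"
    using closure_recurrent[OF F x] by blast
  obtain p q where pq: "p \<in> carrier ?P" "q \<in> carrier ?P"
    "x = p \<otimes>\<^bsub>?P\<^esub> (x \<otimes>\<^bsub>?P\<^esub> w \<otimes>\<^bsub>?P\<^esub> x) \<otimes>\<^bsub>?P\<^esub> q"
    using min[OF w(2)] by blast
  \<comment> \<open>Recurrence puts \<open>x w x\<close> into the closure and minimality makes it a
    factor of \<open>x\<close>, so \<open>x = p x y\<close> for this \<open>y\<close>. As
    \<open>x\<close> occurs in \<open>y\<close>, the idempotent obtained from \<open>y\<close> has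
    \<open>x\<close> as a factor, and it is itself a factor of \<open>x\<close>.\<close>
  let ?y = "w \<otimes>\<^bsub>?P\<^esub> x \<otimes>\<^bsub>?P\<^esub> q"
  have yc: "?y \<in> carrier ?P" using w(1) xc pq(2) by simp
  have "p \<otimes>\<^bsub>?P\<^esub> (x \<otimes>\<^bsub>?P\<^esub> w \<otimes>\<^bsub>?P\<^esub> x) \<otimes>\<^bsub>?P\<^esub> q = p \<otimes>\<^bsub>?P\<^esub> x \<otimes>\<^bsub>?P\<^esub> ?y"
    using w(1) xc pq(1,2) by (simp add: P.m_assoc)
  then have eq: "x = p \<otimes>\<^bsub>?P\<^esub> x \<otimes>\<^bsub>?P\<^esub> ?y" using pq(3) by (rule trans[rotated])
  obtain e z p' where e: "e \<in> idempotents ?P" and z: "z \<in> carrier ?P" "e = ?y \<otimes>\<^bsub>?P\<^esub> z"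
    and p': "p' \<in> carrier ?P" "x = p' \<otimes>\<^bsub>?P\<^esub> x \<otimes>\<^bsub>?P\<^esub> e"
    using ex_idempotent_right_stabilizer[OF pq(1) xc yc eq] by blast
  have ec: "e \<in> carrier ?P" using e by (simp add: idempotents_def)
  have e_x: "e = w \<otimes>\<^bsub>?P\<^esub> x \<otimes>\<^bsub>?P\<^esub> (q \<otimes>\<^bsub>?P\<^esub> z)"
    unfolding z(2) using w(1) xc pq(2) z(1) by (simp add: P.m_assoc)
  have x_e: "(p' \<otimes>\<^bsub>?P\<^esub> x) \<otimes>\<^bsub>?P\<^esub> e \<otimes>\<^bsub>?P\<^esub> \<one>\<^bsub>?P\<^esub> = x"
    unfolding p'(2)[symmetric] using xc by simp
  have xJe: "(x, e) \<in> green_J ?P"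
    unfolding P.green_J_iff
    using xc ec e_x x_e[symmetric] w(1) pq(2) z(1) p'(1) P.one_closed P.m_closed by blast
  let ?J = "green_J ?P `` {e}"
  have J_x: "(x, j) \<in> green_J ?P" if "j \<in> ?J" for j
    using that xJe P.equiv_green_J by (meson Image_singleton_iff equivE transE)
  \<comment> \<open>Every \<open>j\<close> in the class is a factor of \<open>x\<close>, which lies
    in the closure; factoriality is applied to \<open>j\<close> and then to its factor
    \<open>y\<close>.\<close>
  have below: "y \<in> profinite_closure F"
    if "j \<in> ?J" "y \<in> carrier ?P" "u \<in> carrier ?P" "v \<in> carrier ?P" "j = u \<otimes>\<^bsub>?P\<^esub> y \<otimes>\<^bsub>?P\<^esub> v" for j y u v
  proof -
    from J_x[OF that(1)] obtain s t where
      st: "s \<in> carrier ?P" "t \<in> carrier ?P" "x = s \<otimes>\<^bsub>?P\<^esub> j \<otimes>\<^bsub>?P\<^esub> t"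
      unfolding P.green_J_iff by blast
    have jc: "j \<in> carrier ?P" using J_x[OF that(1)] unfolding P.green_J_iff by blast
    have "s \<otimes>\<^bsub>?P\<^esub> j \<otimes>\<^bsub>?P\<^esub> t \<in> profinite_closure F" using x st(3) by simp
    then have "u \<otimes>\<^bsub>?P\<^esub> y \<otimes>\<^bsub>?P\<^esub> v \<in> profinite_closure F"
      unfolding that(5)[symmetric] by (rule closure_factorial[OF fac st(1) jc st(2)])
    then show ?thesis by (rule closure_factorial[OF fac that(3,2,4)])
  qed
  have "regular_J_class ?P ?J"
    using e regular_J_class_iff[OF monoid_free_profinite] by blast
  moreover have "?J \<subseteq> profinite_closure F"
  proof
    fix j assume j: "j \<in> ?J"
    then have "j \<in> carrier ?P" using J_x unfolding P.green_J_iff by blast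
    then show "j \<in> profinite_closure F" using below[OF j, of j "\<one>\<^bsub>?P\<^esub>" "\<one>\<^bsub>?P\<^esub>"] by simp
  qed
  moreover have "profinite_closure F = {y \<in> carrier ?P.
      \<exists>u\<in>carrier ?P. \<exists>v\<in>carrier ?P. u \<otimes>\<^bsub>?P\<^esub> y \<otimes>\<^bsub>?P\<^esub> v \<in> ?J}" (is "_ = ?R")
  proof (intro equalityI subsetI)
    fix y assume y: "y \<in> profinite_closure F"
    obtain u v where uv: "u \<in> carrier ?P" "v \<in> carrier ?P" "x = u \<otimes>\<^bsub>?P\<^esub> y \<otimes>\<^bsub>?P\<^esub> v"
      using min[OF y] by blast
    have "x \<in> ?J" using xJe P.equiv_green_J by (meson Image_singleton_iff equivE symE)
    then have "u \<otimes>\<^bsub>?P\<^esub> y \<otimes>\<^bsub>?P\<^esub> v \<in> ?J" using uv(3) by simp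
    moreover have "y \<in> carrier ?P" using y by (simp add: profinite_closure_iff)
    ultimately show "y \<in> ?R" using uv(1,2) by blast
  next
    fix y assume "y \<in> ?R"
    then obtain u v where "y \<in> carrier ?P" "u \<in> carrier ?P" "v \<in> carrier ?P"
      "u \<otimes>\<^bsub>?P\<^esub> y \<otimes>\<^bsub>?P\<^esub> v \<in> ?J" by blast
    then show "y \<in> profinite_closure F" using below by blast
  qed
  ultimately show ?thesis unfolding is_J_class_of_def by blast
qed

lemma is_J_class_of_factor:
  assumes J: "is_J_class_of F J" and j: "j \<in> J" and y: "y \<in> profinite_closure F"
  shows "\<exists>p\<in>carrier free_profinite. \<exists>q\<in>carrier free_profinite.
    j = p \<otimes>\<^bsub>free_profinite\<^esub> y \<otimes>\<^bsub>free_profinite\<^esub> q"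
proof -
  let ?P = "free_profinite :: 'a profinite_word monoid"
  interpret P: monoid ?P by (rule monoid_free_profinite)
  obtain u v where uv: "y \<in> carrier ?P" "u \<in> carrier ?P" "v \<in> carrier ?P" "u \<otimes>\<^bsub>?P\<^esub> y \<otimes>\<^bsub>?P\<^esub> v \<in> J"
    using J y unfolding is_J_class_of_def by blast
  have "J \<in> carrier ?P // green_J ?P" using J by (simp add: is_J_class_of_def regular_J_class_def)
  then have "(u \<otimes>\<^bsub>?P\<^esub> y \<otimes>\<^bsub>?P\<^esub> v, j) \<in> green_J ?P"
    using quotient_eq_iff[OF P.equiv_green_J] uv(4) j by metis
  then obtain s t where st: "s \<in> carrier ?P" "t \<in> carrier ?P"
    "j = s \<otimes>\<^bsub>?P\<^esub> (u \<otimes>\<^bsub>?P\<^esub> y \<otimes>\<^bsub>?P\<^esub> v) \<otimes>\<^bsub>?P\<^esub> t"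
    unfolding P.green_J_iff by blast
  have "j = (s \<otimes>\<^bsub>?P\<^esub> u) \<otimes>\<^bsub>?P\<^esub> y \<otimes>\<^bsub>?P\<^esub> (v \<otimes>\<^bsub>?P\<^esub> t)"
    unfolding st(3) using uv(1-3) st(1,2) by (simp add: P.m_assoc)
  then show ?thesis using uv(2,3) st(1,2) P.m_closed by blast
qed

text \<open>Both classes lie in the closure, so an element of either is a factor of any element of
  the other.\<close>

lemma is_J_class_of_unique:
  assumes J: "is_J_class_of F J" and K: "is_J_class_of F K"
  shows "J = K"
proof -
  let ?P = "free_profinite :: 'a profinite_word monoid"
  interpret P: monoid ?P by (rule monoid_free_profinite)
  have Jq: "J \<in> carrier ?P // green_J ?P" and Kq: "K \<in> carrier ?P // green_J ?P"
    using J K by (simp_all add: is_J_class_of_def regular_J_class_def)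
  obtain j k where jk: "j \<in> J" "k \<in> K"
    using J K unfolding is_J_class_of_def regular_J_class_def by blast
  have cl: "j \<in> profinite_closure F" "k \<in> profinite_closure F"
    using J K jk unfolding is_J_class_of_def by blast+
  then have "j \<in> carrier ?P" "k \<in> carrier ?P" by (simp_all add: profinite_closure_iff)
  then have "(j, k) \<in> green_J ?P"
    unfolding P.green_J_iff
    using is_J_class_of_factor[OF J jk(1) cl(2)] is_J_class_of_factor[OF K jk(2) cl(1)] by blast
  then show ?thesis using quotient_eqI[OF P.equiv_green_J Jq Kq jk] by blast
qed

lemma is_J_class_of_J_class_of:
  assumes F: "recurrent F"
  shows "is_J_class_of F (J_class_of F)"
proof -
  obtain J where J: "is_J_class_of F J" using ex_is_J_class_of[OF F] by blast
  have "J_class_of F = J"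
    unfolding J_class_of_def
    unfolding is_J_class_of_def[symmetric]
    by (rule the_equality[where P = "is_J_class_of F", OF J]) (rule is_J_class_of_unique[OF _ J])
  then show ?thesis using J by simp
qed

section \<open>Homomorphisms to syntactic monoids\<close>

lemma hom_idempotents:
  "h \<in> hom G H \<Longrightarrow> e \<in> idempotents G \<Longrightarrow> h e \<in> idempotents H"
  by (auto simp: idempotents_def hom_def Pi_def) metis

lemma hom_green_H:
  assumes "monoid G" "monoid H" and h: "h \<in> hom G H" and e: "e \<in> idempotents G"
    and y: "y \<in> green_H G `` {e}"
  shows "h y \<in> green_H H `` {h e}"
proof -
  have ec: "e \<in> carrier G" using e by (simp add: idempotents_def)
  obtain z z' where z: "y \<in> carrier G" "e \<otimes>\<^bsub>G\<^esub> y = y" "y \<otimes>\<^bsub>G\<^esub> e = y" "z \<in> carrier G" "y \<otimes>\<^bsub>G\<^esub> z = e"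
    "z' \<in> carrier G" "z' \<otimes>\<^bsub>G\<^esub> y = e"
    using y monoid.green_H_idempotent_iff[OF assms(1) e] by blast
  have "h e \<otimes>\<^bsub>H\<^esub> h y = h y" "h y \<otimes>\<^bsub>H\<^esub> h e = h y" "h y \<otimes>\<^bsub>H\<^esub> h z = h e" "h z' \<otimes>\<^bsub>H\<^esub> h y = h e"
    using hom_mult[OF h] z ec by metis+
  moreover have "h y \<in> carrier H" "h z \<in> carrier H" "h z' \<in> carrier H"
    using hom_in_carrier[OF h] z by blast+
  ultimately show ?thesis
    unfolding monoid.green_H_idempotent_iff[OF assms(2) hom_idempotents[OF h e]] by blast
qed

lemma hom_green_J:
  assumes "monoid G" "monoid H" and h: "h \<in> hom G H" and xy: "(x, y) \<in> green_J G"
  shows "(h x, h y) \<in> green_J H"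
proof -
  interpret G: monoid G by fact
  interpret H: monoid H by fact
  obtain s t s' t' where st: "x \<in> carrier G" "y \<in> carrier G" "s \<in> carrier G" "t \<in> carrier G"
    "y = s \<otimes>\<^bsub>G\<^esub> x \<otimes>\<^bsub>G\<^esub> t" "s' \<in> carrier G" "t' \<in> carrier G" "x = s' \<otimes>\<^bsub>G\<^esub> y \<otimes>\<^bsub>G\<^esub> t'"
    using xy unfolding G.green_J_iff by blast
  have h3: "h (a \<otimes>\<^bsub>G\<^esub> b \<otimes>\<^bsub>G\<^esub> c) = h a \<otimes>\<^bsub>H\<^esub> h b \<otimes>\<^bsub>H\<^esub> h c"
    if "a \<in> carrier G" "b \<in> carrier G" "c \<in> carrier G" for a b c
    using that by (simp add: hom_mult[OF h])
  have "h y = h s \<otimes>\<^bsub>H\<^esub> h x \<otimes>\<^bsub>H\<^esub> h t" using h3[OF st(3,1,4)] st(5) by simp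
  moreover have "h x = h s' \<otimes>\<^bsub>H\<^esub> h y \<otimes>\<^bsub>H\<^esub> h t'" using h3[OF st(6,2,7)] st(8) by simp
  moreover have "h z \<in> carrier H" if "z \<in> carrier G" for z using hom_in_carrier[OF h that] .
  ultimately show ?thesis unfolding H.green_J_iff using st(1-4,6,7) by blast
qed

text \<open>As \<open>S\<close> is an ideal of \<open>M\<close>, every nonempty ideal
  \<open>I\<close> of \<open>M\<close> meets \<open>S\<close> in a nonempty ideal of
  \<open>S\<close>. The minimum ideal of \<open>S\<close>, where \<open>e\<close> lies, is therefore
  inside \<open>I\<close>.\<close>

lemma nil_simple_ideal_idempotent:
  assumes M: "monoid M" and S: "S \<subseteq> carrier M" "\<And>m s. m \<in> carrier M \<Longrightarrow> s \<in> S \<Longrightarrow> m \<otimes>\<^bsub>M\<^esub> s \<in> S \<and> s \<otimes>\<^bsub>M\<^esub> m \<in> S"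
    and nil: "nil_simple (M\<lparr>carrier := S\<rparr>)" and e: "e \<in> idempotents M" "e \<in> S"
  shows "e \<in> min_ideal M"
  unfolding min_ideal_def
proof (rule InterI)
  fix I assume "I \<in> {I. I \<noteq> {} \<and> I \<subseteq> carrier M \<and>
    (\<forall>x\<in>I. \<forall>s\<in>carrier M. s \<otimes>\<^bsub>M\<^esub> x \<in> I \<and> x \<otimes>\<^bsub>M\<^esub> s \<in> I)}"
  then have I: "I \<noteq> {}" "I \<subseteq> carrier M"
    "\<And>x s. x \<in> I \<Longrightarrow> s \<in> carrier M \<Longrightarrow> s \<otimes>\<^bsub>M\<^esub> x \<in> I \<and> x \<otimes>\<^bsub>M\<^esub> s \<in> I" by blast+
  obtain i where "i \<in> I" using I(1) by blast
  then have "e \<otimes>\<^bsub>M\<^esub> i \<in> I \<inter> S" using S I e by blast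
  then have 1: "I \<inter> S \<noteq> {}" by blast
  have 2: "\<forall>x\<in>I \<inter> S. \<forall>s\<in>S. s \<otimes>\<^bsub>M\<^esub> x \<in> I \<inter> S \<and> x \<otimes>\<^bsub>M\<^esub> s \<in> I \<inter> S"
  proof (intro ballI)
    fix x s assume "x \<in> I \<inter> S" "s \<in> S"
    then show "s \<otimes>\<^bsub>M\<^esub> x \<in> I \<inter> S \<and> x \<otimes>\<^bsub>M\<^esub> s \<in> I \<inter> S"
      using I(3)[of x s] S(2)[of s x] S(1) by blast
  qed
  have "e \<in> idempotents (M\<lparr>carrier := S\<rparr>)" using e by (simp add: idempotents_def)
  then have "e \<in> min_ideal (M\<lparr>carrier := S\<rparr>)" using nil unfolding nil_simple_def by blast
  then have "e \<in> I \<inter> S"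
    unfolding min_ideal_def by (rule InterD) (use 1 2 in simp)
  then show "e \<in> I" by blast
qed

text \<open>A maximal subgroup has only one idempotent, so one that contains \<open>e\<close> can
  only be the one at \<open>e\<close>.\<close>

lemma maximal_subgroup_iff:
  assumes "monoid M" and e: "e \<in> J \<inter> idempotents M" and eS: "e \<in> S"
  shows "S \<in> maximal_subgroups M J \<longleftrightarrow> S = green_H M `` {e}"
proof
  assume "S \<in> maximal_subgroups M J"
  then obtain f where f: "f \<in> idempotents M" "S = green_H M `` {f}"
    by (auto simp: maximal_subgroups_def)
  have "e = f"
    using monoid.green_H_idempotent_unique[OF assms(1) f(1)] e eS f(2) by blast
  then show "S = green_H M `` {e}" using f(2) by simp
next
  assume "S = green_H M `` {e}"
  then show "S \<in> maximal_subgroups M J" using e by (auto simp: maximal_subgroups_def)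
qed

text \<open>The maps \<open>f\<close> and \<open>g\<close> have the same kernel on \<open>A\<close>,
  so sending \<open>f x\<close> to \<open>g x\<close> is a well-defined isomorphism between their
  images.\<close>

lemma group_at_iso_of_common_image:
  assumes hX: "\<And>x y. x \<in> A \<Longrightarrow> y \<in> A \<Longrightarrow> f (mA x y) = f x \<otimes>\<^bsub>G\<^esub> f y"
    and hZ: "\<And>x y. x \<in> A \<Longrightarrow> y \<in> A \<Longrightarrow> g (mA x y) = g x \<otimes>\<^bsub>H\<^esub> g y"
    and A: "\<And>x y. x \<in> A \<Longrightarrow> y \<in> A \<Longrightarrow> mA x y \<in> A"
    and onto: "f ` A = green_H G `` {a}" "g ` A = green_H H `` {b}"
    and eq: "\<And>x y. x \<in> A \<Longrightarrow> y \<in> A \<Longrightarrow> f x = f y \<longleftrightarrow> g x = g y"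
  shows "group_at G a \<cong> group_at H b"
proof -
  define k where "k z = g (SOME x. x \<in> A \<and> f x = z)" for z
  have kf: "k (f x) = g x" if x: "x \<in> A" for x
  proof -
    have "\<exists>y. y \<in> A \<and> f y = f x" using x by blast
    from someI_ex[OF this] show ?thesis unfolding k_def using eq[OF _ x] by blast
  qed
  have "k ` (f ` A) = g ` A" using kf by (simp add: image_image)
  moreover have "inj_on k (f ` A)"
    by (rule inj_onI) (use kf eq in auto)
  ultimately have "bij_betw k (green_H G `` {a}) (green_H H `` {b})"
    unfolding onto by (simp add: bij_betw_def)
  moreover have "k (z \<otimes>\<^bsub>G\<^esub> w) = k z \<otimes>\<^bsub>H\<^esub> k w" if "z \<in> f ` A" "w \<in> f ` A" for z w
  proof -
    obtain x y where xy: "x \<in> A" "y \<in> A" "z = f x" "w = f y" using \<open>z \<in> f ` A\<close> \<open>w \<in> f ` A\<close> by blast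
    have "k (f (mA x y)) = g (mA x y)" using kf A xy by blast
    then show ?thesis using hX[OF xy(1,2)] hZ[OF xy(1,2)] kf xy by simp
  qed
  ultimately have "k \<in> iso (group_at G a) (group_at H b)"
    unfolding onto by (auto simp: iso_def hom_def group_at_def bij_betw_def)
  then show ?thesis by (rule is_isoI)
qed

text \<open>On \<open>A\<close> the map \<open>f\<close> factors through \<open>g\<close>, so the
  image of \<open>g\<close> has at least \<open>card B = card C\<close> elements and fills
  \<open>C\<close>.\<close>

lemma image_full_of_card_eq:
  assumes "finite C" "g ` A \<subseteq> C" "f ` A = B" "card B = card C"
    and "\<And>x y. x \<in> A \<Longrightarrow> y \<in> A \<Longrightarrow> g x = g y \<Longrightarrow> f x = f y"
  shows "g ` A = C"
proof -
  have gA: "finite (g ` A)" using assms(1,2) finite_subset by blast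
  have "B \<subseteq> (\<lambda>z. f (SOME x. x \<in> A \<and> g x = z)) ` (g ` A)"
  proof
    fix b assume "b \<in> B"
    then obtain x where x: "x \<in> A" "b = f x" using assms(3) by blast
    have "\<exists>y. y \<in> A \<and> g y = g x" using x by blast
    from someI_ex[OF this] have "f (SOME y. y \<in> A \<and> g y = g x) = b"
      using assms(5)[OF _ x(1)] x(2) by blast
    then show "b \<in> (\<lambda>z. f (SOME x. x \<in> A \<and> g x = z)) ` (g ` A)" using x(1) by blast
  qed
  then have "card B \<le> card (g ` A)" by (rule surj_card_le[OF gA])
  then show ?thesis using assms(1,2,4) by (simp add: card_seteq)
qed

section \<open>The finite monoid of a language and evaluation of the extended homomorphism\<close>

lemma syntactic_hom_eq_iff:
  assumes "syntactic_congruence L \<in> word_congruences"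
  shows "syntactic_hom L u = syntactic_hom L v \<longleftrightarrow> (u, v) \<in> syntactic_congruence L"
  unfolding syntactic_hom_def by (rule word_congruence_Image_eq_iff[OF assms])

lemma syntactic_hom_mult:
  assumes "syntactic_congruence L \<in> word_congruences"
  shows "syntactic_hom L u \<otimes>\<^bsub>syntactic_monoid L\<^esub> syntactic_hom L v = syntactic_hom L (u @ v)"
  unfolding syntactic_hom_def syntactic_monoid_def
  by (rule quotient_monoid_mult[OF word_congruenceD(1)[OF assms]])

lemma syntactic_monoid_carrier: "carrier (syntactic_monoid L) = range (syntactic_hom L)"
  by (auto simp: syntactic_monoid_def quotient_monoid_carrier syntactic_hom_def quotient_def)

lemma monoid_syntactic_monoid:
  "syntactic_congruence L \<in> word_congruences \<Longrightarrow> monoid (syntactic_monoid L)"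
  unfolding syntactic_monoid_def by (rule monoid_quotient_monoid[OF word_congruenceD(1)])

lemma finite_syntactic_monoid:
  "syntactic_congruence L \<in> word_congruences \<Longrightarrow> finite (carrier (syntactic_monoid L))"
  unfolding syntactic_monoid_def quotient_monoid_carrier by (rule word_congruenceD(3))

text \<open>Any congruence finer than that of \<open>L\<close> can be used for evaluation, so a
  single word can represent an element for several languages at once.\<close>

lemma syntactic_hom_ext_word:
  assumes L: "syntactic_congruence L \<in> word_congruences" and r: "r \<in> word_congruences" "r \<subseteq> syntactic_congruence L"
    and x: "x \<in> carrier free_profinite" "w \<in> x r"
  shows "syntactic_hom_ext L x = syntactic_hom L w"
proof -
  have "w \<in> x (syntactic_congruence L)" using free_profinite_mono[OF x(1) r(1) L r(2)] x(2) by blast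
  then show ?thesis
    unfolding syntactic_hom_ext_eq[OF L x(1)] syntactic_hom_def by (rule free_profinite_class[OF x(1) L])
qed

lemma syntactic_hom_ext_hom:
  assumes L: "syntactic_congruence L \<in> word_congruences"
  shows "syntactic_hom_ext L \<in> hom free_profinite (syntactic_monoid L)"
proof (rule homI)
  fix x :: "'a profinite_word" assume x: "x \<in> carrier free_profinite"
  obtain w where "w \<in> x (syntactic_congruence L)" using free_profinite_ex_word[OF x L] by blast
  then show "syntactic_hom_ext L x \<in> carrier (syntactic_monoid L)"
    using syntactic_hom_ext_word[OF L L order_refl x] by (simp add: syntactic_monoid_carrier)
  fix y :: "'a profinite_word" assume y: "y \<in> carrier free_profinite"
  show "syntactic_hom_ext L (x \<otimes>\<^bsub>free_profinite\<^esub> y) =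
    syntactic_hom_ext L x \<otimes>\<^bsub>syntactic_monoid L\<^esub> syntactic_hom_ext L y"
    unfolding syntactic_hom_ext_eq[OF L x] syntactic_hom_ext_eq[OF L y]
      syntactic_hom_ext_eq[OF L free_profinite_mult_closed[OF x y]] syntactic_monoid_def
    by (rule free_profinite_mult_eval[OF L])
qed

text \<open>Homomorphisms preserve the J-relation, so the image of the class of \<open>F\<close>
  lies in one J-class, which the image of \<open>e\<close> identifies; this resolves the definite
  description.\<close>

lemma J_rel_eq:
  assumes F: "recurrent F" and X: "syntactic_congruence (star_lang X) \<in> word_congruences"
    and e: "e \<in> J_class_of F \<inter> idempotents free_profinite"
  shows "J_rel F X = green_J (syntactic_monoid (star_lang X)) `` {syntactic_hom_ext (star_lang X) e}"
proof -
  let ?P = "free_profinite :: 'a profinite_word monoid"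
  let ?M = "syntactic_monoid (star_lang X)" and ?f = "syntactic_hom_ext (star_lang X)"
  interpret P: monoid ?P by (rule monoid_free_profinite)
  interpret M: monoid ?M by (rule monoid_syntactic_monoid[OF X])
  note hom = syntactic_hom_ext_hom[OF X]
  have fe: "?f e \<in> idempotents ?M" using hom_idempotents[OF hom] e by blast
  have "J_class_of F \<in> carrier ?P // green_J ?P"
    using is_J_class_of_J_class_of[OF F] by (simp add: is_J_class_of_def regular_J_class_def)
  then have "(e, j) \<in> green_J ?P" if "j \<in> J_class_of F" for j
    using quotient_eq_iff[OF P.equiv_green_J] e that by (metis IntD1)
  then have sub: "?f ` J_class_of F \<subseteq> green_J ?M `` {?f e}"
    using hom_green_J[OF P.monoid_axioms M.monoid_axioms hom] by blast
  show ?thesis unfolding J_rel_def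
  proof (rule the_equality)
    show "regular_J_class ?M (green_J ?M `` {?f e}) \<and> ?f ` J_class_of F \<subseteq> green_J ?M `` {?f e}"
      unfolding regular_J_class_iff[OF M.monoid_axioms] using sub fe by blast
    fix J assume J: "regular_J_class ?M J \<and> ?f ` J_class_of F \<subseteq> J"
    from conjunct1[OF this] obtain g where g: "J = green_J ?M `` {g}"
      unfolding regular_J_class_iff[OF M.monoid_axioms] by blast
    have "?f e \<in> J" using J e by blast
    then have "(g, ?f e) \<in> green_J ?M" using g by simp
    then show "J = green_J ?M `` {?f e}"
      unfolding g by (rule equiv_class_eq[OF M.equiv_green_J])
  qed
qed

lemma recurrent_unbounded:
  assumes F: "recurrent F"
  shows "\<exists>w\<in>F. n \<le> length w"
proof (induction n)
  case 0
  then show ?case using F by (auto simp: recurrent_def)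
next
  case (Suc n)
  then obtain w where w: "w \<in> F" "n \<le> length w" by blast
  have "F \<noteq> {}" "F \<noteq> {[]}" using F by (simp_all add: recurrent_def)
  then obtain u where u: "u \<in> F" "u \<noteq> []" by blast
  obtain v where "u @ v @ w \<in> F" using F u(1) w(1) unfolding recurrent_def by blast
  moreover have "Suc n \<le> length (u @ v @ w)" using u(2) w(2) by (cases u) auto
  ultimately show ?case by blast
qed

text \<open>Every word of \<open>F\<close> is a factor of \<open>e\<close>, and \<open>F\<close> has
  arbitrarily long words; modulo the length congruence \<open>e\<close> can therefore not be
  represented by a word shorter than \<open>n\<close>.\<close>

lemma J_class_of_word_length:
  fixes F :: "'a::finite list set"
  assumes F: "recurrent F" and e: "e \<in> J_class_of F"
    and r: "r \<in> word_congruences" "r \<subseteq> {(u, v). u = v \<or> n \<le> length u \<and> n \<le> length v}" and u: "u \<in> e r"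
  shows "n \<le> length u"
proof -
  let ?l = "{(u, v :: 'a list). u = v \<or> n \<le> length u \<and> n \<le> length v}"
  have l: "?l \<in> word_congruences" by (rule length_congruence)
  obtain w where w: "w \<in> F" "n \<le> length w" using recurrent_unbounded[OF F] by blast
  have wc: "profinite_embedding word_monoid w \<in> profinite_closure F"
    unfolding profinite_closure_iff using profinite_embedding_carrier profinite_embedding_mem w(1) by blast
  obtain p q where pq: "p \<in> carrier free_profinite" "q \<in> carrier free_profinite"
    "e = p \<otimes>\<^bsub>free_profinite\<^esub> profinite_embedding word_monoid w \<otimes>\<^bsub>free_profinite\<^esub> q"
    using is_J_class_of_factor[OF is_J_class_of_J_class_of[OF F] e wc] by blast
  obtain a b where ab: "a \<in> p ?l" "b \<in> q ?l"
    using free_profinite_ex_word[OF pq(1) l] free_profinite_ex_word[OF pq(2) l] by blast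
  have ec: "e \<in> carrier free_profinite"
    unfolding pq(3) by (intro free_profinite_mult_closed pq profinite_embedding_carrier)
  have "(a @ w) @ b \<in> e ?l"
    unfolding pq(3) by (intro free_profinite_mult_memI free_profinite_mult_closed pq
      profinite_embedding_carrier profinite_embedding_mem l ab)
  moreover have "u \<in> e ?l" using free_profinite_mono[OF ec r(1) l r(2)] u by blast
  ultimately have "((a @ w) @ b, u) \<in> ?l" using free_profinite_class[OF ec l] by blast
  then show ?thesis using w(2) by auto
qed

section \<open>Charged and weakly charged codes\<close>

lemma syntactic_congruenceI:
  assumes "\<And>x y. x @ u @ y \<in> L \<Longrightarrow> x @ v @ y \<in> L" "\<And>x y. x @ v @ y \<in> L \<Longrightarrow> x @ u @ y \<in> L"
  shows "(u, v) \<in> syntactic_congruence L"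
  unfolding syntactic_congruence_def using assms by blast

locale recurrent_bifix_code =
  fixes F Z X :: "'a::finite list set"
  assumes F: "uniformly_recurrent F" and Z: "bifix_code Z" and rat: "rational_lang Z"
    and deg: "degree Z \<noteq> \<infinity>"
    and nil: "nil_simple ((syntactic_monoid (star_lang Z))
           \<lparr>carrier := syntactic_hom (star_lang Z) ` nonempty_words\<rparr>)"
    and X: "X = Z \<inter> F"
begin

abbreviation (input) P :: "'a profinite_word monoid" where "P \<equiv> free_profinite"
abbreviation (input) M\<^sub>Z where "M\<^sub>Z \<equiv> syntactic_monoid (star_lang Z)"
abbreviation (input) M\<^sub>X where "M\<^sub>X \<equiv> syntactic_monoid (star_lang X)"
abbreviation (input) \<phi>\<^sub>Z where "\<phi>\<^sub>Z \<equiv> syntactic_hom_ext (star_lang Z)"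
abbreviation (input) \<phi>\<^sub>X where "\<phi>\<^sub>X \<equiv> syntactic_hom_ext (star_lang X)"

lemma recurrent: "recurrent F"
  using F by (simp add: uniformly_recurrent_def)

lemma bounded: "\<exists>n. \<forall>z\<in>X. length z \<le> n"
  unfolding X by (rule finite_code_in_uniformly_recurrent[OF F Z deg])

lemma congruence_Z: "syntactic_congruence (star_lang Z) \<in> word_congruences"
  using rational_lang_saturated[OF rat] ex_congruence_saturating_star
    syntactic_congruence_in_word_congruences by metis

lemma congruence_X: "syntactic_congruence (star_lang X) \<in> word_congruences"
  using bounded bounded_lang_saturated ex_congruence_saturating_star
    syntactic_congruence_in_word_congruences by metis

text \<open>Nil-simplicity enters here: the images of nonempty words form an ideal of
  \<open>M\<^sub>Z\<close>, so its idempotents belong to the minimum ideal of the whole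
  monoid.\<close>

lemma idempotent_in_J_code:
  assumes "u \<noteq> []" "syntactic_hom (star_lang Z) u \<in> idempotents M\<^sub>Z"
  shows "syntactic_hom (star_lang Z) u \<in> J_code Z"
  unfolding J_code_def
proof (rule nil_simple_ideal_idempotent[OF monoid_syntactic_monoid[OF congruence_Z] _ _ nil assms(2)])
  show "syntactic_hom (star_lang Z) ` nonempty_words \<subseteq> carrier M\<^sub>Z"
    by (auto simp: syntactic_monoid_carrier)
  show "syntactic_hom (star_lang Z) u \<in> syntactic_hom (star_lang Z) ` nonempty_words"
    using assms(1) by (simp add: nonempty_words_def)
  fix m s assume "m \<in> carrier M\<^sub>Z" "s \<in> syntactic_hom (star_lang Z) ` nonempty_words"
  then obtain a b where ab: "m = syntactic_hom (star_lang Z) a" "s = syntactic_hom (star_lang Z) b" "b \<noteq> []"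
    by (auto simp: syntactic_monoid_carrier nonempty_words_def)
  show "m \<otimes>\<^bsub>M\<^sub>Z\<^esub> s \<in> syntactic_hom (star_lang Z) ` nonempty_words \<and>
    s \<otimes>\<^bsub>M\<^sub>Z\<^esub> m \<in> syntactic_hom (star_lang Z) ` nonempty_words"
    unfolding ab(1,2) syntactic_hom_mult[OF congruence_Z] using ab(3)
    by (auto simp: nonempty_words_def)
qed

context
  fixes e
  assumes e: "e \<in> J_class_of F \<inter> idempotents P"
begin

abbreviation (input) H where "H \<equiv> green_H P `` {e}"
abbreviation (input) H\<^sub>Z where "H\<^sub>Z \<equiv> green_H M\<^sub>Z `` {\<phi>\<^sub>Z e}"
abbreviation (input) H\<^sub>X where "H\<^sub>X \<equiv> green_H M\<^sub>X `` {\<phi>\<^sub>X e}"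

text \<open>One word \<open>u\<close> of \<open>F\<close>, close to \<open>e\<close> for both
  languages and for length, serves all of \<open>H\<close>: because \<open>h = e h e\<close>, every
  \<open>h\<close> is represented by some \<open>u v u\<close>, with the same \<open>v\<close> for
  both codes.\<close>

lemma ex_representing_word:
  obtains u t0 where "\<forall>z\<in>X. length z \<le> length u" "u \<noteq> []" "u @ t0 \<in> star_lang X"
    "\<phi>\<^sub>Z e = syntactic_hom (star_lang Z) u" "\<phi>\<^sub>X e = syntactic_hom (star_lang X) u"
    "\<And>h. h \<in> H \<Longrightarrow> \<exists>v. \<phi>\<^sub>Z h = syntactic_hom (star_lang Z) (u @ v @ u) \<and>
      \<phi>\<^sub>X h = syntactic_hom (star_lang X) (u @ v @ u)"
proof -
  have ei: "e \<in> idempotents P" and eJ: "e \<in> J_class_of F" using e by blast+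
  obtain n where n: "\<forall>z\<in>X. length z \<le> n" using bounded by blast
  \<comment> \<open>With \<open>Suc n\<close> the word \<open>u\<close> is also nonempty when
    \<open>n = 0\<close>; nil-simplicity speaks of nonempty words.\<close>
  define l where "l = {(u, v :: 'a list). u = v \<or> Suc n \<le> length u \<and> Suc n \<le> length v}"
  define r where "r = syntactic_congruence (star_lang Z) \<inter> syntactic_congruence (star_lang X) \<inter> l"
  have r: "r \<in> word_congruences"
    unfolding r_def l_def by (intro word_congruence_Int congruence_Z congruence_X length_congruence)
  have rZ: "r \<subseteq> syntactic_congruence (star_lang Z)" and rX: "r \<subseteq> syntactic_congruence (star_lang X)"
    and rl: "r \<subseteq> l" by (auto simp: r_def)
  note wZ = syntactic_hom_ext_word[OF congruence_Z r rZ] and wX = syntactic_hom_ext_word[OF congruence_X r rX]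
  have "e \<in> profinite_closure F"
    using is_J_class_of_J_class_of[OF recurrent] eJ unfolding is_J_class_of_def by blast
  then obtain u where ec: "e \<in> carrier P" and u: "u \<in> F" "u \<in> e r"
    using r by (auto simp: profinite_closure_iff)
  have len: "Suc n \<le> length u"
    by (rule J_class_of_word_length[OF recurrent eJ r rl[unfolded l_def] u(2)])
  obtain t0 where t0: "u @ t0 \<in> star_lang X"
    using ex_completion_in_star[OF recurrent Z deg u(1)] unfolding X by blast
  have "\<exists>v. \<phi>\<^sub>Z h = syntactic_hom (star_lang Z) (u @ v @ u) \<and>
      \<phi>\<^sub>X h = syntactic_hom (star_lang X) (u @ v @ u)" if h: "h \<in> H" for h
  proof -
    have hc: "h \<in> carrier P" "e \<otimes>\<^bsub>P\<^esub> h = h" "h \<otimes>\<^bsub>P\<^esub> e = h"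
      using h monoid.green_H_idempotent_iff[OF monoid_free_profinite ei] by blast+
    obtain v where v: "v \<in> h r" using free_profinite_ex_word[OF hc(1) r] by blast
    have "v @ u \<in> h r" using free_profinite_mult_memI[OF hc(1) ec r v u(2)] hc(3) by simp
    then have "u @ v @ u \<in> h r" using free_profinite_mult_memI[OF ec hc(1) r u(2)] hc(2) by fastforce
    then show ?thesis using wZ[OF hc(1)] wX[OF hc(1)] by blast
  qed
  then show ?thesis
    using that[of u t0] n len t0 wZ[OF ec u(2)] wX[OF ec u(2)] by fastforce
qed

lemma \<phi>\<^sub>X_idempotent: "\<phi>\<^sub>X e \<in> idempotents M\<^sub>X"
  using hom_idempotents[OF syntactic_hom_ext_hom[OF congruence_X]] e by blast

lemma \<phi>\<^sub>Z_idempotent: "\<phi>\<^sub>Z e \<in> J_code Z \<inter> idempotents M\<^sub>Z"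
proof -
  have i: "\<phi>\<^sub>Z e \<in> idempotents M\<^sub>Z"
    using hom_idempotents[OF syntactic_hom_ext_hom[OF congruence_Z]] e by blast
  obtain u where "u \<noteq> []" "\<phi>\<^sub>Z e = syntactic_hom (star_lang Z) u"
    by (rule ex_representing_word) blast
  then show ?thesis using idempotent_in_J_code i by auto
qed

lemma \<phi>\<^sub>X_maps_H: "h \<in> H \<Longrightarrow> \<phi>\<^sub>X h \<in> H\<^sub>X"
  using hom_green_H[OF monoid_free_profinite monoid_syntactic_monoid[OF congruence_X]
      syntactic_hom_ext_hom[OF congruence_X]] e by blast

lemma \<phi>\<^sub>Z_maps_H: "h \<in> H \<Longrightarrow> \<phi>\<^sub>Z h \<in> H\<^sub>Z"
  using hom_green_H[OF monoid_free_profinite monoid_syntactic_monoid[OF congruence_Z]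
      syntactic_hom_ext_hom[OF congruence_Z]] e by blast

text \<open>The image of \<open>w\<close> is invertible in the group \<open>H\<^sub>X\<close>; a
  word for its inverse is the completion \<open>b\<close> that the transfer lemmas ask for.\<close>

lemma ex_right_completion:
  assumes "syntactic_hom (star_lang X) w \<in> H\<^sub>X" "\<phi>\<^sub>X e = syntactic_hom (star_lang X) u"
  shows "\<exists>b. (w @ b, u) \<in> syntactic_congruence (star_lang X)"
proof -
  obtain z where "z \<in> carrier M\<^sub>X" "syntactic_hom (star_lang X) w \<otimes>\<^bsub>M\<^sub>X\<^esub> z = \<phi>\<^sub>X e"
    using assms(1)
      monoid.green_H_idempotent_iff[OF monoid_syntactic_monoid[OF congruence_X] \<phi>\<^sub>X_idempotent] by blast
  then obtain b where "syntactic_hom (star_lang X) w \<otimes>\<^bsub>M\<^sub>X\<^esub> syntactic_hom (star_lang X) b = \<phi>\<^sub>X e"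
    by (auto simp: syntactic_monoid_carrier)
  then show ?thesis
    unfolding assms(2) syntactic_hom_mult[OF congruence_X] syntactic_hom_eq_iff[OF congruence_X] by blast
qed

text \<open>Words are used instead of elements of \<open>H\<close> because, when
  \<open>\<phi>\<^sub>X\<close> is shown to be onto, \<open>v\<close> represents an element of
  \<open>H\<^sub>X\<close> not yet known to come from \<open>H\<close>.\<close>

lemma word_\<phi>\<^sub>X_determined:
  assumes len: "\<forall>z\<in>X. length z \<le> length u" and u: "\<phi>\<^sub>X e = syntactic_hom (star_lang X) u"
    and v: "syntactic_hom (star_lang X) (u @ v @ u) \<in> H\<^sub>X"
    and v': "syntactic_hom (star_lang X) (u @ v' @ u) \<in> H\<^sub>X"
    and eq: "syntactic_hom (star_lang Z) (u @ v @ u) = syntactic_hom (star_lang Z) (u @ v' @ u)"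
  shows "syntactic_hom (star_lang X) (u @ v @ u) = syntactic_hom (star_lang X) (u @ v' @ u)"
proof -
  have XZ: "X \<subseteq> Z" using X by blast
  have SZ: "(u @ v @ u, u @ v' @ u) \<in> syntactic_congruence (star_lang Z)"
    and SZ': "(u @ v' @ u, u @ v @ u) \<in> syntactic_congruence (star_lang Z)"
    using eq eq[symmetric] unfolding syntactic_hom_eq_iff[OF congruence_Z] by blast+
  obtain b b' where b: "(u @ v @ u @ b, u) \<in> syntactic_congruence (star_lang X)"
    and b': "(u @ v' @ u @ b', u) \<in> syntactic_congruence (star_lang X)"
    using ex_right_completion[OF v u] ex_right_completion[OF v' u] by auto
  have "(u @ v @ u, u @ v' @ u) \<in> syntactic_congruence (star_lang X)"
  proof (rule syntactic_congruenceI)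
    fix x y
    show "x @ (u @ v' @ u) @ y \<in> star_lang X" if "x @ (u @ v @ u) @ y \<in> star_lang X"
      using syntactic_transfer_to_subcode[OF Z XZ len SZ b', of x y] that by simp
    show "x @ (u @ v @ u) @ y \<in> star_lang X" if "x @ (u @ v' @ u) @ y \<in> star_lang X"
      using syntactic_transfer_to_subcode[OF Z XZ len SZ' b, of x y] that by simp
  qed
  then show ?thesis unfolding syntactic_hom_eq_iff[OF congruence_X] .
qed

lemma \<phi>\<^sub>X_determined:
  assumes "h \<in> H" "h' \<in> H" "\<phi>\<^sub>Z h = \<phi>\<^sub>Z h'"
  shows "\<phi>\<^sub>X h = \<phi>\<^sub>X h'"
proof -
  obtain u where u: "\<forall>z\<in>X. length z \<le> length u" "\<phi>\<^sub>X e = syntactic_hom (star_lang X) u"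
    and rep: "\<And>h. h \<in> H \<Longrightarrow> \<exists>v. \<phi>\<^sub>Z h = syntactic_hom (star_lang Z) (u @ v @ u) \<and>
      \<phi>\<^sub>X h = syntactic_hom (star_lang X) (u @ v @ u)"
    by (rule ex_representing_word) blast
  obtain v where v: "\<phi>\<^sub>Z h = syntactic_hom (star_lang Z) (u @ v @ u)"
    "\<phi>\<^sub>X h = syntactic_hom (star_lang X) (u @ v @ u)" using rep[OF assms(1)] by blast
  obtain v' where v': "\<phi>\<^sub>Z h' = syntactic_hom (star_lang Z) (u @ v' @ u)"
    "\<phi>\<^sub>X h' = syntactic_hom (star_lang X) (u @ v' @ u)" using rep[OF assms(2)] by blast
  show ?thesis
    using word_\<phi>\<^sub>X_determined[OF u, of v v'] \<phi>\<^sub>X_maps_H[OF assms(1)] \<phi>\<^sub>X_maps_H[OF assms(2)] assms(3)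
    unfolding v v' by blast
qed

text \<open>A representative \<open>u v u\<close> of \<open>g\<close> acts on
  \<open>star_lang Z\<close> as an element of \<open>H\<^sub>Z\<close>, hence by assumption like
  some \<open>h\<close> in \<open>H\<close>; equality of the actions on \<open>star_lang Z\<close>
  then forces \<open>g = \<phi>\<^sub>X h\<close>.\<close>

lemma \<phi>\<^sub>X_onto:
  assumes onto: "\<phi>\<^sub>Z ` H = H\<^sub>Z"
  shows "\<phi>\<^sub>X ` H = H\<^sub>X"
proof (intro equalityI subsetI)
  show "g \<in> H\<^sub>X" if "g \<in> \<phi>\<^sub>X ` H" for g using that \<phi>\<^sub>X_maps_H by blast
next
  fix g assume g: "g \<in> H\<^sub>X"
  obtain u where u: "\<forall>z\<in>X. length z \<le> length u" "\<phi>\<^sub>X e = syntactic_hom (star_lang X) u"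
    "\<phi>\<^sub>Z e = syntactic_hom (star_lang Z) u"
    and rep: "\<And>h. h \<in> H \<Longrightarrow> \<exists>v. \<phi>\<^sub>Z h = syntactic_hom (star_lang Z) (u @ v @ u) \<and>
      \<phi>\<^sub>X h = syntactic_hom (star_lang X) (u @ v @ u)"
    by (rule ex_representing_word) blast
  have gc: "g \<in> carrier M\<^sub>X" "\<phi>\<^sub>X e \<otimes>\<^bsub>M\<^sub>X\<^esub> g = g" "g \<otimes>\<^bsub>M\<^sub>X\<^esub> \<phi>\<^sub>X e = g"
    using g monoid.green_H_idempotent_iff[OF monoid_syntactic_monoid[OF congruence_X] \<phi>\<^sub>X_idempotent]
    by blast+
  obtain v where v: "g = syntactic_hom (star_lang X) v"
    using gc(1) unfolding syntactic_monoid_carrier by blast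
  have "g = \<phi>\<^sub>X e \<otimes>\<^bsub>M\<^sub>X\<^esub> (g \<otimes>\<^bsub>M\<^sub>X\<^esub> \<phi>\<^sub>X e)" using gc by simp
  then have guvu: "g = syntactic_hom (star_lang X) (u @ v @ u)"
    unfolding u(2) v syntactic_hom_mult[OF congruence_X] .
  have "\<phi>\<^sub>Z e \<otimes>\<^bsub>M\<^sub>Z\<^esub> syntactic_hom (star_lang Z) v \<otimes>\<^bsub>M\<^sub>Z\<^esub> \<phi>\<^sub>Z e \<in> H\<^sub>Z"
    by (rule monoid.min_ideal_local_group[OF monoid_syntactic_monoid[OF congruence_Z]
          finite_syntactic_monoid[OF congruence_Z]])
      (use \<phi>\<^sub>Z_idempotent in \<open>auto simp: J_code_def syntactic_monoid_carrier\<close>)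
  then have "syntactic_hom (star_lang Z) (u @ v @ u) \<in> H\<^sub>Z"
    unfolding u(3) syntactic_hom_mult[OF congruence_Z] by simp
  then have "syntactic_hom (star_lang Z) (u @ v @ u) \<in> \<phi>\<^sub>Z ` H"
    by (simp only: onto)
  then obtain h where h: "syntactic_hom (star_lang Z) (u @ v @ u) = \<phi>\<^sub>Z h" "h \<in> H"
    by (rule imageE)
  obtain v' where v': "\<phi>\<^sub>Z h = syntactic_hom (star_lang Z) (u @ v' @ u)"
    "\<phi>\<^sub>X h = syntactic_hom (star_lang X) (u @ v' @ u)" using rep[OF h(2)] by blast
  have "g = \<phi>\<^sub>X h"
    unfolding guvu v'(2)
  proof (rule word_\<phi>\<^sub>X_determined[OF u(1,2)])
    show "syntactic_hom (star_lang X) (u @ v @ u) \<in> H\<^sub>X" using g guvu by simp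
    show "syntactic_hom (star_lang X) (u @ v' @ u) \<in> H\<^sub>X" using \<phi>\<^sub>X_maps_H[OF h(2)] v'(2) by simp
    show "syntactic_hom (star_lang Z) (u @ v @ u) = syntactic_hom (star_lang Z) (u @ v' @ u)"
      using h(1) v'(1) by simp
  qed
  then show "g \<in> \<phi>\<^sub>X ` H" using h(2) by blast
qed

lemma \<phi>\<^sub>Z_determined:
  assumes onto: "\<phi>\<^sub>Z ` H = H\<^sub>Z" and h: "h \<in> H" and h': "h' \<in> H" and eq: "\<phi>\<^sub>X h = \<phi>\<^sub>X h'"
  shows "\<phi>\<^sub>Z h = \<phi>\<^sub>Z h'"
proof -
  have XZ: "X \<subseteq> Z" using X by blast
  obtain u t0 where u: "\<forall>z\<in>X. length z \<le> length u" "u @ t0 \<in> star_lang X"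
    "\<phi>\<^sub>Z e = syntactic_hom (star_lang Z) u" "\<phi>\<^sub>X e = syntactic_hom (star_lang X) u"
    and rep: "\<And>h. h \<in> H \<Longrightarrow> \<exists>v. \<phi>\<^sub>Z h = syntactic_hom (star_lang Z) (u @ v @ u) \<and>
      \<phi>\<^sub>X h = syntactic_hom (star_lang X) (u @ v @ u)"
    by (rule ex_representing_word) blast
  \<comment> \<open>The word \<open>u m u\<close> acts on \<open>star_lang Z\<close> like some
    \<open>g\<close> in \<open>H\<close>. A representative \<open>u v u\<close> of \<open>g\<close>
    has its image for \<open>X\<close> in \<open>H\<^sub>X\<close>, so it can be completed there;
    this gives \<open>w = u v\<close>.\<close>
  have trans: "\<exists>w b. (u @ m @ u, w @ u) \<in> syntactic_congruence (star_lang Z) \<and>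
      (w @ u @ b, u) \<in> syntactic_congruence (star_lang X)" for m
  proof -
    have "\<phi>\<^sub>Z e \<otimes>\<^bsub>M\<^sub>Z\<^esub> syntactic_hom (star_lang Z) m \<otimes>\<^bsub>M\<^sub>Z\<^esub> \<phi>\<^sub>Z e \<in> H\<^sub>Z"
      by (rule monoid.min_ideal_local_group[OF monoid_syntactic_monoid[OF congruence_Z]
            finite_syntactic_monoid[OF congruence_Z]])
        (use \<phi>\<^sub>Z_idempotent in \<open>auto simp: J_code_def syntactic_monoid_carrier\<close>)
    then have "syntactic_hom (star_lang Z) (u @ m @ u) \<in> H\<^sub>Z"
      unfolding u(3) syntactic_hom_mult[OF congruence_Z] by simp
    then have "syntactic_hom (star_lang Z) (u @ m @ u) \<in> \<phi>\<^sub>Z ` H"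
      by (simp only: onto)
    then obtain g where g: "syntactic_hom (star_lang Z) (u @ m @ u) = \<phi>\<^sub>Z g" "g \<in> H"
      by (rule imageE)
    obtain v where v: "\<phi>\<^sub>Z g = syntactic_hom (star_lang Z) (u @ v @ u)"
      "\<phi>\<^sub>X g = syntactic_hom (star_lang X) (u @ v @ u)" using rep[OF g(2)] by blast
    obtain b where "((u @ v @ u) @ b, u) \<in> syntactic_congruence (star_lang X)"
      using ex_right_completion[OF _ u(4), of "u @ v @ u"] \<phi>\<^sub>X_maps_H[OF g(2)] v(2) by auto
    moreover have "(u @ m @ u, u @ v @ u) \<in> syntactic_congruence (star_lang Z)"
      using g(1) v(1) by (simp add: syntactic_hom_eq_iff[OF congruence_Z, symmetric])
    ultimately show ?thesis by (intro exI[of _ "u @ v"] exI[of _ b]) simp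
  qed
  obtain v where v: "\<phi>\<^sub>Z h = syntactic_hom (star_lang Z) (u @ v @ u)"
    "\<phi>\<^sub>X h = syntactic_hom (star_lang X) (u @ v @ u)" using rep[OF h] by blast
  obtain v' where v': "\<phi>\<^sub>Z h' = syntactic_hom (star_lang Z) (u @ v' @ u)"
    "\<phi>\<^sub>X h' = syntactic_hom (star_lang X) (u @ v' @ u)" using rep[OF h'] by blast
  have SX: "(u @ v @ u, u @ v' @ u) \<in> syntactic_congruence (star_lang X)"
    and SX': "(u @ v' @ u, u @ v @ u) \<in> syntactic_congruence (star_lang X)"
    using eq v(2) v'(2) by (simp_all add: syntactic_hom_eq_iff[OF congruence_X, symmetric])
  obtain b b' where b: "(u @ v @ u @ b, u) \<in> syntactic_congruence (star_lang X)"
    and b': "(u @ v' @ u @ b', u) \<in> syntactic_congruence (star_lang X)"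
    using ex_right_completion[OF _ u(4), of "u @ v @ u"] ex_right_completion[OF _ u(4), of "u @ v' @ u"]
      \<phi>\<^sub>X_maps_H[OF h] \<phi>\<^sub>X_maps_H[OF h'] v(2) v'(2) by auto
  have "(u @ v @ u, u @ v' @ u) \<in> syntactic_congruence (star_lang Z)"
  proof (rule syntactic_congruenceI)
    fix x y
    show "x @ (u @ v' @ u) @ y \<in> star_lang Z" if "x @ (u @ v @ u) @ y \<in> star_lang Z"
      using syntactic_transfer_from_subcode[OF Z XZ u(1,2) trans SX b, of x y] that by simp
    show "x @ (u @ v @ u) @ y \<in> star_lang Z" if "x @ (u @ v' @ u) @ y \<in> star_lang Z"
      using syntactic_transfer_from_subcode[OF Z XZ u(1,2) trans SX' b', of x y] that by simp
  qed
  then show ?thesis unfolding v(1) v'(1) syntactic_hom_eq_iff[OF congruence_Z] .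
qed

lemma groups_iso:
  assumes onto: "\<phi>\<^sub>Z ` H = H\<^sub>Z"
  shows "group_at M\<^sub>X (\<phi>\<^sub>X e) \<cong> group_at M\<^sub>Z (\<phi>\<^sub>Z e)"
proof (rule group_at_iso_of_common_image[where A = H and mA = "mult P"])
  have Hc: "h \<in> carrier P" if "h \<in> H" for h
    using that monoid.green_H_idempotent_iff[OF monoid_free_profinite] e by blast
  fix x y assume xy: "x \<in> H" "y \<in> H"
  show "\<phi>\<^sub>X (x \<otimes>\<^bsub>P\<^esub> y) = \<phi>\<^sub>X x \<otimes>\<^bsub>M\<^sub>X\<^esub> \<phi>\<^sub>X y"
    by (rule hom_mult[OF syntactic_hom_ext_hom[OF congruence_X] Hc[OF xy(1)] Hc[OF xy(2)]])
  show "\<phi>\<^sub>Z (x \<otimes>\<^bsub>P\<^esub> y) = \<phi>\<^sub>Z x \<otimes>\<^bsub>M\<^sub>Z\<^esub> \<phi>\<^sub>Z y"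
    by (rule hom_mult[OF syntactic_hom_ext_hom[OF congruence_Z] Hc[OF xy(1)] Hc[OF xy(2)]])
  show "x \<otimes>\<^bsub>P\<^esub> y \<in> H"
    using monoid.green_H_mult[OF monoid_free_profinite _ xy] e by blast
  show "\<phi>\<^sub>X x = \<phi>\<^sub>X y \<longleftrightarrow> \<phi>\<^sub>Z x = \<phi>\<^sub>Z y"
    using \<phi>\<^sub>X_determined[OF xy] \<phi>\<^sub>Z_determined[OF onto xy] by blast
qed (use onto \<phi>\<^sub>X_onto[OF onto] in blast)+

lemma \<phi>\<^sub>Z_onto:
  assumes onto: "\<phi>\<^sub>X ` H = H\<^sub>X" and card: "card H\<^sub>X = card H\<^sub>Z"
  shows "\<phi>\<^sub>Z ` H = H\<^sub>Z"
proof (rule image_full_of_card_eq[OF _ _ onto card])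
  have "H\<^sub>Z \<subseteq> carrier M\<^sub>Z"
    using monoid.green_H_idempotent_iff[OF monoid_syntactic_monoid[OF congruence_Z]] \<phi>\<^sub>Z_idempotent by blast
  then show "finite H\<^sub>Z" using finite_syntactic_monoid[OF congruence_Z] finite_subset by blast
  show "\<phi>\<^sub>Z ` H \<subseteq> H\<^sub>Z" using \<phi>\<^sub>Z_maps_H by blast
qed (rule \<phi>\<^sub>X_determined)

text \<open>The idempotent chosen in \<open>G_rel\<close> is J-equivalent to
  \<open>\<phi>\<^sub>X e\<close>, and maximal subgroups in one J-class of a finite monoid are
  isomorphic.\<close>

lemma G_rel_iso: "G_rel F X \<cong> group_at M\<^sub>X (\<phi>\<^sub>X e)" "order (G_rel F X) = card H\<^sub>X"
  and mem_J_rel: "\<phi>\<^sub>X e \<in> J_rel F X"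
proof -
  interpret M: monoid M\<^sub>X by (rule monoid_syntactic_monoid[OF congruence_X])
  note J = J_rel_eq[OF recurrent congruence_X e]
  have "\<phi>\<^sub>X e \<in> carrier M\<^sub>X" using \<phi>\<^sub>X_idempotent by (simp add: idempotents_def)
  then show mem: "\<phi>\<^sub>X e \<in> J_rel F X" unfolding J using equiv_class_self[OF M.equiv_green_J] by blast
  obtain f where f: "f \<in> J_rel F X \<inter> idempotents M\<^sub>X" "G_rel F X = group_at M\<^sub>X f"
    unfolding G_rel_def
    by (rule schuetzenberger_group_eq_group_at[of "J_rel F X" M\<^sub>X]) (use mem \<phi>\<^sub>X_idempotent in blast)
  have "(f, \<phi>\<^sub>X e) \<in> green_J M\<^sub>X"
    using f(1) M.equiv_green_J unfolding J by (meson Image_singleton_iff IntD1 equivE symE)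
  then show iso: "G_rel F X \<cong> group_at M\<^sub>X (\<phi>\<^sub>X e)"
    unfolding f(2) using M.group_at_iso finite_syntactic_monoid[OF congruence_X] f(1) \<phi>\<^sub>X_idempotent by blast
  show "order (G_rel F X) = card H\<^sub>X"
    using iso_same_card[OF iso] by (simp add: order_def group_at_def)
qed

lemma G_code_iso: "group_at M\<^sub>Z (\<phi>\<^sub>Z e) \<cong> G_code Z" "order (G_code Z) = card H\<^sub>Z"
proof -
  interpret M: monoid M\<^sub>Z by (rule monoid_syntactic_monoid[OF congruence_Z])
  obtain f where f: "f \<in> J_code Z \<inter> idempotents M\<^sub>Z" "G_code Z = group_at M\<^sub>Z f"
    unfolding G_code_def
    by (rule schuetzenberger_group_eq_group_at[of "J_code Z" M\<^sub>Z]) (use \<phi>\<^sub>Z_idempotent in blast)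
  have "(\<phi>\<^sub>Z e, f) \<in> green_J M\<^sub>Z"
    using M.min_ideal_green_J f(1) \<phi>\<^sub>Z_idempotent unfolding J_code_def by blast
  then show iso: "group_at M\<^sub>Z (\<phi>\<^sub>Z e) \<cong> G_code Z"
    unfolding f(2) using M.group_at_iso finite_syntactic_monoid[OF congruence_Z] f(1) \<phi>\<^sub>Z_idempotent by blast
  show "order (G_code Z) = card H\<^sub>Z"
    using iso_same_card[OF iso] by (simp add: order_def group_at_def)
qed

lemma maximal_subgroup_Z_iff: "\<phi>\<^sub>Z ` H \<in> maximal_subgroups M\<^sub>Z (J_code Z) \<longleftrightarrow> \<phi>\<^sub>Z ` H = H\<^sub>Z"
proof (rule maximal_subgroup_iff[OF monoid_syntactic_monoid[OF congruence_Z] \<phi>\<^sub>Z_idempotent])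
  show "\<phi>\<^sub>Z e \<in> \<phi>\<^sub>Z ` H"
    using monoid.idempotent_in_green_H[OF monoid_free_profinite] e by blast
qed

lemma maximal_subgroup_X_iff: "\<phi>\<^sub>X ` H \<in> maximal_subgroups M\<^sub>X (J_rel F X) \<longleftrightarrow> \<phi>\<^sub>X ` H = H\<^sub>X"
proof (rule maximal_subgroup_iff[OF monoid_syntactic_monoid[OF congruence_X]])
  show "\<phi>\<^sub>X e \<in> J_rel F X \<inter> idempotents M\<^sub>X" using mem_J_rel \<phi>\<^sub>X_idempotent by blast
  show "\<phi>\<^sub>X e \<in> \<phi>\<^sub>X ` H"
    using monoid.idempotent_in_green_H[OF monoid_free_profinite] e by blast
qed

end

section \<open>The equivalence of the three conditions\<close>

lemma ex_idempotent: "\<exists>e. e \<in> J_class_of F \<inter> idempotents P"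
  using is_J_class_of_J_class_of[OF recurrent] unfolding is_J_class_of_def regular_J_class_def by blast

text \<open>Maximal subgroups of the class of \<open>F\<close> are given by its idempotents, and the
  image of the one at \<open>e\<close> contains \<open>\<phi>\<^sub>Z e\<close>, which leaves a
  single candidate for the maximal subgroup it can be.\<close>

lemma charged_iff:
  "charged F Z \<longleftrightarrow> (\<forall>e \<in> J_class_of F \<inter> idempotents P.
    \<phi>\<^sub>Z ` (green_H P `` {e}) = green_H M\<^sub>Z `` {\<phi>\<^sub>Z e})"
proof -
  have "charged F Z \<longleftrightarrow> (\<forall>e \<in> J_class_of F \<inter> idempotents P.
      \<phi>\<^sub>Z ` (green_H P `` {e}) \<in> maximal_subgroups M\<^sub>Z (J_code Z))"
    unfolding charged_def maximal_subgroups_def[of P] by blast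
  then show ?thesis using maximal_subgroup_Z_iff by simp
qed

lemma weakly_charged_iff:
  "weakly_charged F X \<longleftrightarrow> (\<forall>e \<in> J_class_of F \<inter> idempotents P.
    \<phi>\<^sub>X ` (green_H P `` {e}) = green_H M\<^sub>X `` {\<phi>\<^sub>X e})"
proof -
  have "weakly_charged F X \<longleftrightarrow> (\<forall>e \<in> J_class_of F \<inter> idempotents P.
      \<phi>\<^sub>X ` (green_H P `` {e}) \<in> maximal_subgroups M\<^sub>X (J_rel F X))"
    unfolding weakly_charged_def maximal_subgroups_def[of P] by blast
  then show ?thesis using maximal_subgroup_X_iff by simp
qed

text \<open>The isomorphism is read off at one idempotent, while weak charging is checked at each of
  them.\<close>

lemma charged_imp_weakly_charged:
  assumes "charged F Z"
  shows "G_rel F X \<cong> G_code Z" "weakly_charged F X"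
proof -
  obtain e where e: "e \<in> J_class_of F \<inter> idempotents P" using ex_idempotent by blast
  have "\<phi>\<^sub>Z ` (green_H P `` {e}) = green_H M\<^sub>Z `` {\<phi>\<^sub>Z e}" using assms e charged_iff by blast
  then show "G_rel F X \<cong> G_code Z"
    by (rule iso_trans[OF G_rel_iso(1)[OF e] iso_trans[OF groups_iso[OF e] G_code_iso(1)[OF e]]])
  show "weakly_charged F X"
    unfolding weakly_charged_iff
  proof
    fix e assume e: "e \<in> J_class_of F \<inter> idempotents P"
    from bspec[OF assms[unfolded charged_iff] e]
    show "\<phi>\<^sub>X ` (green_H P `` {e}) = green_H M\<^sub>X `` {\<phi>\<^sub>X e}" by (rule \<phi>\<^sub>X_onto[OF e])
  qed
qed

lemma weakly_charged_imp_charged: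
  assumes "order (G_rel F X) = order (G_code Z)" "weakly_charged F X"
  shows "charged F Z"
  unfolding charged_iff
proof
  fix e assume e: "e \<in> J_class_of F \<inter> idempotents P"
  show "\<phi>\<^sub>Z ` (green_H P `` {e}) = green_H M\<^sub>Z `` {\<phi>\<^sub>Z e}"
  proof (rule \<phi>\<^sub>Z_onto[OF e])
    show "\<phi>\<^sub>X ` (green_H P `` {e}) = green_H M\<^sub>X `` {\<phi>\<^sub>X e}" using assms(2) e weakly_charged_iff by blast
    show "card (green_H M\<^sub>X `` {\<phi>\<^sub>X e}) = card (green_H M\<^sub>Z `` {\<phi>\<^sub>Z e})"
      using assms(1) G_rel_iso(2)[OF e] G_code_iso(2)[OF e] by simp
  qed
qed

end

theorem theorem4p13:
  fixes F Z X :: "'a::finite list set"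
  assumes "uniformly_recurrent F"
    and "bifix_code Z" and "rational_lang Z" and "degree Z \<noteq> \<infinity>"
    and "nil_simple ((syntactic_monoid (star_lang Z))
           \<lparr>carrier := syntactic_hom (star_lang Z) ` nonempty_words\<rparr>)"
    and "X = Z \<inter> F"
  shows "(charged F Z \<longleftrightarrow> G_rel F X \<cong> G_code Z \<and> weakly_charged F X) \<and>
    (G_rel F X \<cong> G_code Z \<and> weakly_charged F X \<longleftrightarrow>
     order (G_rel F X) = order (G_code Z) \<and> weakly_charged F X)"
proof -
  interpret recurrent_bifix_code F Z X
    using assms by unfold_locales
  \<comment> \<open>Isomorphic groups have the same order, which gives (2) implies (3); the two
    preceding lemmas give (1) implies (2) and (3) implies (1).\<close>
  have "order (G_rel F X) = order (G_code Z)" if "G_rel F X \<cong> G_code Z"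
    using iso_same_card[OF that] by (simp add: order_def)
  then show ?thesis
    using charged_imp_weakly_charged weakly_charged_imp_charged by blast
qed

end
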